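(* Let $F$ be a D$k$-graph with $b$ vertices and $f$ edges. For any $\varepsilon>0$ and integer $d\in[k-1]$ the following holds for all sufficiently large $n$ with $b\mid n$. Suppose $\mathbf{H}=\{H_1,\ldots,H_{nf/b}\}$ is an $n$-vertex D$k$-graph system on $V$. If $\delta^*_d(H_i)\ge(\max\{c^{\rm abs,*}_{d,F},c^{\rm cov,*}_{d,F}\}+\varepsilon)\binom{n-d}{k-d}$ for every $i\in[nf/b]$, then $\mathbf{H}$ admits a rainbow $F$-factor.
   Context: A directed $k$-graph (D$k$-graph) $H$ has edge set $E(H)\subseteq\binom{V(H)}{k}\times\{+,-\}$ (each edge is a $k$-set with a direction; e.g. a digraph is encoded via an ordering of the vertex set, arcs following the order getting $+$ and against it $-$). A D$k$-graph system is a collection $\mathbf{H}=\{H_1,\ldots,H_m\}$ of not necessarily distinct D$k$-graphs on the same vertex set, $H_i$ being the edges of colour $i$. A subgraph is rainbow if its edges can be assigned pairwise distinct colours $i$ with each edge of colour $i$ lying in $H_i$; its colour set is the set of colours used. An $F$-packing is a set of vertex-disjoint copies of $F$; an $F$-factor is an $F$-packing covering all vertices. A rainbow $F$-factor here has $nf/b$ edges and so uses each colour exactly once. Degree rule: $\delta^*_d$ is a fixed (implicit) minimum $d$-degree notion given as follows: there is $\ell\in\mathbb{N}$ such that to each $d$-set $S\subseteq V(H)$ is associated $N^*(S)=\{E_1,\ldots,E_\ell\}$, where each $E_j$ is a set of edges of $H$ containing $S$; $\deg^*(S)=\min_{j\in[\ell]}|E_j|$ and $\delta^*_d(H)=\min_{S\in\binom{V}{d}}\deg^*(S)$.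 The thresholds below are defined with respect to this same rule. Absorbers: for a $b$-set $B$, a D$k$-graph $A$ is an $F$-absorber for $B$ if $V(A)=B\,\dot\cup\, L$ and $E(A)=E_{\rm ext}\cup E_{\rm int}$ where $E_{\rm ext}$ forms an $F$-factor on $V(A)$ and $E_{\rm int}$ forms an $F$-factor on $L$. Given D$k$-graph systems $\mathbf{H}=\{H_1,\ldots,H_m\}$ and $\mathbf{H}'=\{H_1,\ldots,H_{m-f}\}$ on $V$ with $m=\frac{v(A)}{b}f$, a rainbow $F$-absorber for a $b$-set $B$ is a subgraph $\mathbf{A}$ with $E(\mathbf{A})=E_{\rm ext}\dot\cup E_{\rm int}$, $B$ disjoint from the vertices of $E_{\rm int}$, such that $\mathbf{A}[E_{\rm int}]$ is a rainbow $F$-packing with colour set $[m-f]$ and $\mathbf{A}[E_{\rm ext}]$ is a rainbow $F$-packing with colour set $[m]$. $c^{\rm abs,*}_{d,F}$: for a fixed $F$-absorber $A$ with $m=\frac{v(A)}{b}f$, let $c_{d,F,A}$ be the infimum of $c>0$ such that for every $\varepsilon>0$ there is $\varepsilon'>0$ such that for all sufficiently large $n$: if $\mathbf{H}=\{H_1,\ldots,H_m\}$ is an $n$-vertex D$k$-graph system on $V$ with $\delta^*_d(H_i)\ge(c+\varepsilon)\binom{n-d}{k-d}$ for all $i\in[m]$, then for every $b$-set $B\subseteq V$, $\mathbf{H}$ contains at least $\varepsilon' n^{v(A)-b}$ rainbow $F$-absorbers for $B$ whose underlying graph is isomorphic to $A$. Then $c^{\rm abs,*}_{d,F}=\inf_A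 c_{d,F,A}$ over all $F$-absorbers $A$. $c^{\rm cov,*}_{d,F}$: for an $n$-vertex D$k$-graph system $\mathbf{H}=\{H_1,\ldots,H_f\}$ on $V$, let $H_F$ be the $b$-uniform hypergraph on $V$ whose edges are the vertex sets $V(F')$ of rainbow copies $F'$ of $F$ with colour set $[f]$. $c^{\rm cov,*}_{d,F}$ is the infimum of $c>0$ such that for every $\varepsilon>0$ and every $n$-vertex D$k$-graph system $\{H_1,\ldots,H_f\}$ with $n$ sufficiently large and $\delta^*_d(H_i)\ge(c+\varepsilon)\binom{n-d}{k-d}$ for all $i\in[f]$, the $b$-graph $H_F$ has a perfect fractional matching (a weight function $w:E(H_F)\to[0,1]$ with $\sum_{e\ni v}w(e)=1$ for every vertex $v$).
   Formalization: The degree rule is additionally assumed compatible with induced subgraphs: an edge counted for S in H and contained in U ⊇ S is also counted for S in H[U]; for arbitrary rules the claim fails, and ordinary d-degree, semi-degree and total degree satisfy this. *)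

theory Defs
  imports Complex_Main
begin

datatype dir = Plus | Minus

fun opp :: "dir \<Rightarrow> dir" where
  "opp Plus = Minus"
| "opp Minus = Plus"

type_synonym 'v dedge = "'v set \<times> dir"

datatype 'v dkgraph = DK (verts: "'v set") (edges: "'v dedge set")

definition dkgraph :: "nat \<Rightarrow> 'v dkgraph \<Rightarrow> bool" where
  "dkgraph k H \<longleftrightarrow> finite (verts H) \<and> (\<forall>x\<in>edges H. fst x \<subseteq> verts H \<and> card (fst x) = k)"

definition induced :: "'v dkgraph \<Rightarrow> 'v set \<Rightarrow> 'v dkgraph" where
  "induced H U = DK (verts H \<inter> U) {x \<in> edges H. fst x \<subseteq> U}"

(* What a relabelling of the vertices does to a direction depends on what the
   directions encode.
   Absolute: the direction is a label of the edge and is kept.  An undirected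
   k-graph is the case where every edge is labelled Plus.
   Relative: the direction refers to the ordering of the vertices, so that it is
   reversed when the relabelling induces an odd permutation of the edge.  For
   k = 2, with Plus for the arcs following the ordering and Minus for those
   against it, this is the action on arcs of a digraph (carry_arc below). *)
datatype dir_conv = Absolute | Relative

definition inversions :: "('v::linorder \<Rightarrow> 'v) \<Rightarrow> 'v set \<Rightarrow> ('v \<times> 'v) set" where
  "inversions \<phi> e = {(x, y). x \<in> e \<and> y \<in> e \<and> x < y \<and> \<phi> y < \<phi> x}"

fun carry :: "dir_conv \<Rightarrow> ('v::linorder \<Rightarrow> 'v) \<Rightarrow> 'v dedge \<Rightarrow> 'v dedge" where
  "carry Absolute \<phi> (e, s) = (\<phi> ` e, s)"
| "carry Relative \<phi> (e, s) = (\<phi> ` e, if even (card (inversions \<phi> e)) then s else opp s)"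

definition arc :: "'v::linorder \<Rightarrow> 'v \<Rightarrow> 'v dedge" where
  "arc x y = ({x, y}, if x < y then Plus else Minus)"

lemma carry_arc:
  assumes "x \<noteq> y" "\<phi> x \<noteq> \<phi> y"
  shows "carry Relative \<phi> (arc x y) = arc (\<phi> x) (\<phi> y)"
proof -
  have "inversions \<phi> {x, y} =
      (if x < y \<and> \<phi> y < \<phi> x then {(x, y)} else if y < x \<and> \<phi> x < \<phi> y then {(y, x)} else {})"
    by (auto simp: inversions_def)
  then show ?thesis
    using assms by (auto simp: arc_def)
qed

definition isomorphic :: "dir_conv \<Rightarrow> 'v::linorder dkgraph \<Rightarrow> 'v dkgraph \<Rightarrow> bool" where
  "isomorphic cv G H \<longleftrightarrow>
     (\<exists>\<phi>. bij_betw \<phi> (verts G) (verts H) \<and> edges H = carry cv \<phi> ` edges G)"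

(* H 1, ..., H m are D k-graphs on the common vertex set V. *)
definition dk_system :: "nat \<Rightarrow> 'v set \<Rightarrow> nat \<Rightarrow> (nat \<Rightarrow> 'v dkgraph) \<Rightarrow> bool" where
  "dk_system k V m H \<longleftrightarrow> finite V \<and> (\<forall>i\<in>{1..m}. dkgraph k (H i) \<and> verts (H i) = V)"

(* The edges in E can be given pairwise distinct colours, C being the set of colours used. *)
definition rainbow :: "(nat \<Rightarrow> 'v dkgraph) \<Rightarrow> nat set \<Rightarrow> 'v dedge set \<Rightarrow> bool" where
  "rainbow H C E \<longleftrightarrow> (\<exists>col. bij_betw col E C \<and> (\<forall>x\<in>E. x \<in> edges (H (col x))))"

definition packing :: "dir_conv \<Rightarrow> 'v::linorder dkgraph \<Rightarrow> 'v dkgraph set \<Rightarrow> bool" where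
  "packing cv F P \<longleftrightarrow>
     (\<forall>G\<in>P. isomorphic cv F G) \<and> pairwise (\<lambda>G G'. disjnt (verts G) (verts G')) P"

definition factor_on :: "dir_conv \<Rightarrow> 'v::linorder dkgraph \<Rightarrow> 'v set \<Rightarrow> 'v dkgraph set \<Rightarrow> bool" where
  "factor_on cv F W P \<longleftrightarrow> packing cv F P \<and> (\<Union>G\<in>P. verts G) = W"

definition pack_edges :: "'v dkgraph set \<Rightarrow> 'v dedge set" where
  "pack_edges P = (\<Union>G\<in>P. edges G)"

definition has_rainbow_factor ::
  "dir_conv \<Rightarrow> 'v::linorder dkgraph \<Rightarrow> 'v set \<Rightarrow> nat \<Rightarrow> (nat \<Rightarrow> 'v dkgraph) \<Rightarrow> bool" where
  "has_rainbow_factor cv F V m H \<longleftrightarrow>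
     (\<exists>P. factor_on cv F V P \<and> rainbow H {1..m} (pack_edges P))"


(* N H S 1, ..., N H S l are the edge sets that the rule associates to the d-set S in H.
   The last conjunct expresses that the rule is one fixed notion applied uniformly to all
   host graphs: an edge counted for S in H is still counted for S in every induced
   subgraph containing it.  Without any such compatibility N could be an arbitrary
   function of H (for instance, empty unless H is one particular graph), and no
   transference between H and its subgraphs would be possible. *)
definition degree_rule ::
  "nat \<Rightarrow> nat \<Rightarrow> nat \<Rightarrow> ('v dkgraph \<Rightarrow> 'v set \<Rightarrow> nat \<Rightarrow> 'v dedge set) \<Rightarrow> bool" where
  "degree_rule k d l N \<longleftrightarrow> l \<ge> 1 \<and>
     (\<forall>H S j. dkgraph k H \<and> S \<subseteq> verts H \<and> card S = d \<and> j \<in> {1..l} \<longrightarrow>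
        N H S j \<subseteq> {x \<in> edges H. S \<subseteq> fst x} \<and>
        (\<forall>U. S \<subseteq> U \<and> U \<subseteq> verts H \<longrightarrow>
           {x \<in> N H S j. fst x \<subseteq> U} \<subseteq> N (induced H U) S j))"

(* Ordinary d-degree (R constantly true), semi-degree (l = 2, out- and in-arcs), etc. *)
lemma degree_rule_local:
  assumes "l \<ge> 1"
  shows "degree_rule k d l (\<lambda>H S j. {x \<in> edges H. S \<subseteq> fst x \<and> R S j x})"
  using assms by (auto simp: degree_rule_def induced_def)

definition rule_deg ::
  "nat \<Rightarrow> ('v dkgraph \<Rightarrow> 'v set \<Rightarrow> nat \<Rightarrow> 'v dedge set) \<Rightarrow> 'v dkgraph \<Rightarrow> 'v set \<Rightarrow> nat" where
  "rule_deg l N H S = Min ((\<lambda>j. card (N H S j)) ` {1..l})"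

definition min_rule_deg ::
  "nat \<Rightarrow> nat \<Rightarrow> ('v dkgraph \<Rightarrow> 'v set \<Rightarrow> nat \<Rightarrow> 'v dedge set) \<Rightarrow> 'v dkgraph \<Rightarrow> nat" where
  "min_rule_deg d l N H = Min (rule_deg l N H ` {S. S \<subseteq> verts H \<and> card S = d})"

(* H 1, ..., H m form an n-vertex system on V whose members all have minimum d-degree
   at least x times (n - d choose k - d). *)
definition dense_system ::
  "nat \<Rightarrow> nat \<Rightarrow> nat \<Rightarrow> ('v dkgraph \<Rightarrow> 'v set \<Rightarrow> nat \<Rightarrow> 'v dedge set) \<Rightarrow>
   real \<Rightarrow> nat \<Rightarrow> 'v set \<Rightarrow> nat \<Rightarrow> (nat \<Rightarrow> 'v dkgraph) \<Rightarrow> bool" where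
  "dense_system k d l N x n V m H \<longleftrightarrow> dk_system k V m H \<and> card V = n \<and>
     (\<forall>i\<in>{1..m}. real (min_rule_deg d l N (H i)) \<ge> x * real ((n - d) choose (k - d)))"


definition absorber_for ::
  "nat \<Rightarrow> dir_conv \<Rightarrow> 'v::linorder dkgraph \<Rightarrow> 'v set \<Rightarrow> 'v dkgraph \<Rightarrow> bool" where
  "absorber_for k cv F B A \<longleftrightarrow> dkgraph k A \<and> card B = card (verts F) \<and>
     (\<exists>L Pext Pint. verts A = B \<union> L \<and> B \<inter> L = {} \<and>
        edges A = pack_edges Pext \<union> pack_edges Pint \<and>
        factor_on cv F (verts A) Pext \<and> factor_on cv F L Pint)"

definition absorber_colours :: "'v dkgraph \<Rightarrow> 'v dkgraph \<Rightarrow> nat" where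
  "absorber_colours F A = card (verts A) * card (edges F) div card (verts F)"

definition rainbow_absorber ::
  "dir_conv \<Rightarrow> 'v::linorder dkgraph \<Rightarrow> 'v set \<Rightarrow> nat \<Rightarrow> (nat \<Rightarrow> 'v dkgraph) \<Rightarrow>
   'v set \<Rightarrow> 'v dkgraph \<Rightarrow> bool" where
  "rainbow_absorber cv F V m H B G \<longleftrightarrow> verts G \<subseteq> V \<and> card B = card (verts F) \<and>
     (\<exists>L Pext Pint. verts G = B \<union> L \<and> B \<inter> L = {} \<and>
        edges G = pack_edges Pext \<union> pack_edges Pint \<and> pack_edges Pext \<inter> pack_edges Pint = {} \<and>
        factor_on cv F (verts G) Pext \<and> rainbow H {1..m} (pack_edges Pext) \<and>
        factor_on cv F L Pint \<and> rainbow H {1..m - card (edges F)} (pack_edges Pint))"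

(* Inf is taken in the reals.  If F has a vertex, the sets below are nonempty: every
   c > 2 belongs to the sets defining c_abs_of and c_cov (no degree exceeds
   2 * (n - d choose k - d)), or every c > 0 if F has no edges; and F is itself an
   F-absorber, with L empty. *)
definition c_abs_of ::
  "nat \<Rightarrow> nat \<Rightarrow> nat \<Rightarrow> ('v dkgraph \<Rightarrow> 'v set \<Rightarrow> nat \<Rightarrow> 'v dedge set) \<Rightarrow>
   dir_conv \<Rightarrow> 'v::linorder dkgraph \<Rightarrow> 'v dkgraph \<Rightarrow> real" where
  "c_abs_of k d l N cv F A = Inf {c. c > 0 \<and>
     (\<forall>\<epsilon>>0. \<exists>\<epsilon>'>0. \<forall>\<^sub>F n in sequentially. \<forall>V H.
        dense_system k d l N (c + \<epsilon>) n V (absorber_colours F A) H \<longrightarrow>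
        (\<forall>B. B \<subseteq> V \<and> card B = card (verts F) \<longrightarrow>
           real (card {G. rainbow_absorber cv F V (absorber_colours F A) H B G \<and> isomorphic cv A G})
             \<ge> \<epsilon>' * real n ^ (card (verts A) - card (verts F))))}"

definition c_abs ::
  "nat \<Rightarrow> nat \<Rightarrow> nat \<Rightarrow> ('v dkgraph \<Rightarrow> 'v set \<Rightarrow> nat \<Rightarrow> 'v dedge set) \<Rightarrow>
   dir_conv \<Rightarrow> 'v::linorder dkgraph \<Rightarrow> real" where
  "c_abs k d l N cv F = Inf {c_abs_of k d l N cv F A | A. \<exists>B. absorber_for k cv F B A}"

definition copy_sets ::
  "dir_conv \<Rightarrow> 'v::linorder dkgraph \<Rightarrow> 'v set \<Rightarrow> (nat \<Rightarrow> 'v dkgraph) \<Rightarrow> 'v set set" where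
  "copy_sets cv F V H = {verts G | G. isomorphic cv F G \<and> verts G \<subseteq> V \<and>
     rainbow H {1..card (edges F)} (edges G)}"

definition perfect_fractional_matching ::
  "'v set \<Rightarrow> 'v set set \<Rightarrow> ('v set \<Rightarrow> real) \<Rightarrow> bool" where
  "perfect_fractional_matching V K w \<longleftrightarrow>
     (\<forall>e\<in>K. 0 \<le> w e \<and> w e \<le> 1) \<and> (\<forall>v\<in>V. (\<Sum>e | e \<in> K \<and> v \<in> e. w e) = 1)"

definition c_cov ::
  "nat \<Rightarrow> nat \<Rightarrow> nat \<Rightarrow> ('v dkgraph \<Rightarrow> 'v set \<Rightarrow> nat \<Rightarrow> 'v dedge set) \<Rightarrow>
   dir_conv \<Rightarrow> 'v::linorder dkgraph \<Rightarrow> real" where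
  "c_cov k d l N cv F = Inf {c. c > 0 \<and>
     (\<forall>\<epsilon>>0. \<forall>\<^sub>F n in sequentially. \<forall>V H.
        dense_system k d l N (c + \<epsilon>) n V (card (edges F)) H \<longrightarrow>
        (\<exists>w. perfect_fractional_matching V (copy_sets cv F V H) w))}"

end

theory Submission
  imports Defs "HOL-Library.Ramsey" "HOL-Library.Disjoint_Sets"
begin

text \<open>
  The proof is by absorption. Each absorber for a $b$-set $B$ and an $f$-set $C$ of colours is a pair
  $(L, D)$ of vertices and colours such that both $L$ and $B \cup L$ have rainbow $F$-factors, with
  colour sets $D$ and $C \cup D$; a positive proportion of all pairs $(L, D)$ absorb a given $(B, C)$.
  Pairwise disjoint pairs absorbing every $(B, C)$ linearly often are chosen one by one so that the
  potential $\sum_{(B, C)} 2^{-a(B, C)}$ decays geometrically, $a(B, C)$ being the number of chosen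
  pairs that absorb $(B, C)$.

  The remaining vertices are covered almost completely without a nibble. The remaining colours are
  split into $f$-sets in advance, and step $s$ uses the $s$-th of them. Let $Q$ be a large constant.
  By concentration almost all $Q$-sets $U$ inherit the degree condition, and on such a $U$ the copies
  of $F$ in the colours of step $s$ have a perfect fractional matching. Choosing a uniformly random
  $Q$-subset of the remaining vertices and then a copy according to this matching (an arbitrary
  $b$-set if $U$ is degenerate) removes each remaining vertex with the same probability. Hence the
  proportion of degenerate $Q$-sets is almost a supermartingale, and the expected number of wasted
  steps stays small; averaging makes the process deterministic.
\<close>

section \<open>Concentration for random subsets\<close>

text \<open>The covering threshold only concerns systems of f colours, while all nf/b colours have
  to be used; serving each block of f colours on vertex sets of constant size Q turns every step
  into an instance of that threshold. Vertex-uniformity keeps the steps from spoiling each other.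
  Removing a random b-set from R spares a fixed Q-set with probability at most 1 - bQ/|R| +
  O(1/|R|^2), and the proportion of all Q-sets that are spared is also 1 - bQ/|R| up to O(1/|R|^2).
  So the density of any family of Q-sets grows in expectation by a factor of at most 1 + O(1/|R|^2),
  and as long as linearly many vertices remain, linearly many such factors multiply to a bounded
  constant. Constants are fixed in this order: \<alpha>, the density of absorbing pairs; \<gamma>,
  with about \<gamma> n absorbers selected; \<mu> = \<alpha> \<gamma> / 64, governing both the
  uncovered part and the failed steps; Q; and finally n. The relation between them is that the
  leftover, about 2 \<mu> n blocks, must stay below the roughly \<alpha> \<gamma> n / 8 absorbers
  guaranteed to every pair (B, C).\<close>

lemma mem_nsets_iff: "finite X \<Longrightarrow> A \<in> nsets X q \<longleftrightarrow> A \<subseteq> X \<and> card A = q"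
  by (auto simp: nsets_def intro: finite_subset)

text \<open>For a variable of mean zero this bounds the exponential moment by one plus the square of
  a bound on the variable, the one-step estimate of \<open>nsets_exp_moment\<close>. For negative
  arguments it comes from inverting a Taylor lower bound for exp(-x).\<close>

lemma exp_le_quadratic:
  fixes x :: real
  assumes "\<bar>x\<bar> \<le> 1"
  shows "exp x \<le> 1 + x + x\<^sup>2"
proof (cases "x \<ge> 0")
  case True
  then show ?thesis using assms exp_bound by auto
next
  case False
  define y where "y = - x"
  have y: "0 \<le> y" "y \<le> 1" using False assms by (auto simp: y_def)
  have "1 + y + y\<^sup>2 / 2 \<le> exp y" using exp_lower_Taylor_quadratic y by blast
  moreover have "1 \<le> (1 + y + y\<^sup>2 / 2) * (1 - y + y\<^sup>2)"
  proof -
    have "(1 + y + y\<^sup>2 / 2) * (1 - y + y\<^sup>2) = 1 + y^2 / 2 + y^3/2 + y^4 / 2"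
      by (simp add: field_simps power2_eq_square power3_eq_cube power4_eq_xxxx)
    then show ?thesis using y by auto
  qed
  moreover have "0 \<le> 1 - y + y\<^sup>2" using y by auto
  ultimately have "1 \<le> exp y * (1 - y + y\<^sup>2)"
    by (meson mult_right_mono order_trans)
  then have "exp (-y) * 1 \<le> exp (-y) * (exp y * (1 - y + y\<^sup>2))"
    by (intro mult_left_mono) auto
  also have "\<dots> = 1 - y + y\<^sup>2"
    by (simp add: mult.assoc[symmetric] exp_minus_inverse mult.commute)
  finally show ?thesis by (simp add: y_def)
qed

text \<open>A set of size q + 1 can be generated by revealing one of its elements first; it arises
  once from each of its q + 1 elements.\<close>

lemma sum_nsets_insert:
  fixes G :: "'a set \<Rightarrow> real"
  assumes "finite X"
  shows "(\<Sum>v\<in>X. \<Sum>A\<in>nsets (X - {v}) q. G (insert v A)) = (Suc q) * (\<Sum>A\<in>nsets X (Suc q). G A)"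
proof -
  have "(\<Sum>v\<in>X. \<Sum>A\<in>nsets (X - {v}) q. G (insert v A))
      = (\<Sum>(v, A)\<in>Sigma X (\<lambda>v. nsets (X - {v}) q). G (insert v A))"
    using assms by (subst sum.Sigma) (auto intro: finite_imp_finite_nsets)
  also have "\<dots> = (\<Sum>(A, v)\<in>Sigma (nsets X (Suc q)) (\<lambda>A. A). G A)"
    by (rule sum.reindex_bij_witness[of _ "\<lambda>(A, v). (v, A - {v})" "\<lambda>(v, A). (insert v A, v)"])
      (use assms in \<open>auto simp: nsets_def card_insert_if\<close>)
  also have "\<dots> = (\<Sum>A\<in>nsets X (Suc q). \<Sum>v\<in>A. G A)"
    using assms by (subst sum.Sigma) (auto intro: finite_imp_finite_nsets simp: nsets_def)
  also have "\<dots> = (\<Sum>A\<in>nsets X (Suc q). Suc q * G A)"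
    by (intro sum.cong) (auto simp: nsets_def)
  finally show ?thesis by (simp add: sum_distrib_left)
qed

text \<open>Expectation at a uniformly random \<open>q\<close>-subset, kept as a finite average so
  that no probability space is needed.\<close>

definition nsets_avg :: "'a set \<Rightarrow> nat \<Rightarrow> ('a set \<Rightarrow> real) \<Rightarrow> real" where
  "nsets_avg X q g = (\<Sum>A\<in>nsets X q. g A) / (card X choose q)"

text \<open>Tower rule: condition on the first revealed element. The normalising binomials match by
  \<open>binomial_absorption\<close>.\<close>

lemma nsets_avg_insert:
  assumes X: "finite X" and q: "Suc q \<le> card X"
  shows "nsets_avg X (Suc q) g = (\<Sum>v\<in>X. nsets_avg (X - {v}) q (\<lambda>A. g (insert v A))) / card X"
proof -
  have "(\<Sum>v\<in>X. nsets_avg (X - {v}) q (\<lambda>A. g (insert v A)))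
      = (\<Sum>v\<in>X. \<Sum>A\<in>nsets (X - {v}) q. g (insert v A)) / (card X - 1 choose q)"
    using X by (simp add: nsets_avg_def sum_divide_distrib)
  also have "\<dots> = (Suc q) * (\<Sum>A\<in>nsets X (Suc q). g A) / (card X - 1 choose q)"
    using sum_nsets_insert[OF X] by metis
  finally have 1: "(\<Sum>v\<in>X. nsets_avg (X - {v}) q (\<lambda>A. g (insert v A)))
    = (Suc q) * (\<Sum>A\<in>nsets X (Suc q). g A) / (card X - 1 choose q)" .
  have 2: "Suc q * (card X choose Suc q) = card X * (card X - 1 choose q)"
    by (rule binomial_absorption)
  have 3: "real (Suc q) * real (card X choose Suc q) = real (card X) * real (card X - 1 choose q)"
    using 2 by (metis of_nat_mult)
  have "real (card X choose Suc q) > 0" "real (card X - 1 choose q) > 0" "real (card X) > 0"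
    using q by auto
  then show ?thesis unfolding 1 unfolding nsets_avg_def
    using 3 by (simp add: frac_eq_eq mult_ac)
qed

text \<open>The bounded-difference condition of the martingale that reveals a random subset element
  by element: conditional expectations given two different first elements differ by at most the cost
  of exchanging one element.\<close>

lemma nsets_avg_swap:
  assumes X: "finite X" and u: "u \<in> X" and v: "v \<in> X" and q: "Suc q \<le> card X"
    and lip: "\<And>A u v. A \<subseteq> X \<Longrightarrow> card A = q \<Longrightarrow> u \<in> X - A \<Longrightarrow> v \<in> X - A \<Longrightarrow>
       \<bar>g (insert u A) - g (insert v A)\<bar> \<le> (c::real)" and c: "c \<ge> 0"
  shows "\<bar>nsets_avg (X - {u}) q (\<lambda>A. g (insert u A)) - nsets_avg (X - {v}) q (\<lambda>A. g (insert v A))\<bar> \<le> c"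
proof (cases "u = v")
  case True
  then show ?thesis using c by simp
next
  case False
  \<comment> \<open>exchanging \<open>u\<close> and \<open>v\<close> couples the random subsets of \<open>X - {v}\<close> and \<open>X - {u}\<close>\<close>
  define t where "t u v A = (if u \<in> A then insert v (A - {u}) else A)" for u v :: 'a and A
  have tt: "t u v A \<in> nsets (X - {u}) q" if "A \<in> nsets (X - {v}) q" "u \<in> X" "v \<in> X" for A u v
    using that X by (auto simp: t_def mem_nsets_iff card_insert_if card_Diff_singleton_if finite_subset
        intro: Suc_pred) (metis Diff_empty Diff_insert0 Suc_pred card_gt_0_iff finite_Diff finite_subset insert_absorb insert_not_empty subset_Diff_insert)+
  have inv: "t v u (t u v A) = A" if "A \<in> nsets (X - {v}) q" for A u v
    using that X by (auto simp: t_def mem_nsets_iff)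
  have "(\<Sum>A\<in>nsets (X - {u}) q. g (insert u A)) = (\<Sum>A\<in>nsets (X - {v}) q. g (insert u (t u v A)))"
    by (rule sum.reindex_bij_witness[of _ "t u v" "t v u"]) (use u v tt inv in auto)
  then have "(\<Sum>A\<in>nsets (X - {u}) q. g (insert u A)) - (\<Sum>A\<in>nsets (X - {v}) q. g (insert v A))
     = (\<Sum>A\<in>nsets (X - {v}) q. g (insert u (t u v A)) - g (insert v A))"
    by (simp add: sum_subtractf)
  also have "\<bar>\<dots>\<bar> \<le> (\<Sum>A\<in>nsets (X - {v}) q. c)"
  proof (rule order_trans[OF sum_abs], rule sum_mono)
    fix A assume A: "A \<in> nsets (X - {v}) q"
    show "\<bar>g (insert u (t u v A)) - g (insert v A)\<bar> \<le> c"
    proof (cases "u \<in> A")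
      case True
      then have "insert u (t u v A) = insert v A" by (auto simp: t_def)
      then show ?thesis using c by simp
    next
      case False
      then show ?thesis using A X u v by (auto simp: t_def mem_nsets_iff intro!: lip)
    qed
  qed
  also have "\<dots> = c * (card X - 1 choose q)" using X v by simp
  finally have 1: "\<bar>(\<Sum>A\<in>nsets (X - {u}) q. g (insert u A)) - (\<Sum>A\<in>nsets (X - {v}) q. g (insert v A))\<bar>
     \<le> c * (card X - 1 choose q)" .
  have p: "real (card X - 1 choose q) > 0" using q by simp
  have "nsets_avg (X - {u}) q (\<lambda>A. g (insert u A)) - nsets_avg (X - {v}) q (\<lambda>A. g (insert v A))
    = ((\<Sum>A\<in>nsets (X - {u}) q. g (insert u A)) - (\<Sum>A\<in>nsets (X - {v}) q. g (insert v A))) / (card X - 1 choose q)"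
    using X u v by (simp add: nsets_avg_def diff_divide_distrib)
  also have "\<bar>\<dots>\<bar> \<le> c" using 1 p by (simp add: field_simps abs_mult)
  finally show ?thesis .
qed

text \<open>An Azuma-Hoeffding moment bound for sampling without replacement. Induction on
  \<open>q\<close> reveals one element at a time, each at the price of a factor exp((lam c)^2).
  Stating the exchange condition with \<open>Suc (card A) = q\<close> makes it vacuous for q = 0 and
  lets it pass to \<open>X - {v}\<close>.\<close>

lemma nsets_exp_moment:
  fixes g :: "'a set \<Rightarrow> real"
  assumes X: "finite X" and q: "q \<le> card X" and c: "c \<ge> 0" and lam: "0 \<le> lam" "lam * c \<le> 1"
    and lip: "\<And>A u v. A \<subseteq> X \<Longrightarrow> Suc (card A) = q \<Longrightarrow> u \<in> X - A \<Longrightarrow> v \<in> X - A \<Longrightarrow>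
       \<bar>g (insert u A) - g (insert v A)\<bar> \<le> (c::real)"
  shows "(\<Sum>A\<in>nsets X q. exp (lam * (nsets_avg X q g - g A))) \<le> (card X choose q) * exp (q * (lam * c)\<^sup>2)"
  using X q lip
proof (induction q arbitrary: X g)
  case 0
  then show ?case by (simp add: nsets_avg_def)
next
  case (Suc q)
  define E where "E = exp (q * (lam * c)\<^sup>2)"
  define m where "m v = nsets_avg (X - {v}) q (\<lambda>A. g (insert v A))" for v
  define M where "M = nsets_avg X (Suc q) g"
  have N: "real (card X) > 0" using Suc.prems by auto
  have M: "M * card X = (\<Sum>v\<in>X. m v)"
    unfolding M_def m_def using nsets_avg_insert[OF Suc.prems(1,2)] N by simp
  have mm: "\<bar>m u - m v\<bar> \<le> c" if "u \<in> X" "v \<in> X" for u v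
    unfolding m_def by (rule nsets_avg_swap) (use that Suc.prems c in auto)
  \<comment> \<open>\<open>M\<close> is the mean of the values of \<open>m\<close>, so it is as
    close to each of them as they are to one another.\<close>
  have Mm: "\<bar>M - m v\<bar> \<le> c" if v: "v \<in> X" for v
  proof -
    have "(M - m v) * card X = (\<Sum>u\<in>X. m u - m v)"
      using M by (simp add: sum_subtractf left_diff_distrib)
    also have "\<bar>\<dots>\<bar> \<le> (\<Sum>u\<in>X. c)"
      by (rule order_trans[OF sum_abs], rule sum_mono) (use mm v in auto)
    finally have "\<bar>M - m v\<bar> * card X \<le> c * card X" by (simp add: abs_mult mult.commute)
    then show ?thesis using N by simp
  qed
  have IH: "(\<Sum>A\<in>nsets (X - {v}) q. exp (lam * (m v - g (insert v A)))) \<le> (card X - 1 choose q) * E"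
    if v: "v \<in> X" for v
  proof -
    have "(\<Sum>A\<in>nsets (X - {v}) q. exp (lam * (nsets_avg (X - {v}) q (\<lambda>A. g (insert v A)) - g (insert v A))))
       \<le> (card (X - {v}) choose q) * E"
      unfolding E_def
    proof (rule Suc.IH)
      show "finite (X - {v})" "q \<le> card (X - {v})" using Suc.prems v by auto
      fix A a b assume *: "A \<subseteq> X - {v}" "Suc (card A) = q" "a \<in> X - {v} - A" "b \<in> X - {v} - A"
      have "Suc (card (insert v A)) = Suc q" using * Suc.prems(1)
        by (subst card_insert_disjoint) (auto intro: finite_subset)
      then have "\<bar>g (insert a (insert v A)) - g (insert b (insert v A))\<bar> \<le> c"
        using * v by (intro Suc.prems(3)) auto
      then show "\<bar>g (insert v (insert a A)) - g (insert v (insert b A))\<bar> \<le> c"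
        by (simp add: insert_commute)
    qed
    then show ?thesis using v Suc.prems(1) by (simp add: m_def)
  qed
  have "Suc q * (\<Sum>A\<in>nsets X (Suc q). exp (lam * (M - g A)))
      = (\<Sum>v\<in>X. \<Sum>A\<in>nsets (X - {v}) q. exp (lam * (M - g (insert v A))))"
    using sum_nsets_insert[OF Suc.prems(1), where q = q and G = "\<lambda>A. exp (lam * (M - g A))"] by simp
  also have "\<dots> = (\<Sum>v\<in>X. exp (lam * (M - m v)) * (\<Sum>A\<in>nsets (X - {v}) q. exp (lam * (m v - g (insert v A)))))"
    by (simp add: sum_distrib_left exp_add[symmetric] algebra_simps)
  also have "\<dots> \<le> (\<Sum>v\<in>X. exp (lam * (M - m v)) * ((card X - 1 choose q) * E))"
    by (intro sum_mono mult_left_mono IH) auto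
  also have "\<dots> = (\<Sum>v\<in>X. exp (lam * (M - m v))) * ((card X - 1 choose q) * E)"
    by (simp add: sum_distrib_right)
  also have "\<dots> \<le> (card X * exp ((lam * c)\<^sup>2)) * ((card X - 1 choose q) * E)"
  proof (rule mult_right_mono)
    have "(\<Sum>v\<in>X. exp (lam * (M - m v))) \<le> (\<Sum>v\<in>X. 1 + lam * (M - m v) + (lam * c)\<^sup>2)"
    proof (rule sum_mono)
      fix v assume v: "v \<in> X"
      have a: "\<bar>lam * (M - m v)\<bar> \<le> lam * c"
        using Mm[OF v] lam by (simp add: abs_mult mult_left_mono)
      then have "exp (lam * (M - m v)) \<le> 1 + lam * (M - m v) + (lam * (M - m v))\<^sup>2"
        using lam by (intro exp_le_quadratic) auto
      moreover have "(lam * (M - m v))\<^sup>2 \<le> (lam * c)\<^sup>2"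
        using a by (metis abs_ge_zero power2_abs power_mono)
      ultimately show "exp (lam * (M - m v)) \<le> 1 + lam * (M - m v) + (lam * c)\<^sup>2" by simp
    qed
    \<comment> \<open>The linear terms cancel in the sum because \<open>M\<close> is the mean of
      \<open>m\<close>; only the quadratic term is left.\<close>
    also have "\<dots> = card X * (1 + (lam * c)\<^sup>2) + lam * (M * card X - (\<Sum>v\<in>X. m v))"
      by (simp add: sum.distrib sum_subtractf sum_distrib_left[symmetric] algebra_simps)
    also have "\<dots> \<le> card X * exp ((lam * c)\<^sup>2)"
      using M by (simp add: mult_left_mono)
    finally show "(\<Sum>v\<in>X. exp (lam * (M - m v))) \<le> card X * exp ((lam * c)\<^sup>2)" .
  qed (simp add: E_def)
  also have "\<dots> = (card X * (card X - 1 choose q)) * exp (Suc q * (lam * c)\<^sup>2)"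
    by (simp add: E_def exp_add[symmetric] algebra_simps)
  also have "card X * (card X - 1 choose q) = Suc q * (card X choose Suc q)"
    by (metis binomial_absorption)
  finally have "real (Suc q) * (\<Sum>A\<in>nsets X (Suc q). exp (lam * (M - g A)))
     \<le> real (Suc q) * ((card X choose Suc q) * exp (Suc q * (lam * c)\<^sup>2))"
    by (simp only: of_nat_mult mult.assoc)
  then show ?case unfolding M_def by (subst (asm) mult_le_cancel_left_pos) auto
qed

text \<open>Markov's inequality for the exponential moment; \<open>lam\<close> is left free for the
  caller to optimise.\<close>

lemma nsets_lower_tail:
  assumes X: "finite X" and q: "q \<le> card X" and c: "c \<ge> 0" and lam: "0 \<le> lam" "lam * c \<le> 1"
    and lip: "\<And>A u v. A \<subseteq> X \<Longrightarrow> Suc (card A) = q \<Longrightarrow> u \<in> X - A \<Longrightarrow> v \<in> X - A \<Longrightarrow>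
       \<bar>g (insert u A) - g (insert v A)\<bar> \<le> (c::real)"
  shows "card {A \<in> nsets X q. g A \<le> nsets_avg X q g - t}
    \<le> (card X choose q) * exp (q * (lam * c)\<^sup>2 - lam * t)"
proof -
  have fin: "finite (nsets X q)" using X by (rule finite_imp_finite_nsets)
  have "card {A \<in> nsets X q. g A \<le> nsets_avg X q g - t} * exp (lam * t)
     = (\<Sum>A\<in>{A \<in> nsets X q. g A \<le> nsets_avg X q g - t}. exp (lam * t))" by simp
  also have "\<dots> \<le> (\<Sum>A\<in>{A \<in> nsets X q. g A \<le> nsets_avg X q g - t}. exp (lam * (nsets_avg X q g - g A)))"
    using lam by (intro sum_mono) (auto intro!: mult_left_mono)
  also have "\<dots> \<le> (\<Sum>A\<in>nsets X q. exp (lam * (nsets_avg X q g - g A)))"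
    using fin by (intro sum_mono2) auto
  also have "\<dots> \<le> (card X choose q) * exp (q * (lam * c)\<^sup>2)"
    by (rule nsets_exp_moment) (use assms in auto)
  finally show ?thesis by (simp add: exp_diff field_simps)
qed


section \<open>Number of members of a set family inside a random subset\<close>

lemma binomial_le_power: "(n choose k) \<le> n ^ k"
  using binomial_fact_pow[of n k] by (metis fact_ge_1 le_trans mult.right_neutral mult_le_mono2)

lemma card_nsets_superset:
  assumes X: "finite X" and T: "T \<subseteq> X" "card T \<le> q"
  shows "card {A \<in> nsets X q. T \<subseteq> A} = (card X - card T choose (q - card T))"
proof -
  have fT: "finite T" using X T finite_subset by blast
  have "bij_betw (\<lambda>A. A \<union> T) (nsets (X - T) (q - card T)) {A \<in> nsets X q. T \<subseteq> A}"
    by (rule bij_betw_byWitness[where f' = "\<lambda>A. A - T"])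
      (use X T fT in \<open>auto simp: nsets_def card_Un_disjoint card_Diff_subset Int_Diff
         Diff_disjoint disjoint_iff intro!: card_Un_disjoint[THEN trans]\<close>)
  then have "card {A \<in> nsets X q. T \<subseteq> A} = card (nsets (X - T) (q - card T))"
    by (metis bij_betw_same_card)
  then show ?thesis using T fT by (simp add: card_Diff_subset)
qed

text \<open>Linearity of expectation: by \<open>choose_mult\<close>, each r-set lies in the random
  subset with probability (q choose r) / (|X| choose r).\<close>

lemma nsets_avg_count:
  assumes X: "finite X" and I: "finite I" and r: "r \<le> q" "q \<le> card X"
    and tau: "\<And>x. x \<in> I \<Longrightarrow> \<tau> x \<subseteq> X \<and> card (\<tau> x) = r"
  shows "nsets_avg X q (\<lambda>A. card {x \<in> I. \<tau> x \<subseteq> A}) = card I * (q choose r) / (card X choose r)"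
proof -
  have fin: "finite (nsets X q)" using X by (rule finite_imp_finite_nsets)
  have "(\<Sum>A\<in>nsets X q. card {x \<in> I. \<tau> x \<subseteq> A}) = (\<Sum>x\<in>I. card {A \<in> nsets X q. \<tau> x \<subseteq> A})"
    using I fin by (intro sum_multicount_gen) auto
  also have "\<dots> = card I * (card X - r choose (q - r))"
    using card_nsets_superset[OF X] tau r by simp
  finally have 1: "(\<Sum>A\<in>nsets X q. card {x \<in> I. \<tau> x \<subseteq> A}) = card I * (card X - r choose (q - r))" .
  have 2: "(card X choose q) * (q choose r) = (card X choose r) * (card X - r choose (q - r))"
    using choose_mult[of r q "card X"] r by simp
  have 3: "real (card X choose q) * (q choose r) = (card X choose r) * (card X - r choose (q - r))"
    using 2 by (metis of_nat_mult)
  have p: "real (card X choose q) > 0" "real (card X choose r) > 0" using r by auto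
  have "nsets_avg X q (\<lambda>A. card {x \<in> I. \<tau> x \<subseteq> A}) = card I * (card X - r choose (q - r)) / (card X choose q)"
    by (simp only: nsets_avg_def 1 flip: of_nat_sum of_nat_mult)
  also have "\<dots> = card I * (q choose r) / (card X choose r)"
    using p 3 by (simp add: field_simps)
  finally show ?thesis .
qed

text \<open>Allowing every set to occur twice accommodates the two directions of an edge. In the
  application \<open>X\<close> is a vertex set without a fixed d-set, and \<open>r\<close> is k -
  d.\<close>

lemma nsets_count_lower_tail:
  fixes \<tau> :: "'i \<Rightarrow> 'a set"
  assumes X: "finite X" and I: "finite I" and r: "1 \<le> r" "r \<le> q" "q \<le> card X"
    and tau: "\<And>x. x \<in> I \<Longrightarrow> \<tau> x \<subseteq> X \<and> card (\<tau> x) = r"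
    and mult: "\<And>T. card {x \<in> I. \<tau> x = T} \<le> 2"
    and eps: "0 < \<epsilon>" "\<epsilon> \<le> 1"
  shows "card {A \<in> nsets X q. card {x \<in> I. \<tau> x \<subseteq> A} \<le> (card I / (card X choose r) - \<epsilon>) * (q choose r)}
    \<le> (card X choose q) * exp (- (\<epsilon>\<^sup>2 * q / (16 * r\<^sup>2)))"
proof -
  define g where "g A = real (card {x \<in> I. \<tau> x \<subseteq> A})" for A
  \<comment> \<open>Adding \<open>u\<close> to a (q - 1)-set creates at most this many new indices:
    r - 1 of the q - 1 other elements determine \<open>\<tau> x\<close>, and each value occurs at
    most twice. An exchange hence changes \<open>g\<close> by at most \<open>c\<close>.\<close>
  define c where "c = 2 * real (q - 1 choose (r - 1))"
  \<comment> \<open>With lam = \<eta> / c and (q choose r) = q c / (2 r), the exponent is q \<eta>^2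
    - \<eta> \<epsilon> q / (2 r), which this \<eta> minimises.\<close>
  define \<eta> where "\<eta> = \<epsilon> / (4 * r)"
  have c0: "c > 0" using r by (simp add: c_def)
  have split: "g (insert u A) = g A + card {x \<in> I. \<tau> x \<subseteq> insert u A \<and> u \<in> \<tau> x}" if "u \<notin> A" for u A
  proof -
    have "{x \<in> I. \<tau> x \<subseteq> insert u A} = {x \<in> I. \<tau> x \<subseteq> A} \<union> {x \<in> I. \<tau> x \<subseteq> insert u A \<and> u \<in> \<tau> x}"
      using that by auto
    then have "card {x \<in> I. \<tau> x \<subseteq> insert u A} = card {x \<in> I. \<tau> x \<subseteq> A} + card {x \<in> I. \<tau> x \<subseteq> insert u A \<and> u \<in> \<tau> x}"
      using I that by (simp, subst card_Un_disjoint) auto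
    then show ?thesis by (simp add: g_def)
  qed
  have small: "card {x \<in> I. \<tau> x \<subseteq> insert u A \<and> u \<in> \<tau> x} \<le> c"
    if A: "A \<subseteq> X" "Suc (card A) = q" "u \<in> X - A" for u A
  proof -
    have fA: "finite A" using A X finite_subset by blast
    have "{x \<in> I. \<tau> x \<subseteq> insert u A \<and> u \<in> \<tau> x} \<subseteq> (\<Union>T\<in>nsets A (r - 1). {x \<in> I. \<tau> x = insert u T})"
    proof
      fix x assume x: "x \<in> {x \<in> I. \<tau> x \<subseteq> insert u A \<and> u \<in> \<tau> x}"
      then have "\<tau> x - {u} \<in> nsets A (r - 1)" "\<tau> x = insert u (\<tau> x - {u})"
        using tau[of x] fA by (auto simp: mem_nsets_iff)
      then show "x \<in> (\<Union>T\<in>nsets A (r - 1). {x \<in> I. \<tau> x = insert u T})" using x by blast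
    qed
    then have "card {x \<in> I. \<tau> x \<subseteq> insert u A \<and> u \<in> \<tau> x}
        \<le> card (\<Union>T\<in>nsets A (r - 1). {x \<in> I. \<tau> x = insert u T})"
      using I fA by (intro card_mono) (auto intro: finite_imp_finite_nsets)
    also have "\<dots> \<le> (\<Sum>T\<in>nsets A (r - 1). card {x \<in> I. \<tau> x = insert u T})"
      using fA by (intro card_UN_le finite_imp_finite_nsets)
    also have "\<dots> \<le> (\<Sum>T\<in>nsets A (r - 1). 2)" by (intro sum_mono mult)
    also have "\<dots> = 2 * (q - 1 choose (r - 1))" using A by (simp flip: A(2))
    finally show ?thesis by (simp add: c_def)
  qed
  have lip: "\<bar>g (insert u A) - g (insert v A)\<bar> \<le> c"
    if "A \<subseteq> X" "Suc (card A) = q" "u \<in> X - A" "v \<in> X - A" for u v A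
    using split[of u A] split[of v A] small[of A u] small[of A v] that by (auto simp: abs_le_iff)
  have \<eta>: "0 \<le> \<eta>" "\<eta> \<le> 1" using eps r by (auto simp: \<eta>_def field_simps)
  have avg: "nsets_avg X q g = card I * (q choose r) / (card X choose r)"
    unfolding g_def by (rule nsets_avg_count) (use assms in auto)
  have "card {A \<in> nsets X q. g A \<le> nsets_avg X q g - \<epsilon> * (q choose r)}
     \<le> (card X choose q) * exp (q * (\<eta> / c * c)\<^sup>2 - \<eta> / c * (\<epsilon> * (q choose r)))"
    by (rule nsets_lower_tail) (use X r c0 \<eta> lip in auto)
  moreover have "q * (\<eta> / c * c)\<^sup>2 - \<eta> / c * (\<epsilon> * (q choose r)) = - (\<epsilon>\<^sup>2 * q / (16 * r\<^sup>2))"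
  proof -
    have "r * (q choose r) = q * (q - 1 choose (r - 1))"
      using times_binomial_minus1_eq[of r q] r by simp
    then have "real r * (q choose r) = q * (c / 2)" by (simp add: c_def flip: of_nat_mult)
    then have "real (q choose r) = q * c / (2 * r)" using r by (simp add: field_simps)
    then have "\<eta> / c * (\<epsilon> * (q choose r)) = \<eta> * \<epsilon> * q / (2 * r)"
      using c0 by simp
    moreover have "\<eta> / c * c = \<eta>" using c0 by simp
    ultimately have "q * (\<eta> / c * c)\<^sup>2 - \<eta> / c * (\<epsilon> * (q choose r)) = q * \<eta>\<^sup>2 - \<eta> * \<epsilon> * q / (2 * r)"
      by (simp only:)
    also have "\<dots> = - (\<epsilon>\<^sup>2 * q / (16 * r\<^sup>2))"
    proof -
      have "q * \<eta>\<^sup>2 = \<epsilon>\<^sup>2 * q / (16 * r\<^sup>2)"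
        by (simp add: \<eta>_def power_divide power_mult_distrib)
      moreover have "\<eta> * \<epsilon> * q / (2 * r) = 2 * (\<epsilon>\<^sup>2 * q / (16 * r\<^sup>2))"
        by (simp add: \<eta>_def power2_eq_square)
      ultimately show ?thesis by simp
    qed
    finally show ?thesis .
  qed
  moreover have "nsets_avg X q g - \<epsilon> * (q choose r) = (card I / (card X choose r) - \<epsilon>) * (q choose r)"
    unfolding avg by (simp add: algebra_simps)
  ultimately show ?thesis by (simp add: g_def)
qed

text \<open>Replaces the random choices in the greedy packing and in the selection of absorbers:
  unnormalised weights act as a distribution, and an outcome no worse than average is taken.\<close>

lemma exists_le_weighted_average:
  fixes w f :: "'a \<Rightarrow> real"
  assumes A: "finite A" and w: "\<And>a. a \<in> A \<Longrightarrow> 0 \<le> w a" "0 < sum w A"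
    and avg: "(\<Sum>a\<in>A. w a * f a) \<le> x * sum w A"
  shows "\<exists>a\<in>A. f a \<le> x"
proof (rule ccontr)
  assume "\<not> ?thesis"
  then have f: "f a > x" if "a \<in> A" for a using that by (meson not_le)
  have le: "(\<Sum>a\<in>A. w a * (f a - x)) \<le> 0"
    using avg by (simp add: right_diff_distrib sum_subtractf sum_distrib_right[symmetric] mult.commute[of x])
  have nn: "0 \<le> w a * (f a - x)" if "a \<in> A" for a using f[OF that] w(1)[OF that] by simp
  have "(\<Sum>a\<in>A. w a * (f a - x)) = 0" using le nn sum_nonneg[of A "\<lambda>a. w a * (f a - x)"] by simp
  then have "w a * (f a - x) = 0" if "a \<in> A" for a
    using that nn sum_nonneg_eq_0_iff[OF A, of "\<lambda>a. w a * (f a - x)"] by simp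
  then have "w a = 0" if "a \<in> A" for a using f[OF that] that by force
  then show False using w(2) by simp
qed

section \<open>Derandomized greedy packing\<close>

text \<open>A perfect fractional matching of \<open>U\<close>, extended by zero to all b-subsets.
  Scaled by b / |U|, it is a distribution on b-sets that covers every vertex of \<open>U\<close>
  with the same probability.\<close>

definition uniform_weight :: "'a set \<Rightarrow> nat \<Rightarrow> ('a set \<Rightarrow> real) \<Rightarrow> bool" where
  "uniform_weight U b w \<longleftrightarrow> (\<forall>e\<in>nsets U b. 0 \<le> w e) \<and> (\<forall>v\<in>U. (\<Sum>e | e \<in> nsets U b \<and> v \<in> e. w e) = 1)"

lemma sum_card_Int:
  fixes w :: "'a set \<Rightarrow> real"
  assumes "finite U" "finite \<E>" "\<And>e. e \<in> \<E> \<Longrightarrow> e \<subseteq> U"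
  shows "(\<Sum>e\<in>\<E>. w e * card (B \<inter> e)) = (\<Sum>v\<in>B \<inter> U. \<Sum>e | e \<in> \<E> \<and> v \<in> e. w e)"
proof -
  have "(\<Sum>e\<in>\<E>. w e * card (B \<inter> e)) = (\<Sum>e\<in>\<E>. \<Sum>v | v \<in> B \<inter> U \<and> v \<in> e. w e)"
  proof (rule sum.cong)
    fix e assume "e \<in> \<E>"
    then have "{v. v \<in> B \<inter> U \<and> v \<in> e} = B \<inter> e" using assms by auto
    then show "w e * card (B \<inter> e) = (\<Sum>v | v \<in> B \<inter> U \<and> v \<in> e. w e)" by simp
  qed simp
  also have "\<dots> = (\<Sum>v\<in>B \<inter> U. \<Sum>e | e \<in> \<E> \<and> v \<in> e. w e)"
    using assms by (intro sum.swap_restrict) auto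
  finally show ?thesis .
qed

lemma uniform_weight_card_Int:
  assumes U: "finite U" and w: "uniform_weight U b w"
  shows "(\<Sum>e\<in>nsets U b. w e * card (B \<inter> e)) = card (B \<inter> U)"
proof -
  have "(\<Sum>e\<in>nsets U b. w e * card (B \<inter> e)) = (\<Sum>v\<in>B \<inter> U. \<Sum>e | e \<in> nsets U b \<and> v \<in> e. w e)"
    using U by (intro sum_card_Int) (auto simp: nsets_def intro: finite_imp_finite_nsets)
  also have "\<dots> = (\<Sum>v\<in>B \<inter> U. 1)"
    using w by (intro sum.cong) (auto simp: uniform_weight_def)
  finally show ?thesis by simp
qed

lemma uniform_weight_total:
  assumes U: "finite U" and w: "uniform_weight U b w" and b: "b \<ge> 1"
  shows "(\<Sum>e\<in>nsets U b. w e) = card U / b"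
proof -
  have "(\<Sum>e\<in>nsets U b. w e) * b = (\<Sum>e\<in>nsets U b. w e * card (U \<inter> e))"
    unfolding sum_distrib_right by (intro sum.cong) (auto simp: nsets_def Int_absorb1)
  then show ?thesis using uniform_weight_card_Int[OF U w, of U] b by (simp add: field_simps)
qed

text \<open>The first-order term is exact, since every vertex is covered with weight exactly 1. The
  error term vanishes when \<open>U\<close> meets \<open>B\<close> in at most one point, the typical
  case for a small random \<open>U\<close> in a large vertex set.\<close>

lemma uniform_weight_disjoint_le:
  assumes U: "finite U" and w: "uniform_weight U b w" and b: "b \<ge> 1"
  shows "(\<Sum>e\<in>nsets U b. w e * of_bool (B \<inter> e = {}))
    \<le> card U / b - card (B \<inter> U) + real (card (B \<inter> U)) * (real (card (B \<inter> U)) - 1)"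
proof -
  have "(\<Sum>e\<in>nsets U b. w e * of_bool (B \<inter> e = {}))
     \<le> (\<Sum>e\<in>nsets U b. w e - w e * card (B \<inter> e) + w e * card (B \<inter> e) * (real (card (B \<inter> U)) - 1))"
  proof (rule sum_mono)
    fix e assume e: "e \<in> nsets U b"
    then have w0: "0 \<le> w e" using w by (auto simp: uniform_weight_def)
    define x where "x = card (B \<inter> e)"
    have le: "x \<le> card (B \<inter> U)" unfolding x_def using e U by (intro card_mono) (auto simp: nsets_def)
    have fe: "finite (B \<inter> e)" using e by (auto simp: nsets_def)
    \<comment> \<open>second-order Bonferroni: for integers \<open>x \<ge> 0\<close> the indicator of \<open>x = 0\<close> is at most \<open>(1 - x)\<^sup>2\<close>\<close>
    have "of_bool (B \<inter> e = {}) \<le> 1 - real x + real x * (real (card (B \<inter> U)) - 1)"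
    proof (cases "x = 0")
      case True
      then show ?thesis by simp
    next
      case False
      then have "B \<inter> e \<noteq> {}" by (auto simp: x_def)
      moreover have "0 \<le> 1 - real x + real x * (real x - 1)"
        using zero_le_power2[of "1 - real x"] by (simp add: power2_eq_square algebra_simps)
      moreover have "real x * (real x - 1) \<le> real x * (real (card (B \<inter> U)) - 1)"
        using le by (intro mult_left_mono) auto
      ultimately show ?thesis by simp
    qed
    then have "w e * of_bool (B \<inter> e = {}) \<le> w e * (1 - real x + real x * (real (card (B \<inter> U)) - 1))"
      by (rule mult_left_mono[OF _ w0])
    then show "w e * of_bool (B \<inter> e = {}) \<le>
        w e - w e * card (B \<inter> e) + w e * card (B \<inter> e) * (real (card (B \<inter> U)) - 1)"
      by (simp add: x_def algebra_simps)
  qed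
  also have "\<dots> = card U / b - card (B \<inter> U) + card (B \<inter> U) * (real (card (B \<inter> U)) - 1)"
    unfolding sum.distrib sum_subtractf sum_distrib_right[symmetric]
    using uniform_weight_card_Int[OF U w] uniform_weight_total[OF U w b] by simp
  finally show ?thesis .
qed

section \<open>Moments of the intersection of a fixed set with a random one\<close>

lemma sum_card_Int_nsets:
  assumes R: "finite R" and B: "B \<subseteq> R" and Q: "1 \<le> Q" "Q \<le> card R"
  shows "(\<Sum>U\<in>nsets R Q. real (card (B \<inter> U))) = card B * Q / card R * (card R choose Q)"
proof -
  have fB: "finite B" using R B finite_subset by blast
  have "(\<Sum>U\<in>nsets R Q. card (B \<inter> U)) = (\<Sum>U\<in>nsets R Q. card {v \<in> B. v \<in> U})"
    by (simp add: Int_def)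
  also have "\<dots> = (\<Sum>v\<in>B. card {U \<in> nsets R Q. v \<in> U})"
    using fB R by (intro sum_multicount_gen) (auto intro: finite_imp_finite_nsets)
  also have "\<dots> = (\<Sum>v\<in>B. card R - 1 choose (Q - 1))"
  proof (rule sum.cong)
    fix v assume "v \<in> B"
    then show "card {U \<in> nsets R Q. v \<in> U} = (card R - 1 choose (Q - 1))"
      using card_nsets_superset[OF R, of "{v}" Q] B Q by auto
  qed simp
  finally have "(\<Sum>U\<in>nsets R Q. card (B \<inter> U)) = card B * (card R - 1 choose (Q - 1))" by simp
  then have 1: "(\<Sum>U\<in>nsets R Q. real (card (B \<inter> U))) = card B * real (card R - 1 choose (Q - 1))"
    by (simp flip: of_nat_sum)
  have "Q * (card R choose Q) = card R * (card R - 1 choose (Q - 1))"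
    using Q by (intro times_binomial_minus1_eq) auto
  then have "real Q * (card R choose Q) = card R * (card R - 1 choose (Q - 1))"
    by (metis of_nat_mult)
  then show ?thesis unfolding 1 using Q by (simp add: field_simps)
qed

text \<open>The summand counts ordered pairs of distinct elements of \<open>B\<close> inside
  \<open>U\<close>. Replacing \<rho> (\<rho> - 1) by \<rho>^2 costs the factor 2.\<close>

lemma sum_card_Int_pairs_nsets:
  assumes R: "finite R" and B: "B \<subseteq> R" and Q: "2 \<le> Q" "Q \<le> card R"
  shows "(\<Sum>U\<in>nsets R Q. real (card (B \<inter> U)) * (real (card (B \<inter> U)) - 1))
    \<le> 2 * (card B)\<^sup>2 * Q\<^sup>2 / (card R)\<^sup>2 * (card R choose Q)"
proof -
  define D where "D = {(u, v). u \<in> B \<and> v \<in> B \<and> u \<noteq> v}"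
  define \<rho> where "\<rho> = card R"
  have fB: "finite B" using R B finite_subset by blast
  have DB: "D \<subseteq> B \<times> B" by (auto simp: D_def)
  have fD: "finite D" using DB fB finite_subset by blast
  have pairs: "real (card {p \<in> D. fst p \<in> U \<and> snd p \<in> U}) = real (card (B \<inter> U)) * (real (card (B \<inter> U)) - 1)" for U
  proof -
    have "{p \<in> D. fst p \<in> U \<and> snd p \<in> U} = (B \<inter> U) \<times> (B \<inter> U) - (\<lambda>v. (v, v)) ` (B \<inter> U)"
      by (auto simp: D_def)
    then have "card {p \<in> D. fst p \<in> U \<and> snd p \<in> U} = card ((B \<inter> U) \<times> (B \<inter> U)) - card ((\<lambda>v. (v, v)) ` (B \<inter> U))"
      using fB by (simp only:) (intro card_Diff_subset, auto)
    also have "card ((\<lambda>v. (v, v)) ` (B \<inter> U)) = card (B \<inter> U)"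
      by (intro card_image) (auto simp: inj_on_def)
    finally have "card {p \<in> D. fst p \<in> U \<and> snd p \<in> U} = card (B \<inter> U) * card (B \<inter> U) - card (B \<inter> U)"
      by (simp add: card_cartesian_product)
    then show ?thesis by (simp add: of_nat_diff algebra_simps)
  qed
  have "(\<Sum>U\<in>nsets R Q. card {p \<in> D. fst p \<in> U \<and> snd p \<in> U}) = (\<Sum>p\<in>D. card {U \<in> nsets R Q. fst p \<in> U \<and> snd p \<in> U})"
    using fD R by (intro sum_multicount_gen) (auto intro: finite_imp_finite_nsets)
  also have "\<dots> = (\<Sum>p\<in>D. \<rho> - 2 choose (Q - 2))"
  proof (rule sum.cong)
    fix p assume "p \<in> D"
    then have "fst p \<in> R" "snd p \<in> R" "fst p \<noteq> snd p" using B by (auto simp: D_def)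
    then show "card {U \<in> nsets R Q. fst p \<in> U \<and> snd p \<in> U} = (\<rho> - 2 choose (Q - 2))"
      using card_nsets_superset[OF R, of "{fst p, snd p}" Q] Q by (simp add: \<rho>_def numeral_2_eq_2)
  qed simp
  also have "\<dots> \<le> (card B)\<^sup>2 * (\<rho> - 2 choose (Q - 2))"
  proof -
    have "card D \<le> card (B \<times> B)" using DB fB by (intro card_mono) auto
    then show ?thesis by (simp add: card_cartesian_product power2_eq_square)
  qed
  finally have "(\<Sum>U\<in>nsets R Q. card {p \<in> D. fst p \<in> U \<and> snd p \<in> U}) \<le> (card B)\<^sup>2 * (\<rho> - 2 choose (Q - 2))" .
  then have "real (\<Sum>U\<in>nsets R Q. card {p \<in> D. fst p \<in> U \<and> snd p \<in> U}) \<le> real ((card B)\<^sup>2 * (\<rho> - 2 choose (Q - 2)))"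
    by (simp only: of_nat_le_iff)
  then have 1: "(\<Sum>U\<in>nsets R Q. real (card (B \<inter> U)) * (real (card (B \<inter> U)) - 1))
     \<le> (card B)\<^sup>2 * real (\<rho> - 2 choose (Q - 2))"
    by (simp add: pairs)
  have \<rho>: "\<rho> \<ge> 2" using Q by (simp add: \<rho>_def)
  have "Q * (\<rho> choose Q) = \<rho> * (\<rho> - 1 choose (Q - 1))"
    using Q by (intro times_binomial_minus1_eq) auto
  moreover have "(Q - 1) * (\<rho> - 1 choose (Q - 1)) = (\<rho> - 1) * (\<rho> - 2 choose (Q - 2))"
    using Q times_binomial_minus1_eq[of "Q - 1" "\<rho> - 1"] by (simp add: numeral_2_eq_2)
  ultimately have "Q * (Q - 1) * (\<rho> choose Q) = \<rho> * (\<rho> - 1) * (\<rho> - 2 choose (Q - 2))"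
    by (metis mult.assoc mult.commute)
  then have "\<rho> * (\<rho> - 1) * (\<rho> - 2 choose (Q - 2)) \<le> Q\<^sup>2 * (\<rho> choose Q)"
    by (metis diff_le_self mult_le_mono1 mult_le_mono2 power2_eq_square)
  moreover have "\<rho>\<^sup>2 \<le> 2 * (\<rho> * (\<rho> - 1))"
    using \<rho> by (auto simp: power2_eq_square dest!: le_Suc_ex simp: numeral_2_eq_2)
  ultimately have "\<rho>\<^sup>2 * (\<rho> - 2 choose (Q - 2)) \<le> 2 * (Q\<^sup>2 * (\<rho> choose Q))"
    by (smt (verit) mult.assoc mult_le_mono1 mult_le_mono2 order_trans)
  then have "real (\<rho>\<^sup>2 * (\<rho> - 2 choose (Q - 2))) \<le> real (2 * (Q\<^sup>2 * (\<rho> choose Q)))"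
    by (simp only: of_nat_le_iff)
  then have "real (\<rho> - 2 choose (Q - 2)) \<le> 2 * Q\<^sup>2 / \<rho>\<^sup>2 * (\<rho> choose Q)"
    using \<rho> by (simp add: field_simps)
  then have "(card B)\<^sup>2 * real (\<rho> - 2 choose (Q - 2)) \<le> (card B)\<^sup>2 * (2 * Q\<^sup>2 / \<rho>\<^sup>2 * (\<rho> choose Q))"
    by (intro mult_left_mono) auto
  with 1 show ?thesis by (simp add: \<rho>_def mult_ac)
qed

text \<open>Relative to the total weight Q / b * (|R| choose Q), the last factor bounds the
  probability that the Q-set \<open>B\<close> survives the removal of a b-set drawn from a random
  \<open>U\<close>. The second moment of the intersection enters only with 1 / |R|^2.\<close>

lemma uniform_weights_disjoint_le:
  assumes R: "finite R" and Q: "2 \<le> Q" "Q \<le> card R" and b: "1 \<le> b"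
    and w: "\<And>U. U \<in> nsets R Q \<Longrightarrow> uniform_weight U b (W U)"
    and B: "B \<in> nsets R Q"
  shows "(\<Sum>U\<in>nsets R Q. \<Sum>e\<in>nsets U b. W U e * of_bool (B \<inter> e = {}))
    \<le> Q / b * (card R choose Q) * (1 - b * Q / card R + 2 * b * Q ^ 3 / (card R)\<^sup>2)"
proof -
  have cB: "card B = Q" "B \<subseteq> R" using B by (auto simp: nsets_def)
  have "(\<Sum>U\<in>nsets R Q. \<Sum>e\<in>nsets U b. W U e * of_bool (B \<inter> e = {}))
     \<le> (\<Sum>U\<in>nsets R Q. Q / b - card (B \<inter> U) + real (card (B \<inter> U)) * (real (card (B \<inter> U)) - 1))"
  proof (rule sum_mono)
    fix U assume U: "U \<in> nsets R Q"
    then have "finite U" "card U = Q" by (auto simp: nsets_def)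
    then show "(\<Sum>e\<in>nsets U b. W U e * of_bool (B \<inter> e = {}))
      \<le> Q / b - card (B \<inter> U) + real (card (B \<inter> U)) * (real (card (B \<inter> U)) - 1)"
      using uniform_weight_disjoint_le[OF _ w[OF U] b] by metis
  qed
  also have "\<dots> = Q / b * (card R choose Q) - (\<Sum>U\<in>nsets R Q. real (card (B \<inter> U)))
     + (\<Sum>U\<in>nsets R Q. real (card (B \<inter> U)) * (real (card (B \<inter> U)) - 1))"
    by (simp add: sum.distrib sum_subtractf)
  also have "\<dots> \<le> Q / b * (card R choose Q) - Q * Q / card R * (card R choose Q)
     + 2 * Q\<^sup>2 * Q\<^sup>2 / (card R)\<^sup>2 * (card R choose Q)"
    using sum_card_Int_pairs_nsets[OF R cB(2) Q] sum_card_Int_nsets[OF R cB(2)] Q cB by simp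
  also have "\<dots> = Q / b * (card R choose Q) * (1 - b * Q / card R + 2 * b * Q ^ 3 / (card R)\<^sup>2)"
    using b by (simp add: algebra_simps power2_eq_square power3_eq_cube)
  finally show ?thesis by simp
qed

text \<open>Deleting b points one by one multiplies the binomial by 1 - Q / (\<rho> - j) for j < b.
  The losses are given the common denominator \<rho> - b and added up as in Bernoulli's
  inequality.\<close>

lemma binomial_diff_ge:
  assumes "\<rho> \<ge> b + Q + 1"
  shows "(1 - b * Q / (\<rho> - b)) * (\<rho> choose Q) \<le> (\<rho> - b choose Q)"
  using assms
proof (induction b)
  case 0
  then show ?case by simp
next
  case (Suc b)
  define n where "n = \<rho> - b"
  have n: "n \<ge> Q + 2" "\<rho> = n + b" using Suc.prems by (auto simp: n_def)
  have "(n - Q) * (n choose Q) = n * (n - 1 choose Q)" by (rule binomial_absorb_comp)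
  then have "real (n - Q) * (n choose Q) = n * (n - 1 choose Q)" by (metis of_nat_mult)
  then have rec: "real (n - 1 choose Q) = (1 - Q / n) * (n choose Q)"
    using n by (simp add: field_simps of_nat_diff)
  have IH: "(1 - b * Q / n) * (\<rho> choose Q) \<le> (n choose Q)" using Suc by (simp add: n_def of_nat_diff)
  have "1 - Suc b * Q / (real n - 1) \<le> 1 - Suc b * Q / n"
    using n by (auto intro!: divide_left_mono)
  also have "\<dots> \<le> (1 - Q / n) * (1 - b * Q / n)"
    using n by (simp add: field_simps)
  finally have "(1 - Suc b * Q / (real n - 1)) * (\<rho> choose Q) \<le> (1 - Q / n) * (1 - b * Q / n) * (\<rho> choose Q)"
    by (intro mult_right_mono) auto
  also have "\<dots> \<le> (1 - Q / n) * (n choose Q)"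
    unfolding mult.assoc using n by (intro mult_left_mono IH) (auto simp: field_simps)
  finally show ?case using n rec by (simp add: of_nat_diff diff_diff_eq distrib_right)
qed

text \<open>The relative error per step, times the square of the number of remaining vertices.\<close>

definition drift :: "nat \<Rightarrow> nat \<Rightarrow> real" where
  "drift b Q = 4 * b\<^sup>2 * Q + 4 * b * Q ^ 3"

text \<open>The survival probability of a fixed Q-set, on the left, is compared with the proportion
  of all Q-sets that survive, on the right. The terms b Q / \<rho> agree, so only an error of order
  1 / \<rho>^2 remains.\<close>

lemma avoidance_contraction:
  assumes b: "1 \<le> b" and Q: "1 \<le> Q" and \<rho>: "\<rho> \<ge> 2 * b + 2 * b * Q"
  shows "(1 - b * Q / \<rho> + 2 * b * Q ^ 3 / \<rho>\<^sup>2) * (\<rho> choose Q) \<le> (1 + drift b Q / \<rho>\<^sup>2) * (\<rho> - b choose Q)"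
proof -
  \<comment> \<open>The loss in \<open>binomial_diff_ge\<close>; the lower bound on \<rho> keeps it
    at most 1/2.\<close>
  define x where "x = b * Q / (real \<rho> - b)"
  have r: "real \<rho> \<ge> 2 * b + 2 * b * Q" using \<rho> by (metis of_nat_add of_nat_le_iff of_nat_mult of_nat_numeral)
  have bQ: "real b * Q \<ge> 0" by simp
  have r2: "real \<rho> \<ge> 2 * b" using r bQ by linarith
  have r0: "real \<rho> > 0" using r2 b by linarith
  have d: "real \<rho> - b > 0" using r2 b by linarith
  have "x \<le> 1/2" unfolding x_def using r d bQ by (simp add: field_simps)
  have "x - b * Q / \<rho> = b\<^sup>2 * Q / (\<rho> * (real \<rho> - b))"
    using d r0 by (simp add: x_def field_simps power2_eq_square)
  also have "\<dots> \<le> b\<^sup>2 * Q / (\<rho> * (real \<rho> / 2))"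
    using d r0 r2 by (intro divide_left_mono mult_left_mono mult_pos_pos) auto
  also have "\<dots> = 2 * b\<^sup>2 * Q / \<rho>\<^sup>2" by (simp add: power2_eq_square)
  finally have x1: "x \<le> b * Q / \<rho> + 2 * b\<^sup>2 * Q / \<rho>\<^sup>2" by simp
  \<comment> \<open>Half of \<open>drift\<close> collects the two errors 2 b^2 Q and 2 b Q^3;
    doubling it pays for the factor 1 - x, which is at least 1/2.\<close>
  have "1 - b * Q / \<rho> + 2 * b * Q ^ 3 / \<rho>\<^sup>2 \<le> 1 - x + 1/2 * (drift b Q / \<rho>\<^sup>2)"
    using x1 by (simp add: drift_def add_divide_distrib mult_ac)
  also have "\<dots> \<le> 1 - x + (1 - x) * (drift b Q / \<rho>\<^sup>2)"
    using \<open>x \<le> 1/2\<close> by (intro add_left_mono mult_right_mono) (auto simp: drift_def)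
  also have "\<dots> = (1 + drift b Q / \<rho>\<^sup>2) * (1 - x)" by (simp add: algebra_simps)
  finally have "(1 - b * Q / \<rho> + 2 * b * Q ^ 3 / \<rho>\<^sup>2) * (\<rho> choose Q) \<le> (1 + drift b Q / \<rho>\<^sup>2) * (1 - x) * (\<rho> choose Q)"
    by (intro mult_right_mono) auto
  also have "\<dots> \<le> (1 + drift b Q / \<rho>\<^sup>2) * (\<rho> - b choose Q)"
  proof -
    have "b * Q \<ge> Q" using b by simp
    then have "\<rho> \<ge> b + Q + 1" using \<rho> b by linarith
    then have "(1 - x) * (\<rho> choose Q) \<le> (\<rho> - b choose Q)"
      using binomial_diff_ge[of b Q \<rho>] by (simp add: x_def of_nat_diff)
    then show ?thesis unfolding mult.assoc by (intro mult_left_mono) (auto simp: drift_def)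
  qed
  finally show ?thesis by simp
qed


text \<open>\<open>J\<close> indexes the later steps and \<open>B0\<close> is the family of degenerate sets of the current one; the
  bound is the descent of the potential used in \<open>greedy_packing\<close>.\<close>

lemma greedy_step:
  assumes R: "finite R" and b: "1 \<le> b" and Q: "2 \<le> Q" and \<rho>: "card R \<ge> 2 * b + 2 * b * Q"
    and w: "\<And>U. U \<in> nsets R Q \<Longrightarrow> uniform_weight U b (W U)"
    and B: "\<And>s. s \<in> J \<Longrightarrow> B s \<subseteq> nsets R Q" "finite J" and B0: "B0 \<subseteq> nsets R Q"
    and good: "\<And>U e. U \<in> nsets R Q - B0 \<Longrightarrow> e \<in> nsets U b \<Longrightarrow> W U e > 0 \<Longrightarrow> good e"
    and a: "a \<ge> 0"
  shows "\<exists>e\<in>nsets R b. of_bool (\<not> good e) + a * (\<Sum>s\<in>J. card {A \<in> B s. A \<inter> e = {}} / (card R - b choose Q))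
     \<le> card B0 / (card R choose Q) + a * (1 + drift b Q / (card R)\<^sup>2) * (\<Sum>s\<in>J. card (B s) / (card R choose Q))"
proof -
  define Z where "Z = Q / b * (card R choose Q)"
  define \<zeta> where "\<zeta> = 1 + drift b Q / (card R)\<^sup>2"
  \<comment> \<open>The sample space: a random Q-set together with a b-set inside it, weighted by
    \<open>W\<close>. Its total weight is \<open>Z\<close>.\<close>
  define P where "P = Sigma (nsets R Q) (\<lambda>U. nsets U b)"
  have bQ: "b * Q \<ge> Q" using b by simp
  have bR: "b + Q \<le> card R" using \<rho> bQ by linarith
  have CQ: "real (card R choose Q) > 0" "real (card R - b choose Q) > 0" using bR by auto
  have fin: "finite (nsets R Q)" using R by (rule finite_imp_finite_nsets)
  have finU: "finite (nsets U b)" if "U \<in> nsets R Q" for U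
    using that by (auto simp: nsets_def intro!: finite_imp_finite_nsets[unfolded nsets_def])
  have sumP: "(\<Sum>p\<in>P. h (fst p) (snd p)) = (\<Sum>U\<in>nsets R Q. \<Sum>e\<in>nsets U b. h U e)" for h :: "'a set \<Rightarrow> 'a set \<Rightarrow> real"
    unfolding P_def using fin finU by (subst sum.Sigma) (auto simp: case_prod_beta)
  have w0: "0 \<le> W U e" if "U \<in> nsets R Q" "e \<in> nsets U b" for U e
    using w that by (auto simp: uniform_weight_def)
  have tot: "(\<Sum>e\<in>nsets U b. W U e) = Q / b" if "U \<in> nsets R Q" for U
    using uniform_weight_total[OF _ w[OF that] b] that by (auto simp: nsets_def)
  have Z: "(\<Sum>p\<in>P. W (fst p) (snd p)) = Z"
    unfolding sumP using tot by (simp add: Z_def)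
  have Zpos: "Z > 0" using Q b CQ by (simp add: Z_def)
  \<comment> \<open>The chosen b-set can be bad only if \<open>U\<close> is degenerate, and each
    \<open>U\<close> carries total weight Q / b.\<close>
  have 1: "(\<Sum>p\<in>P. W (fst p) (snd p) * of_bool (\<not> good (snd p))) \<le> card B0 * (Q / b)"
  proof -
    have "(\<Sum>U\<in>nsets R Q. \<Sum>e\<in>nsets U b. W U e * of_bool (\<not> good e)) \<le> (\<Sum>U\<in>nsets R Q. if U \<in> B0 then Q / b else 0)"
    proof (rule sum_mono)
      fix U assume U: "U \<in> nsets R Q"
      show "(\<Sum>e\<in>nsets U b. W U e * of_bool (\<not> good e)) \<le> (if U \<in> B0 then Q / b else 0)"
      proof (cases "U \<in> B0")
        case True
        have "(\<Sum>e\<in>nsets U b. W U e * of_bool (\<not> good e)) \<le> (\<Sum>e\<in>nsets U b. W U e)"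
          by (intro sum_mono) (use w0[OF U] in \<open>auto simp: of_bool_def\<close>)
        then show ?thesis using True tot[OF U] by simp
      next
        case False
        have "(\<Sum>e\<in>nsets U b. W U e * of_bool (\<not> good e)) = 0"
        proof (rule sum.neutral, rule ballI)
          fix e assume e: "e \<in> nsets U b"
          then show "W U e * of_bool (\<not> good e) = 0"
            using good[of U e] w0[OF U e] U False by (cases "W U e = 0") auto
        qed
        then show ?thesis using False by simp
      qed
    qed
    also have "\<dots> = card B0 * (Q / b)"
      using fin B0 by (simp add: sum.If_cases Int_absorb1)
    finally show ?thesis using sumP[of "\<lambda>U e. W U e * of_bool (\<not> good e)"] by simp
  qed
  have 2: "(\<Sum>p\<in>P. W (fst p) (snd p) * (card {A \<in> B s. A \<inter> snd p = {}} / (card R - b choose Q)))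
     \<le> Z * \<zeta> * (card (B s) / (card R choose Q))" if s: "s \<in> J" for s
  proof -
    have fB: "finite (B s)" using B(1)[OF s] fin finite_subset by blast
    define X where "X = 1 - b * Q / card R + 2 * b * Q ^ 3 / (card R)\<^sup>2"
    have "(\<Sum>p\<in>P. W (fst p) (snd p) * card {A \<in> B s. A \<inter> snd p = {}})
       = (\<Sum>p\<in>P. \<Sum>A\<in>B s. W (fst p) (snd p) * of_bool (A \<inter> snd p = {}))"
      using fB by (intro sum.cong) (auto simp: of_bool_def Int_def sum.If_cases simp flip: sum_distrib_left)
    also have "\<dots> = (\<Sum>A\<in>B s. \<Sum>p\<in>P. W (fst p) (snd p) * of_bool (A \<inter> snd p = {}))"
      by (rule sum.swap)
    also have "\<dots> \<le> (\<Sum>A\<in>B s. Z * X)"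
    proof (rule sum_mono)
      fix A assume A: "A \<in> B s"
      have "(\<Sum>U\<in>nsets R Q. \<Sum>e\<in>nsets U b. W U e * of_bool (A \<inter> e = {})) \<le> Z * X"
        using uniform_weights_disjoint_le[where W = W and B = A, OF R Q _ b w] bR A B(1)[OF s]
        unfolding Z_def X_def by auto
      then show "(\<Sum>p\<in>P. W (fst p) (snd p) * of_bool (A \<inter> snd p = {})) \<le> Z * X"
        using sumP[of "\<lambda>U e. W U e * of_bool (A \<inter> e = {})"] by simp
    qed
    also have "\<dots> = card (B s) * (Q / b) * (X * (card R choose Q))" by (simp add: Z_def)
    also have "\<dots> \<le> card (B s) * (Q / b) * (\<zeta> * (card R - b choose Q))"
      using avoidance_contraction[OF b _ \<rho>] Q unfolding X_def \<zeta>_def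
      by (intro mult_left_mono) auto
    finally have "(\<Sum>p\<in>P. W (fst p) (snd p) * card {A \<in> B s. A \<inter> snd p = {}})
       \<le> card (B s) * (Q / b) * (\<zeta> * (card R - b choose Q))" .
    then have "(\<Sum>p\<in>P. W (fst p) (snd p) * card {A \<in> B s. A \<inter> snd p = {}}) / (card R - b choose Q)
       \<le> card (B s) * (Q / b) * \<zeta>"
      using CQ by (simp add: pos_divide_le_eq mult.assoc)
    moreover have "Z * \<zeta> * (card (B s) / (card R choose Q)) = card (B s) * (Q / b) * \<zeta>"
      using CQ by (simp add: Z_def)
    ultimately show ?thesis by (simp add: sum_divide_distrib)
  qed
  \<comment> \<open>Failure of the current step and the densities for all later ones are averaged
    together, since a single \<open>e\<close> has to control both.\<close>
  define fe where "fe e = of_bool (\<not> good e) + a * (\<Sum>s\<in>J. card {A \<in> B s. A \<inter> e = {}} / (card R - b choose Q))" for e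
  have "(\<Sum>p\<in>P. W (fst p) (snd p) * fe (snd p))
    = (\<Sum>p\<in>P. W (fst p) (snd p) * of_bool (\<not> good (snd p)))
     + a * (\<Sum>s\<in>J. \<Sum>p\<in>P. W (fst p) (snd p) * (card {A \<in> B s. A \<inter> snd p = {}} / (card R - b choose Q)))"
    unfolding fe_def distrib_left sum.distrib sum.swap[of _ P J]
    by (simp add: sum_distrib_left mult_ac)
  also have "\<dots> \<le> card B0 * (Q / b) + a * (\<Sum>s\<in>J. Z * \<zeta> * (card (B s) / (card R choose Q)))"
    by (intro add_mono 1 mult_left_mono sum_mono 2 a)
  also have "\<dots> = (card B0 / (card R choose Q) + a * \<zeta> * (\<Sum>s\<in>J. card (B s) / (card R choose Q))) * Z"
  proof -
    have "card B0 * (Q / b) = card B0 / (card R choose Q) * Z" using CQ by (simp add: Z_def)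
    then show ?thesis by (simp add: distrib_left sum_distrib_left mult_ac)
  qed
  finally have "\<exists>p\<in>P. fe (snd p) \<le> card B0 / (card R choose Q) + a * \<zeta> * (\<Sum>s\<in>J. card (B s) / (card R choose Q))"
    using fin finU w0 Z Zpos
    by (intro exists_le_weighted_average[where w = "\<lambda>p. W (fst p) (snd p)"]) (auto simp: P_def)
  then obtain U e where "U \<in> nsets R Q" "e \<in> nsets U b"
      "fe e \<le> card B0 / (card R choose Q) + a * \<zeta> * (\<Sum>s\<in>J. card (B s) / (card R choose Q))"
    by (auto simp: P_def)
  moreover then have "e \<in> nsets R b" by (auto simp: nsets_def)
  ultimately show ?thesis unfolding fe_def \<zeta>_def by blast
qed

text \<open>The potential adds to the number of failures so far the densities, among Q-subsets of
  the remaining vertices, of the degenerate families of the steps to come; its factor \<zeta>^(T -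
  t) prepays their drift. It starts at no more than \<zeta>^T \<delta> T and ends as the number of
  failures. At least \<open>r0\<close> vertices remain throughout, so one \<zeta> serves all
  steps.\<close>

lemma greedy_packing:
  fixes V :: "'a set" and T b Q r0 :: nat and \<delta> :: real
  assumes V: "finite V" and b: "1 \<le> b" and Q: "2 \<le> Q" and r0: "r0 \<ge> 2 * b + 2 * b * Q" "b * T + r0 \<le> card V"
    and w: "\<And>s U. s < T \<Longrightarrow> U \<in> nsets V Q \<Longrightarrow> uniform_weight U b (W s U)"
    and B: "\<And>s. s < T \<Longrightarrow> B s \<subseteq> nsets V Q" "\<And>s. s < T \<Longrightarrow> card (B s) \<le> \<delta> * (card V choose Q)"
    and good: "\<And>s U e. s < T \<Longrightarrow> U \<in> nsets V Q - B s \<Longrightarrow> e \<in> nsets U b \<Longrightarrow> W s U e > 0 \<Longrightarrow> good s e"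
  shows "\<exists>E. (\<forall>s<T. E s \<in> nsets V b) \<and> disjoint_family_on E {..<T} \<and>
     card {s. s < T \<and> \<not> good s (E s)} \<le> (1 + drift b Q / r0\<^sup>2) ^ T * \<delta> * T"
proof -
  define \<zeta> where "\<zeta> = 1 + drift b Q / r0\<^sup>2"
  define \<beta> where "\<beta> s R = card {A \<in> B s. A \<subseteq> R} / (card R choose Q)" for s R
  have \<zeta>: "\<zeta> \<ge> 1" by (simp add: \<zeta>_def drift_def)
  have "t \<le> T \<Longrightarrow> \<exists>E. (\<forall>s<t. E s \<in> nsets V b) \<and> disjoint_family_on E {..<t} \<and>
     card {s. s < t \<and> \<not> good s (E s)} + \<zeta> ^ (T - t) * (\<Sum>s\<in>{t..<T}. \<beta> s (V - (\<Union>s<t. E s))) \<le> \<zeta> ^ T * \<delta> * T" for t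
  proof (induction t)
    case 0
    have "(\<Sum>s\<in>{0..<T}. \<beta> s V) \<le> (\<Sum>s\<in>{0..<T}. \<delta>)"
    proof (rule sum_mono)
      fix s assume "s \<in> {0..<T}"
      then have s: "s < T" by simp
      have "b * Q \<ge> Q" using b by simp
      then have "Q \<le> card V" using r0 by linarith
      then have "real (card V choose Q) > 0" by simp
      moreover have "{A \<in> B s. A \<subseteq> V} = B s" using B(1)[OF s] by (auto simp: nsets_def)
      ultimately show "\<beta> s V \<le> \<delta>" using B(2)[OF s] by (simp add: \<beta>_def field_simps)
    qed
    then show ?case using \<zeta> by (auto simp: disjoint_family_on_def mult_left_mono mult_ac)
  next
    case (Suc t)
    then obtain E where E: "\<And>s. s < t \<Longrightarrow> E s \<in> nsets V b" "disjoint_family_on E {..<t}"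
      and pot: "card {s. s < t \<and> \<not> good s (E s)} + \<zeta> ^ (T - t) * (\<Sum>s\<in>{t..<T}. \<beta> s (V - (\<Union>s<t. E s))) \<le> \<zeta> ^ T * \<delta> * T"
      by auto
    have t: "t < T" using Suc by simp
    define R where "R = V - (\<Union>s<t. E s)"
    have RV: "R \<subseteq> V" and fR: "finite R" using V by (auto simp: R_def)
    have "card (\<Union>s<t. E s) \<le> (\<Sum>s<t. card (E s))" by (rule card_UN_le) simp
    also have "\<dots> = b * t" using E(1) by (simp add: nsets_def)
    finally have "card V - b * t \<le> card R"
      using diff_card_le_card_Diff[of "\<Union>s<t. E s" V] E(1) unfolding R_def by (force simp: nsets_def)
    moreover have "b * t + b \<le> b * T" using t by (metis Suc_leI mult_Suc_right add.commute mult_le_mono2)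
    ultimately have cR: "r0 \<le> card R" using r0 by linarith
    define J where "J = {Suc t..<T}"
    define \<B> where "\<B> s = {A \<in> B s. A \<subseteq> R}" for s
    have nR: "nsets R Q \<subseteq> nsets V Q" using RV by (rule nsets_mono)
    have \<B>: "\<B> s \<subseteq> nsets R Q" if "s < T" for s
      using B(1)[OF that] by (auto simp: \<B>_def nsets_def)
    have "\<exists>e\<in>nsets R b. of_bool (\<not> good t e) + \<zeta> ^ (T - Suc t) * (\<Sum>s\<in>J. card {A \<in> \<B> s. A \<inter> e = {}} / (card R - b choose Q))
     \<le> card (\<B> t) / (card R choose Q) + \<zeta> ^ (T - Suc t) * (1 + drift b Q / (card R)\<^sup>2) * (\<Sum>s\<in>J. card (\<B> s) / (card R choose Q))"
    proof (rule greedy_step[OF fR b Q])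
      show "2 * b + 2 * b * Q \<le> card R" using cR r0 by simp
      show "uniform_weight U b (W t U)" if "U \<in> nsets R Q" for U using that w[OF t] nR by auto
      show "\<B> s \<subseteq> nsets R Q" if "s \<in> J" for s using that by (intro \<B>) (auto simp: J_def)
      show "\<B> t \<subseteq> nsets R Q" by (rule \<B>[OF t])
      show "good t e" if "U \<in> nsets R Q - \<B> t" "e \<in> nsets U b" "0 < W t U e" for U e
        using that nR by (intro good[OF t, of U]) (auto simp: \<B>_def nsets_def)
    qed (use \<zeta> in \<open>auto simp: J_def\<close>)
    then obtain e where e: "e \<in> nsets R b" and le: "of_bool (\<not> good t e) + \<zeta> ^ (T - Suc t) * (\<Sum>s\<in>J. card {A \<in> \<B> s. A \<inter> e = {}} / (card R - b choose Q))
     \<le> card (\<B> t) / (card R choose Q) + \<zeta> ^ (T - Suc t) * (1 + drift b Q / (card R)\<^sup>2) * (\<Sum>s\<in>J. card (\<B> s) / (card R choose Q))"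
      by blast
    have e': "e \<subseteq> R" "card e = b" "finite e" using e by (auto simp: nsets_def)
    define E' where "E' = E(t := e)"
    have R': "V - (\<Union>s<Suc t. E' s) = R - e" by (auto simp: E'_def R_def lessThan_Suc)
    have \<beta>': "\<beta> s (R - e) = card {A \<in> \<B> s. A \<inter> e = {}} / (card R - b choose Q)" for s
    proof -
      have "{A \<in> B s. A \<subseteq> R - e} = {A \<in> \<B> s. A \<inter> e = {}}" by (auto simp: \<B>_def)
      moreover have "card (R - e) = card R - b" using e' by (simp add: card_Diff_subset)
      ultimately show ?thesis by (simp add: \<beta>_def)
    qed
    have \<beta>R: "\<beta> s R = card (\<B> s) / (card R choose Q)" for s by (simp add: \<beta>_def \<B>_def)
    have \<beta>0: "\<beta> s R \<ge> 0" for s by (simp add: \<beta>_def)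
    have "of_bool (\<not> good t e) + \<zeta> ^ (T - Suc t) * (\<Sum>s\<in>J. \<beta> s (R - e))
      \<le> \<beta> t R + \<zeta> ^ (T - Suc t) * (1 + drift b Q / (card R)\<^sup>2) * (\<Sum>s\<in>J. \<beta> s R)"
      using le by (simp add: \<beta>' \<beta>R)
    \<comment> \<open>The density of the current family, which bounds the chance of failure in step
      t, becomes the summand s = t of the old potential.\<close>
    also have "\<dots> \<le> \<zeta> ^ (T - t) * \<beta> t R + \<zeta> ^ (T - t) * (\<Sum>s\<in>J. \<beta> s R)"
    proof (intro add_mono mult_right_mono sum_nonneg)
      show "\<beta> t R \<le> \<zeta> ^ (T - t) * \<beta> t R"
        using \<beta>0[of t] one_le_power[OF \<zeta>, of "T - t"] by (metis mult_le_cancel_right1 mult_right_mono mult_1)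
      have "(real r0)\<^sup>2 \<le> (real (card R))\<^sup>2" using cR by (intro power_mono) auto
      moreover have "r0 > 0" using r0 b by simp
      ultimately have "1 + drift b Q / (card R)\<^sup>2 \<le> \<zeta>"
        unfolding \<zeta>_def by (auto intro!: divide_left_mono mult_pos_pos simp: drift_def)
      then have "\<zeta> ^ (T - Suc t) * (1 + drift b Q / (card R)\<^sup>2) \<le> \<zeta> ^ (T - Suc t) * \<zeta>"
        using \<zeta> by (intro mult_left_mono) auto
      also have "\<dots> = \<zeta> ^ (T - t)" using t by (metis Suc_diff_Suc power_Suc2)
      finally show "\<zeta> ^ (T - Suc t) * (1 + drift b Q / (card R)\<^sup>2) \<le> \<zeta> ^ (T - t)" .
    qed (use \<beta>0 in auto)
    also have "\<dots> = \<zeta> ^ (T - t) * (\<Sum>s\<in>{t..<T}. \<beta> s R)"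
      using t by (simp add: J_def sum.atLeast_Suc_lessThan distrib_left)
    finally have main: "of_bool (\<not> good t e) + \<zeta> ^ (T - Suc t) * (\<Sum>s\<in>J. \<beta> s (R - e))
      \<le> \<zeta> ^ (T - t) * (\<Sum>s\<in>{t..<T}. \<beta> s R)" .
    have "{s. s < Suc t \<and> \<not> good s (E' s)} = {s. s < t \<and> \<not> good s (E s)} \<union> (if good t e then {} else {t})"
      by (auto simp: E'_def less_Suc_eq)
    then have "real (card {s. s < Suc t \<and> \<not> good s (E' s)}) = card {s. s < t \<and> \<not> good s (E s)} + of_bool (\<not> good t e)"
      by (simp add: card_insert_if)
    then have "card {s. s < Suc t \<and> \<not> good s (E' s)} + \<zeta> ^ (T - Suc t) * (\<Sum>s\<in>{Suc t..<T}. \<beta> s (V - (\<Union>s<Suc t. E' s)))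
       \<le> \<zeta> ^ T * \<delta> * T"
      using main pot unfolding R' J_def R_def[symmetric] by simp
    moreover have "E' s \<in> nsets V b" if "s < Suc t" for s
      using E(1)[of s] e RV that by (cases "s = t") (auto simp: E'_def nsets_def)
    moreover have "disjoint_family_on E' {..<Suc t}"
      using E(2) e'(1) by (auto simp: disjoint_family_on_def E'_def R_def less_Suc_eq) (metis IntI empty_iff lessThan_iff)
    ultimately show ?case by blast
  qed
  from this[of T] show ?thesis by (simp add: \<zeta>_def)
qed

section \<open>Selecting absorbers\<close>

text \<open>Here \<open>y\<close> ranges over demands, \<open>t\<close> over candidates serving
  them, and \<open>cf\<close> is incompatibility. M choices exclude at most M s candidates, at most
  half of those guaranteed to each demand. A demand served fewer than q times would alone contribute
  at least 2^-q to the final potential, against the last hypothesis.\<close>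

lemma potential_selection:
  fixes ab :: "'t \<Rightarrow> 'y \<Rightarrow> bool" and cf :: "'t \<Rightarrow> 't \<Rightarrow> bool" and \<alpha> a :: real and M q s :: nat
  assumes T: "finite T" and Y: "finite Y" "Y \<noteq> {}"
    and ab: "\<And>y. y \<in> Y \<Longrightarrow> a \<le> card {t \<in> T. ab t y}"
    and cf: "\<And>t. t \<in> T \<Longrightarrow> card {t' \<in> T. cf t t'} \<le> s" and Ms: "2 * M * s \<le> a"
    and \<alpha>: "\<alpha> * card T \<le> a" "0 \<le> \<alpha>" "\<alpha> \<le> 1" and a: "a > 0"
    and q: "card Y * (1 - \<alpha> / 4) ^ M * 2 ^ q < 1"
  shows "\<exists>t. (\<forall>i<M. t i \<in> T) \<and> (\<forall>i<M. \<forall>j<i. \<not> cf (t j) (t i)) \<and> (\<forall>y\<in>Y. q \<le> card {i. i < M \<and> ab (t i) y})"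
proof -
  \<comment> \<open>At least half of the candidates absorbing \<open>y\<close> never conflict with the chosen ones, so some choice
    shrinks the potential by the factor \<open>1 - \<alpha> / 4\<close>.\<close>
  have "m \<le> M \<Longrightarrow> \<exists>t. (\<forall>i<m. t i \<in> T) \<and> (\<forall>i<m. \<forall>j<i. \<not> cf (t j) (t i)) \<and>
      (\<Sum>y\<in>Y. (1 / 2) ^ card {i. i < m \<and> ab (t i) y}) \<le> card Y * (1 - \<alpha> / 4) ^ m" for m
  proof (induction m)
    case 0
    then show ?case by simp
  next
    case (Suc m)
    then obtain t where t: "\<And>i. i < m \<Longrightarrow> t i \<in> T" "\<forall>i<m. \<forall>j<i. \<not> cf (t j) (t i)"
      and pot: "(\<Sum>y\<in>Y. (1 / 2) ^ card {i. i < m \<and> ab (t i) y}) \<le> card Y * (1 - \<alpha> / 4) ^ m"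
      by auto
    define \<phi> where "\<phi> y = (1 / 2 :: real) ^ card {i. i < m \<and> ab (t i) y}" for y
    define A where "A = {t' \<in> T. \<forall>j<m. \<not> cf (t j) t'}"
    have fA: "finite A" and AT: "A \<subseteq> T" using T by (auto simp: A_def)
    have cnt: "a / 2 \<le> card {t' \<in> A. ab t' y}" if y: "y \<in> Y" for y
    proof -
      have "{t' \<in> T. ab t' y} \<subseteq> {t' \<in> A. ab t' y} \<union> (\<Union>j<m. {t' \<in> T. cf (t j) t'})"
        by (auto simp: A_def)
      then have "card {t' \<in> T. ab t' y} \<le> card ({t' \<in> A. ab t' y} \<union> (\<Union>j<m. {t' \<in> T. cf (t j) t'}))"
        using T fA by (intro card_mono) auto
      also have "\<dots> \<le> card {t' \<in> A. ab t' y} + card (\<Union>j<m. {t' \<in> T. cf (t j) t'})"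
        by (rule card_Un_le)
      also have "card (\<Union>j<m. {t' \<in> T. cf (t j) t'}) \<le> (\<Sum>j<m. card {t' \<in> T. cf (t j) t'})"
        by (rule card_UN_le) simp
      also have "\<dots> \<le> (\<Sum>j<m. s)" using t(1) by (intro sum_mono cf) auto
      also have "\<dots> \<le> M * s" using Suc.prems by simp
      finally have "real (card {t' \<in> T. ab t' y}) \<le> real (card {t' \<in> A. ab t' y} + M * s)"
        by (simp only: of_nat_le_iff)
      then show ?thesis using ab[OF y] Ms by simp
    qed
    \<comment> \<open>Two factors of 2 lead to \<alpha> / 4: half of the guaranteed candidates may
      be excluded, and serving a demand halves its term instead of deleting it.\<close>
    have cA: "\<alpha> / 2 * card A \<le> a / 2"
    proof -
      have "\<alpha> * card A \<le> \<alpha> * card T"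
        using \<alpha> card_mono[OF T AT] by (intro mult_left_mono) auto
      then show ?thesis using \<alpha>(1) by simp
    qed
    have "\<exists>t'\<in>T. (\<forall>j<m. \<not> cf (t j) t') \<and> (\<Sum>y\<in>Y. \<phi> y * (1 - of_bool (ab t' y) / 2)) \<le> (1 - \<alpha> / 4) * (\<Sum>y\<in>Y. \<phi> y)"
    proof -
      obtain y where y: "y \<in> Y" using Y(2) by blast
      then have "card {t' \<in> A. ab t' y} > 0" using cnt[OF y] a by linarith
      then have Apos: "card A > 0" using card_mono[OF fA, of "{t' \<in> A. ab t' y}"] by simp
      have "(\<Sum>t'\<in>A. \<Sum>y\<in>Y. \<phi> y * (1 - of_bool (ab t' y) / 2)) = (\<Sum>y\<in>Y. \<Sum>t'\<in>A. \<phi> y * (1 - of_bool (ab t' y) / 2))"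
        by (rule sum.swap)
      also have "\<dots> \<le> (\<Sum>y\<in>Y. \<phi> y * (card A * (1 - \<alpha> / 4)))"
      proof (rule sum_mono)
        fix y assume y: "y \<in> Y"
        have "(\<Sum>t'\<in>A. (1 - of_bool (ab t' y) / 2 :: real)) = card A - card {t' \<in> A. ab t' y} / 2"
          using fA by (simp add: sum_subtractf Int_def flip: sum_divide_distrib)
        also have "\<dots> \<le> card A * (1 - \<alpha> / 4)" using cnt[OF y] cA by (simp add: algebra_simps)
        finally show "(\<Sum>t'\<in>A. \<phi> y * (1 - of_bool (ab t' y) / 2)) \<le> \<phi> y * (card A * (1 - \<alpha> / 4))"
          unfolding sum_distrib_left[symmetric] by (rule mult_left_mono) (simp add: \<phi>_def)
      qed
      also have "\<dots> = (1 - \<alpha> / 4) * (\<Sum>y\<in>Y. \<phi> y) * card A"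
        by (simp add: sum_distrib_left sum_distrib_right mult_ac)
      finally have "\<exists>t'\<in>A. (\<Sum>y\<in>Y. \<phi> y * (1 - of_bool (ab t' y) / 2)) \<le> (1 - \<alpha> / 4) * (\<Sum>y\<in>Y. \<phi> y)"
        using Apos by (intro exists_le_weighted_average[OF fA, of "\<lambda>_. 1"]) auto
      then show ?thesis by (auto simp: A_def)
    qed
    then obtain t' where t': "t' \<in> T" "\<forall>j<m. \<not> cf (t j) t'"
      and le: "(\<Sum>y\<in>Y. \<phi> y * (1 - of_bool (ab t' y) / 2)) \<le> (1 - \<alpha> / 4) * (\<Sum>y\<in>Y. \<phi> y)" by blast
    define u where "u = t(m := t')"
    have "(1 / 2) ^ card {i. i < Suc m \<and> ab (u i) y} = \<phi> y * (1 - of_bool (ab t' y) / 2)" for y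
    proof -
      have "{i. i < Suc m \<and> ab (u i) y} = {i. i < m \<and> ab (t i) y} \<union> (if ab t' y then {m} else {})"
        by (auto simp: u_def less_Suc_eq)
      then show ?thesis by (simp add: \<phi>_def card_insert_if)
    qed
    then have "(\<Sum>y\<in>Y. (1 / 2) ^ card {i. i < Suc m \<and> ab (u i) y}) \<le> (1 - \<alpha> / 4) * (\<Sum>y\<in>Y. \<phi> y)"
      using le by simp
    also have "\<dots> \<le> (1 - \<alpha> / 4) * (card Y * (1 - \<alpha> / 4) ^ m)"
      using pot \<alpha> unfolding \<phi>_def by (intro mult_left_mono) auto
    finally have "(\<Sum>y\<in>Y. (1 / 2) ^ card {i. i < Suc m \<and> ab (u i) y}) \<le> card Y * (1 - \<alpha> / 4) ^ Suc m"
      by (simp add: mult_ac)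
    moreover have "\<forall>i<Suc m. u i \<in> T" "\<forall>i<Suc m. \<forall>j<i. \<not> cf (u j) (u i)"
      using t t' by (auto simp: u_def less_Suc_eq)
    ultimately show ?case by blast
  qed
  from this[of M] obtain t where t: "\<forall>i<M. t i \<in> T" "\<forall>i<M. \<forall>j<i. \<not> cf (t j) (t i)"
    and pot: "(\<Sum>y\<in>Y. (1 / 2) ^ card {i. i < M \<and> ab (t i) y}) \<le> card Y * (1 - \<alpha> / 4) ^ M" by auto
  have "q \<le> card {i. i < M \<and> ab (t i) y}" if y: "y \<in> Y" for y
  proof (rule ccontr)
    assume "\<not> ?thesis"
    then have "(1 / 2 :: real) ^ q \<le> (1 / 2) ^ card {i. i < M \<and> ab (t i) y}"
      by (intro power_decreasing) auto
    also have "\<dots> \<le> (\<Sum>y\<in>Y. (1 / 2) ^ card {i. i < M \<and> ab (t i) y})"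
      using Y(1) y by (intro member_le_sum) auto
    also have "\<dots> \<le> card Y * (1 - \<alpha> / 4) ^ M" by (rule pot)
    finally have "(1 / 2) ^ q * 2 ^ q \<le> card Y * (1 - \<alpha> / 4) ^ M * (2 ^ q :: real)"
      by (rule mult_right_mono) auto
    then show False using q by (simp flip: power_mult_distrib)
  qed
  then show ?thesis using t by blast
qed

section \<open>Rainbow factors and degrees\<close>

text \<open>\<open>has_rainbow_factor\<close> for arbitrary vertex and colour sets, so that partial
  factors can be glued.\<close>

definition rainbow_factor ::
  "dir_conv \<Rightarrow> 'v::linorder dkgraph \<Rightarrow> (nat \<Rightarrow> 'v dkgraph) \<Rightarrow> 'v set \<Rightarrow> nat set \<Rightarrow> bool" where
  "rainbow_factor cv F H W D \<longleftrightarrow> (\<exists>P. factor_on cv F W P \<and> rainbow H D (pack_edges P))"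

lemma fst_carry: "fst (carry cv \<phi> x) = \<phi> ` fst x"
  by (cases x; cases cv) auto

lemma carry_id: "carry cv id x = x"
proof -
  have "inversions id e = {}" for e :: "'a set"
    unfolding inversions_def by auto
  then show ?thesis by (cases x; cases cv) auto
qed

lemma isomorphic_refl: "isomorphic cv G G"
  unfolding isomorphic_def by (rule exI[of _ id]) (simp add: carry_id)

lemma isomorphic_card: "isomorphic cv F G \<Longrightarrow> card (verts G) = card (verts F)"
  by (auto simp: isomorphic_def bij_betw_same_card)

lemma isomorphic_dkgraph:
  assumes "dkgraph k F" "isomorphic cv F G"
  shows "dkgraph k G"
proof -
  obtain \<phi> where \<phi>: "bij_betw \<phi> (verts F) (verts G)" "edges G = carry cv \<phi> ` edges F"
    using assms by (auto simp: isomorphic_def)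
  show ?thesis
    unfolding dkgraph_def
  proof (intro conjI ballI)
    show "finite (verts G)" using assms \<phi> by (auto simp: dkgraph_def bij_betw_finite)
    fix x assume "x \<in> edges G"
    then obtain y where y: "y \<in> edges F" "x = carry cv \<phi> y" using \<phi> by auto
    then have "fst y \<subseteq> verts F" "card (fst y) = k" using assms by (auto simp: dkgraph_def)
    moreover have "inj_on \<phi> (fst y)" using calculation \<phi> by (meson bij_betw_def inj_on_subset)
    ultimately show "fst x \<subseteq> verts G" "card (fst x) = k"
      using y \<phi> by (auto simp: fst_carry card_image bij_betw_def)
  qed
qed

lemma pack_edges_subset:
  assumes "dkgraph k F" "factor_on cv F W P" "x \<in> pack_edges P"
  shows "fst x \<subseteq> W \<and> card (fst x) = k"
proof -
  obtain G where G: "G \<in> P" "x \<in> edges G" using assms by (auto simp: pack_edges_def)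
  then have "dkgraph k G" "verts G \<subseteq> W"
    using assms isomorphic_dkgraph[OF assms(1), of cv G] by (auto simp: factor_on_def packing_def)
  then show ?thesis using G unfolding dkgraph_def by blast
qed

text \<open>The colourings can be combined because k >= 1 makes edges nonempty, so that edges inside
  disjoint vertex sets are distinct.\<close>

lemma rainbow_factor_Un:
  assumes F: "dkgraph k F" "k \<ge> 1"
    and 1: "rainbow_factor cv F H W D" and 2: "rainbow_factor cv F H W' D'"
    and disj: "W \<inter> W' = {}" "D \<inter> D' = {}"
  shows "rainbow_factor cv F H (W \<union> W') (D \<union> D')"
proof -
  obtain P where P: "factor_on cv F W P" "rainbow H D (pack_edges P)" using 1 by (auto simp: rainbow_factor_def)
  obtain P' where P': "factor_on cv F W' P'" "rainbow H D' (pack_edges P')" using 2 by (auto simp: rainbow_factor_def)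
  obtain c where c: "bij_betw c (pack_edges P) D" "\<forall>x\<in>pack_edges P. x \<in> edges (H (c x))"
    using P by (auto simp: rainbow_def)
  obtain c' where c': "bij_betw c' (pack_edges P') D'" "\<forall>x\<in>pack_edges P'. x \<in> edges (H (c' x))"
    using P' by (auto simp: rainbow_def)
  have E: "pack_edges P \<inter> pack_edges P' = {}"
  proof (rule ccontr)
    assume "\<not> ?thesis"
    then obtain x where x: "x \<in> pack_edges P" "x \<in> pack_edges P'" by blast
    then have "fst x \<subseteq> W \<inter> W'" "card (fst x) \<ge> 1"
      using pack_edges_subset[OF F(1) P(1), of x] pack_edges_subset[OF F(1) P'(1), of x] F(2) by auto
    then show False using disj by auto
  qed
  define d where "d x = (if x \<in> pack_edges P then c x else c' x)" for x
  have "bij_betw d (pack_edges P) D" using c(1) by (subst bij_betw_cong[of _ _ c]) (auto simp: d_def)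
  moreover have "bij_betw d (pack_edges P') D'"
    using c'(1) E by (subst bij_betw_cong[of _ _ c']) (auto simp: d_def)
  ultimately have "bij_betw d (pack_edges P \<union> pack_edges P') (D \<union> D')"
    using disj by (intro bij_betw_combine)
  moreover have "pack_edges (P \<union> P') = pack_edges P \<union> pack_edges P'" by (auto simp: pack_edges_def)
  ultimately have "rainbow H (D \<union> D') (pack_edges (P \<union> P'))"
    unfolding rainbow_def using c c' by (intro exI[of _ d]) (auto simp: d_def)
  moreover have "factor_on cv F (W \<union> W') (P \<union> P')"
  proof -
    have "disjnt (verts G) (verts G')" if "G \<in> P" "G' \<in> P'" for G G'
      using that P(1) P'(1) disj by (auto simp: factor_on_def disjnt_def)
    then show ?thesis using P(1) P'(1)
      by (auto simp: factor_on_def packing_def pairwise_def disjnt_sym)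
  qed
  ultimately show ?thesis by (auto simp: rainbow_factor_def)
qed

lemma rainbow_factor_empty: "rainbow_factor cv F H {} {}"
  unfolding rainbow_factor_def
  by (rule exI[of _ "{}"]) (auto simp: factor_on_def packing_def rainbow_def pack_edges_def bij_betw_def)

lemma rainbow_factor_UN:
  assumes F: "dkgraph k F" "k \<ge> 1" and I: "finite I"
    and 1: "\<And>i. i \<in> I \<Longrightarrow> rainbow_factor cv F H (W i) (D i)"
    and disj: "disjoint_family_on W I" "disjoint_family_on D I"
  shows "rainbow_factor cv F H (\<Union>i\<in>I. W i) (\<Union>i\<in>I. D i)"
  using I 1 disj
proof (induction I)
  case empty
  then show ?case by (simp add: rainbow_factor_empty)
next
  case (insert i I)
  have "rainbow_factor cv F H (W i \<union> (\<Union>i\<in>I. W i)) (D i \<union> (\<Union>i\<in>I. D i))"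
    by (rule rainbow_factor_Un[OF F])
      (use insert in \<open>auto simp: disjoint_family_on_insert\<close>)
  then show ?case by simp
qed

lemma rainbow_factor_copy:
  assumes "isomorphic cv F G" "rainbow H D (edges G)"
  shows "rainbow_factor cv F H (verts G) D"
  unfolding rainbow_factor_def
  using assms by (intro exI[of _ "{G}"]) (auto simp: factor_on_def packing_def pack_edges_def)

lemma rainbow_mono:
  assumes "rainbow H D E" "\<And>i. i \<in> D \<Longrightarrow> edges (H i) \<subseteq> edges (H' i)"
  shows "rainbow H' D E"
  using assms unfolding rainbow_def by (meson bij_betwE subsetD)

lemma rainbow_reindex:
  assumes "rainbow (\<lambda>i. H (\<sigma> i)) D E" "bij_betw \<sigma> D D'"
  shows "rainbow H D' E"
proof -
  obtain c where c: "bij_betw c E D" "\<forall>x\<in>E. x \<in> edges (H (\<sigma> (c x)))" using assms by (auto simp: rainbow_def)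
  then have "bij_betw (\<sigma> \<circ> c) E D'" using assms(2) by (rule_tac bij_betw_trans)
  then show ?thesis unfolding rainbow_def using c by (intro exI[of _ "\<sigma> \<circ> c"]) auto
qed

section \<open>Degrees under passing to induced subgraphs\<close>

lemma verts_induced: "U \<subseteq> verts G \<Longrightarrow> verts (induced G U) = U"
  by (auto simp: induced_def)

lemma edges_induced_subset: "edges (induced G U) \<subseteq> edges G"
  by (auto simp: induced_def)

lemma dkgraph_induced: "dkgraph k G \<Longrightarrow> dkgraph k (induced G U)"
  by (auto simp: dkgraph_def induced_def)

lemma finite_edges:
  assumes "dkgraph k G"
  shows "finite (edges G)"
proof -
  have "(UNIV :: dir set) = {Plus, Minus}" using dir.exhaust by auto
  then have "finite (UNIV :: dir set)" by (metis finite.emptyI finite_insert)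
  moreover have "edges G \<subseteq> Pow (verts G) \<times> UNIV" using assms by (fastforce simp: dkgraph_def)
  ultimately show ?thesis using assms
    by (meson dkgraph_def finite_Pow_iff finite_SigmaI finite_subset)
qed

text \<open>The bounds on \<open>d\<close> and \<open>l\<close> make both minima range over nonempty
  sets, where \<open>Min\<close> has its intended meaning.\<close>

lemma min_rule_deg_ge_iff:
  fixes x :: real
  assumes "finite (verts G)" "d \<le> card (verts G)" "l \<ge> 1"
  shows "x \<le> min_rule_deg d l N G \<longleftrightarrow>
    (\<forall>S\<in>nsets (verts G) d. \<forall>j\<in>{1..l}. x \<le> card (N G S j))"
proof -
  have eq: "{S. S \<subseteq> verts G \<and> card S = d} = nsets (verts G) d"
    using assms by (auto simp: mem_nsets_iff)
  have ne: "nsets (verts G) d \<noteq> {}" using assms by (simp add: nsets_eq_empty_iff)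
  have fin: "finite (nsets (verts G) d)" using assms by (intro finite_imp_finite_nsets)
  have 1: "x \<le> rule_deg l N G S \<longleftrightarrow> (\<forall>j\<in>{1..l}. x \<le> card (N G S j))" for S
  proof
    assume *: "x \<le> rule_deg l N G S"
    show "\<forall>j\<in>{1..l}. x \<le> card (N G S j)"
    proof
      fix j assume "j \<in> {1..l}"
      then have "rule_deg l N G S \<le> card (N G S j)" unfolding rule_deg_def by (intro Min_le) auto
      then show "x \<le> card (N G S j)" using * by linarith
    qed
  next
    assume *: "\<forall>j\<in>{1..l}. x \<le> card (N G S j)"
    have "rule_deg l N G S \<in> (\<lambda>j. card (N G S j)) ` {1..l}"
      unfolding rule_deg_def using assms by (intro Min_in) auto
    then show "x \<le> rule_deg l N G S" using * by auto
  qed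
  have "x \<le> min_rule_deg d l N G \<longleftrightarrow> (\<forall>S\<in>nsets (verts G) d. x \<le> rule_deg l N G S)"
  proof
    assume *: "x \<le> min_rule_deg d l N G"
    show "\<forall>S\<in>nsets (verts G) d. x \<le> rule_deg l N G S"
    proof
      fix S assume "S \<in> nsets (verts G) d"
      then have "min_rule_deg d l N G \<le> rule_deg l N G S" unfolding min_rule_deg_def eq using fin by (intro Min_le) auto
      then show "x \<le> rule_deg l N G S" using * by linarith
    qed
  next
    assume *: "\<forall>S\<in>nsets (verts G) d. x \<le> rule_deg l N G S"
    have "min_rule_deg d l N G \<in> rule_deg l N G ` nsets (verts G) d"
      unfolding min_rule_deg_def eq using fin ne by (intro Min_in) auto
    then show "x \<le> min_rule_deg d l N G" using * by auto
  qed
  then show ?thesis using 1 by simp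
qed

lemma degree_rule_subset:
  assumes "degree_rule k d l N" "dkgraph k G" "S \<in> nsets (verts G) d" "j \<in> {1..l}"
  shows "N G S j \<subseteq> {x \<in> edges G. S \<subseteq> fst x}"
  using assms unfolding degree_rule_def nsets_def by blast

lemma degree_rule_induced:
  assumes rule: "degree_rule k d l N" and G: "dkgraph k G" and S: "S \<in> nsets U d" and U: "U \<subseteq> verts G" and j: "j \<in> {1..l}"
  shows "card {x \<in> N G S j. fst x \<subseteq> U} \<le> card (N (induced G U) S j)"
proof (rule card_mono)
  have S': "S \<in> nsets (verts G) d" using S U nsets_mono by blast
  show "{x \<in> N G S j. fst x \<subseteq> U} \<subseteq> N (induced G U) S j"
    using rule G S S' U j unfolding degree_rule_def nsets_def by blast
  have "N (induced G U) S j \<subseteq> edges (induced G U)"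
    using degree_rule_subset[OF rule dkgraph_induced[OF G], of S U j] S j verts_induced[OF U] by auto
  then show "finite (N (induced G U) S j)"
    using finite_edges[OF dkgraph_induced[OF G]] finite_subset by blast
qed

lemma card_edges_with_vertex_set_le: "card {x \<in> (E :: 'v dedge set). fst x = e} \<le> 2"
proof -
  have "{x \<in> E. fst x = e} \<subseteq> {(e, Plus), (e, Minus)}"
  proof
    fix x assume "x \<in> {x \<in> E. fst x = e}"
    then show "x \<in> {(e, Plus), (e, Minus)}" by (cases x; cases "snd x") auto
  qed
  then have "card {x \<in> E. fst x = e} \<le> card {(e, Plus), (e, Minus)}" by (intro card_mono) auto
  then show ?thesis by simp
qed

lemma card_edges_superset_le:
  assumes G: "dkgraph k G" and S: "S \<subseteq> verts G" "card S \<le> k"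
  shows "card {x \<in> edges G. S \<subseteq> fst x} \<le> 2 * (card (verts G) - card S choose (k - card S))"
proof -
  have fV: "finite (verts G)" using G by (simp add: dkgraph_def)
  have "{x \<in> edges G. S \<subseteq> fst x} \<subseteq> (\<Union>e\<in>{e \<in> nsets (verts G) k. S \<subseteq> e}. {x \<in> edges G. fst x = e})"
    using G fV by (auto simp: dkgraph_def nsets_def intro: finite_subset)
  then have "card {x \<in> edges G. S \<subseteq> fst x} \<le> card (\<Union>e\<in>{e \<in> nsets (verts G) k. S \<subseteq> e}. {x \<in> edges G. fst x = e})"
    using finite_imp_finite_nsets[OF fV] finite_edges[OF G] by (intro card_mono) auto
  also have "\<dots> \<le> (\<Sum>e\<in>{e \<in> nsets (verts G) k. S \<subseteq> e}. card {x \<in> edges G. fst x = e})"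
    using finite_imp_finite_nsets[OF fV] by (intro card_UN_le) auto
  also have "\<dots> \<le> (\<Sum>e\<in>{e \<in> nsets (verts G) k. S \<subseteq> e}. 2)"
    by (intro sum_mono card_edges_with_vertex_set_le)
  also have "\<dots> = 2 * (card (verts G) - card S choose (k - card S))"
    using card_nsets_superset[OF fV S] by simp
  finally show ?thesis .
qed

text \<open>Serves for deleting the vertices of the absorbers, a small but not random set. A deleted
  vertex lies in at most 2 (n - d - 1 choose k - d - 1) edges containing S, which is a fraction 2 (k
  - d) / (n - d) of (n - d choose k - d); \<eta> bounds the total fraction lost.\<close>

lemma min_rule_deg_induced_ge:
  fixes x \<eta> :: real
  assumes rule: "degree_rule k d l N" and G: "dkgraph k G" and d: "d < k" "k \<le> card (verts G)"
    and U: "U \<subseteq> verts G" "d \<le> card U"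
    and deg: "x * (card (verts G) - d choose (k - d)) \<le> min_rule_deg d l N G"
    and \<eta>: "2 * card (verts G - U) * real (k - d) \<le> \<eta> * (card (verts G) - d)" "\<eta> \<le> x"
  shows "(x - \<eta>) * (card U - d choose (k - d)) \<le> min_rule_deg d l N (induced G U)"
proof -
  define n where "n = card (verts G)"
  have fV: "finite (verts G)" using G by (simp add: dkgraph_def)
  have fU: "finite U" using U fV finite_subset by blast
  have l: "l \<ge> 1" using rule by (simp add: degree_rule_def)
  have "(x - \<eta>) * (card U - d choose (k - d)) \<le> card (N (induced G U) S j)"
    if S: "S \<in> nsets U d" and j: "j \<in> {1..l}" for S j
  proof -
    have S': "S \<in> nsets (verts G) d" using S U nsets_mono by blast
    have Sd: "card S = d" "S \<subseteq> U" "finite S" using S by (auto simp: nsets_def)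
    have sub: "N G S j \<subseteq> {x \<in> edges G. S \<subseteq> fst x}" by (rule degree_rule_subset[OF rule G S' j])
    then have fN: "finite (N G S j)" using finite_edges[OF G] finite_subset[OF sub] by simp
    have "x * (n - d choose (k - d)) \<le> card (N G S j)"
      using deg S' j min_rule_deg_ge_iff[OF fV _ l, of d] d unfolding n_def by auto
    also have "card (N G S j) \<le> card ({x \<in> N G S j. fst x \<subseteq> U} \<union> (\<Union>v\<in>verts G - U. {x \<in> edges G. insert v S \<subseteq> fst x}))"
    proof (rule card_mono)
      show "finite ({x \<in> N G S j. fst x \<subseteq> U} \<union> (\<Union>v\<in>verts G - U. {x \<in> edges G. insert v S \<subseteq> fst x}))"
        using fN fV finite_edges[OF G] by auto
      show "N G S j \<subseteq> {x \<in> N G S j. fst x \<subseteq> U} \<union> (\<Union>v\<in>verts G - U. {x \<in> edges G. insert v S \<subseteq> fst x})"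
      proof
        fix y assume y: "y \<in> N G S j"
        then have "fst y \<subseteq> verts G" "y \<in> edges G" "S \<subseteq> fst y" using sub G by (auto simp: dkgraph_def)
        then show "y \<in> {x \<in> N G S j. fst x \<subseteq> U} \<union> (\<Union>v\<in>verts G - U. {x \<in> edges G. insert v S \<subseteq> fst x})"
          using y by blast
      qed
    qed
    also have "\<dots> \<le> card {x \<in> N G S j. fst x \<subseteq> U} + card (\<Union>v\<in>verts G - U. {x \<in> edges G. insert v S \<subseteq> fst x})"
      by (rule card_Un_le)
    also have "card (\<Union>v\<in>verts G - U. {x \<in> edges G. insert v S \<subseteq> fst x}) \<le> (\<Sum>v\<in>verts G - U. card {x \<in> edges G. insert v S \<subseteq> fst x})"
      using fV by (intro card_UN_le) auto
    also have "\<dots> \<le> (\<Sum>v\<in>verts G - U. 2 * (n - Suc d choose (k - Suc d)))"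
    proof (rule sum_mono)
      fix v assume v: "v \<in> verts G - U"
      then have "card (insert v S) = Suc d" using Sd by (subst card_insert_disjoint) auto
      then show "card {x \<in> edges G. insert v S \<subseteq> fst x} \<le> 2 * (n - Suc d choose (k - Suc d))"
        using card_edges_superset_le[OF G, of "insert v S"] v Sd U d by (simp add: n_def)
    qed
    finally have 1: "x * (n - d choose (k - d))
        \<le> card {x \<in> N G S j. fst x \<subseteq> U} + 2 * card (verts G - U) * real (n - Suc d choose (k - Suc d))"
      by (simp add: mult_ac)
    have "(k - d) * (n - d choose (k - d)) = (n - d) * (n - d - 1 choose (k - d - 1))"
      using d by (intro times_binomial_minus1_eq) auto
    then have 2: "real (k - d) * (n - d choose (k - d)) = real (n - d) * (n - Suc d choose (k - Suc d))"
      by (metis of_nat_mult diff_Suc_eq_diff_pred diff_commute One_nat_def diff_diff_left plus_1_eq_Suc add.commute)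
    have nd: "real (n - d) > 0" using d by (simp add: n_def)
    have "2 * card (verts G - U) * real (n - Suc d choose (k - Suc d)) * (n - d)
       = 2 * card (verts G - U) * real (k - d) * (n - d choose (k - d))"
      using 2 by (simp add: mult_ac)
    also have "\<dots> \<le> \<eta> * (n - d) * (n - d choose (k - d))"
      using \<eta> by (intro mult_right_mono) (auto simp: n_def)
    finally have "2 * card (verts G - U) * real (n - Suc d choose (k - Suc d)) * (n - d) \<le> \<eta> * (n - d choose (k - d)) * (n - d)"
      by (simp add: mult_ac)
    then have "2 * card (verts G - U) * real (n - Suc d choose (k - Suc d)) \<le> \<eta> * (n - d choose (k - d))"
      using nd by (simp only: mult_le_cancel_right_pos)
    then have "(x - \<eta>) * (n - d choose (k - d)) \<le> card {x \<in> N G S j. fst x \<subseteq> U}"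
      using 1 by (simp add: left_diff_distrib)
    also have "\<dots> \<le> card (N (induced G U) S j)"
      using degree_rule_induced[OF rule G S U(1) j] by simp
    finally have "(x - \<eta>) * (n - d choose (k - d)) \<le> card (N (induced G U) S j)" .
    \<comment> \<open>Here \<eta> <= x matters: a smaller binomial weakens the bound only if its
      coefficient is nonnegative.\<close>
    moreover have "(x - \<eta>) * (card U - d choose (k - d)) \<le> (x - \<eta>) * (n - d choose (k - d))"
      using \<eta> card_mono[OF fV U(1)] by (intro mult_left_mono) (auto simp: n_def intro!: binomial_right_mono diff_le_mono)
    ultimately show ?thesis by linarith
  qed
  then show ?thesis
    using min_rule_deg_ge_iff[of "induced G U" d l] fU U l verts_induced[OF U(1)] by simp
qed

section \<open>Almost perfect packings\<close>

text \<open>A union bound over colours, the l edge sets of the degree rule, and the d-sets S inside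
  U. For fixed S, the rest of U ranges over the (Q - d)-subsets of V - S, to which the lower tail
  applies. Since Q is to be a constant, the resulting proportion must not depend on |V|.\<close>

lemma card_degenerate_subsets_le:
  fixes x \<eta> :: real and H :: "nat \<Rightarrow> 'v dkgraph"
  assumes rule: "degree_rule k d l N" and V: "finite V"
    and H: "\<And>i. i \<in> {1..f} \<Longrightarrow> dkgraph k (H i) \<and> verts (H i) = V"
    and deg: "\<And>i. i \<in> {1..f} \<Longrightarrow> x * (card V - d choose (k - d)) \<le> min_rule_deg d l N (H i)"
    and d: "d < k" "k \<le> Q" "Q \<le> card V" and \<eta>: "0 < \<eta>" "\<eta> \<le> 1"
  shows "card {U \<in> nsets V Q. \<exists>i\<in>{1..f}. min_rule_deg d l N (induced (H i) U) < (x - \<eta>) * (Q - d choose (k - d))}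
    \<le> f * l * (Q choose d) * exp (- (\<eta>\<^sup>2 * real (Q - d) / (16 * (real (k - d))\<^sup>2))) * (card V choose Q)"
proof -
  define n where "n = card V"
  define c where "c = exp (- (\<eta>\<^sup>2 * real (Q - d) / (16 * (real (k - d))\<^sup>2)))"
  \<comment> \<open>The extensions A of S for which S \<union> A may violate the degree condition at
    S, in colour i and edge set j.\<close>
  define Z where "Z i S j = {A \<in> nsets (V - S) (Q - d).
     card {y \<in> N (H i) S j. fst y - S \<subseteq> A} \<le> (card (N (H i) S j) / (card (V - S) choose (k - d)) - \<eta>) * (Q - d choose (k - d))}" for i S j
  define Bad where "Bad = {U \<in> nsets V Q. \<exists>i\<in>{1..f}. min_rule_deg d l N (induced (H i) U) < (x - \<eta>) * (Q - d choose (k - d))}"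
  have l: "l \<ge> 1" using rule by (simp add: degree_rule_def)
  have finV: "finite (nsets V q)" for q using V by (rule finite_imp_finite_nsets)
  have finZ: "finite (Z i S j)" for i S j
    unfolding Z_def by (rule finite_subset[of _ "nsets (V - S) (Q - d)"]) (use V in \<open>auto intro: finite_imp_finite_nsets\<close>)
  have Z: "card (Z i S j) \<le> (n - d choose (Q - d)) * c" if i: "i \<in> {1..f}" and S: "S \<in> nsets V d" and j: "j \<in> {1..l}" for i S j
  proof -
    have G: "dkgraph k (H i)" "verts (H i) = V" using H[OF i] by auto
    have S': "S \<subseteq> V" "card S = d" "finite S" using S by (auto simp: nsets_def)
    have sub: "N (H i) S j \<subseteq> {x \<in> edges (H i). S \<subseteq> fst x}"
      using degree_rule_subset[OF rule G(1) _ j, of S] S G by simp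
    have fN: "finite (N (H i) S j)" using finite_edges[OF G(1)] finite_subset[OF sub] by simp
    have cV: "card (V - S) = n - d" using S' by (simp add: card_Diff_subset n_def)
    have "card (Z i S j) \<le> (card (V - S) choose (Q - d)) * c"
      unfolding Z_def c_def
    proof (rule nsets_count_lower_tail)
      show "fst y - S \<subseteq> V - S \<and> card (fst y - S) = k - d" if "y \<in> N (H i) S j" for y
      proof -
        have "y \<in> edges (H i)" "S \<subseteq> fst y" using sub that by auto
        then have "fst y \<subseteq> V" "card (fst y) = k" using G by (auto simp: dkgraph_def)
        then show ?thesis using S' \<open>S \<subseteq> fst y\<close> by (auto simp: card_Diff_subset)
      qed
      show "card {y \<in> N (H i) S j. fst y - S = T} \<le> 2" for T
      proof -
        have "card {y \<in> N (H i) S j. fst y - S = T} \<le> card {y \<in> N (H i) S j. fst y = S \<union> T}"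
          using fN sub by (intro card_mono) auto
        also have "\<dots> \<le> 2" by (rule card_edges_with_vertex_set_le)
        finally show ?thesis .
      qed
    qed (use V d fN \<eta> cV in \<open>auto simp: n_def\<close>)
    then show ?thesis by (simp add: cV)
  qed
  have "Bad \<subseteq> (\<Union>(i, j, S)\<in>{1..f} \<times> {1..l} \<times> nsets V d. (\<lambda>A. S \<union> A) ` Z i S j)"
  proof
    fix U assume "U \<in> Bad"
    then obtain i where U: "U \<subseteq> V" "card U = Q" "finite U" and i: "i \<in> {1..f}"
      and less: "min_rule_deg d l N (induced (H i) U) < (x - \<eta>) * (Q - d choose (k - d))"
      by (auto simp: Bad_def nsets_def)
    have G: "dkgraph k (H i)" "verts (H i) = V" using H[OF i] by auto
    have "\<not> (x - \<eta>) * (Q - d choose (k - d)) \<le> min_rule_deg d l N (induced (H i) U)" using less by simp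
    then obtain S j where S: "S \<in> nsets U d" and j: "j \<in> {1..l}"
      and lt: "card (N (induced (H i) U) S j) < (x - \<eta>) * (Q - d choose (k - d))"
      using min_rule_deg_ge_iff[of "induced (H i) U" d l] verts_induced[of U "H i"] U G l d by (auto simp: not_le)
    have S': "S \<subseteq> U" "card S = d" "finite S" "S \<in> nsets V d" using S U by (auto simp: nsets_def)
    have sub: "N (H i) S j \<subseteq> {x \<in> edges (H i). S \<subseteq> fst x}"
      using degree_rule_subset[OF rule G(1) _ j, of S] S' G by simp
    have cV: "card (V - S) = n - d" using S' U by (simp add: card_Diff_subset n_def)
    have "{y \<in> N (H i) S j. fst y - S \<subseteq> U - S} = {y \<in> N (H i) S j. fst y \<subseteq> U}"
      using S'(1) sub by blast
    then have "card {y \<in> N (H i) S j. fst y - S \<subseteq> U - S} \<le> card (N (induced (H i) U) S j)"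
      using degree_rule_induced[OF rule G(1) S _ j] U G by simp
    then have "card {y \<in> N (H i) S j. fst y - S \<subseteq> U - S} \<le> (x - \<eta>) * (Q - d choose (k - d))"
      using lt by linarith
    also have "\<dots> \<le> (card (N (H i) S j) / (card (V - S) choose (k - d)) - \<eta>) * (Q - d choose (k - d))"
    proof (intro mult_right_mono diff_right_mono)
      have "x * (n - d choose (k - d)) \<le> card (N (H i) S j)"
        using min_rule_deg_ge_iff[of "H i" d l] deg[OF i] G V d l S' j by (auto simp: n_def)
      then show "x \<le> card (N (H i) S j) / (card (V - S) choose (k - d))"
        using d by (simp add: cV n_def pos_le_divide_eq)
    qed auto
    finally have "U - S \<in> Z i S j" using U S' by (auto simp: Z_def nsets_def card_Diff_subset)
    moreover have "U = S \<union> (U - S)" using S' by auto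
    ultimately have "U \<in> (\<lambda>A. S \<union> A) ` Z i S j" by (rule rev_image_eqI)
    then show "U \<in> (\<Union>(i, j, S)\<in>{1..f} \<times> {1..l} \<times> nsets V d. (\<lambda>A. S \<union> A) ` Z i S j)"
      using i j S'(4) by (intro UN_I[of "(i, j, S)"]) auto
  qed
  then have "card Bad \<le> card (\<Union>(i, j, S)\<in>{1..f} \<times> {1..l} \<times> nsets V d. (\<lambda>A. S \<union> A) ` Z i S j)"
    using finV finZ by (intro card_mono) auto
  also have "\<dots> \<le> (\<Sum>(i, j, S)\<in>{1..f} \<times> {1..l} \<times> nsets V d. card ((\<lambda>A. S \<union> A) ` Z i S j))"
    using finV card_UN_le[of "{1..f} \<times> {1..l} \<times> nsets V d" "\<lambda>(i, j, S). (\<lambda>A. S \<union> A) ` Z i S j"]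
    by (simp add: case_prod_beta)
  also have "\<dots> \<le> (\<Sum>(i, j, S)\<in>{1..f} \<times> {1..l} \<times> nsets V d. card (Z i S j))"
    using finZ by (intro sum_mono) (auto intro: card_image_le)
  finally have "real (card Bad) \<le> real (\<Sum>(i, j, S)\<in>{1..f} \<times> {1..l} \<times> nsets V d. card (Z i S j))"
    by (simp only: of_nat_le_iff)
  also have "\<dots> = (\<Sum>(i, j, S)\<in>{1..f} \<times> {1..l} \<times> nsets V d. real (card (Z i S j)))"
    by (simp add: case_prod_beta)
  also have "\<dots> \<le> (\<Sum>(i, j, S)\<in>{1..f} \<times> {1..l} \<times> nsets V d. (n - d choose (Q - d)) * c)"
    using Z by (intro sum_mono) auto
  also have "\<dots> = f * l * c * real ((n choose d) * (n - d choose (Q - d)))"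
    by (simp add: case_prod_beta n_def card_cartesian_product)
  \<comment> \<open>This trades the d-subsets of V for those of a single Q-set, which removes n from
    the failure probability.\<close>
  also have "(n choose d) * (n - d choose (Q - d)) = (n choose Q) * (Q choose d)"
    using d by (intro choose_mult[symmetric]) (auto simp: n_def)
  finally show ?thesis unfolding Bad_def c_def n_def by (simp add: mult_ac)
qed

lemma copy_sets_subset_nsets:
  assumes "dkgraph k F"
  shows "copy_sets cv F V H \<subseteq> nsets V (card (verts F))"
proof
  fix e assume "e \<in> copy_sets cv F V H"
  then obtain G where "e = verts G" "isomorphic cv F G" "verts G \<subseteq> V" by (auto simp: copy_sets_def)
  then show "e \<in> nsets V (card (verts F))"
    using isomorphic_card isomorphic_dkgraph[OF assms] by (auto simp: nsets_def dkgraph_def)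
qed

lemma uniform_weight_copy_sets:
  assumes F: "dkgraph k F" and U: "finite U"
    and w: "perfect_fractional_matching U (copy_sets cv F U H) w"
  shows "uniform_weight U (card (verts F)) (\<lambda>e. if e \<in> copy_sets cv F U H then w e else 0)"
proof -
  define K where "K = copy_sets cv F U H"
  have K: "K \<subseteq> nsets U (card (verts F))" unfolding K_def by (rule copy_sets_subset_nsets[OF F])
  have "(\<Sum>e | e \<in> nsets U (card (verts F)) \<and> v \<in> e. if e \<in> K then w e else 0) = 1" if "v \<in> U" for v
  proof -
    have "(\<Sum>e | e \<in> nsets U (card (verts F)) \<and> v \<in> e. if e \<in> K then w e else 0) = (\<Sum>e | e \<in> K \<and> v \<in> e. w e)"
      using finite_imp_finite_nsets[OF U] K by (intro sum.mono_neutral_cong_right) auto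
    also have "\<dots> = 1" using w that by (simp add: perfect_fractional_matching_def K_def)
    finally show ?thesis .
  qed
  moreover have "0 \<le> (if e \<in> K then w e else 0)" for e
    using w by (auto simp: perfect_fractional_matching_def K_def)
  ultimately show ?thesis unfolding uniform_weight_def K_def by blast
qed

text \<open>The substitute on degenerate Q-sets: even where no fractional matching by copies of F is
  available, the step must remove vertices uniformly.\<close>

lemma uniform_weight_const:
  assumes U: "finite U" and b: "1 \<le> b" "b \<le> card U"
  shows "uniform_weight U b (\<lambda>e. 1 / (card U - 1 choose (b - 1)))"
proof -
  have *: "(\<Sum>e | e \<in> nsets U b \<and> v \<in> e. 1 / real (card U - 1 choose (b - 1))) = 1" if "v \<in> U" for v
    using card_nsets_superset[OF U, of "{v}" b] that b by simp
  show ?thesis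
    unfolding uniform_weight_def
  proof (intro conjI ballI)
    show "(\<Sum>e | e \<in> nsets U b \<and> v \<in> e. 1 / real (card U - 1 choose (b - 1))) = 1" if "v \<in> U" for v
      by (rule *[OF that])
  qed simp
qed

lemma copy_sets_induced_subset:
  assumes "U \<subseteq> V"
  shows "copy_sets cv F U (\<lambda>i. induced (H i) U) \<subseteq> copy_sets cv F V H"
proof -
  have "rainbow (\<lambda>i. induced (H i) U) C E \<Longrightarrow> rainbow H C E" for C E
    by (erule rainbow_mono) (rule edges_induced_subset)
  then show ?thesis using assms unfolding copy_sets_def by blast
qed

lemma eventually_poly_times_exp_less:
  fixes \<kappa> \<delta> c :: real
  assumes "\<kappa> > 0" "\<delta> > 0"
  shows "\<forall>\<^sub>F n :: nat in sequentially. c * real n ^ D * exp (- (\<kappa> * n)) < \<delta>"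
proof -
  have lim: "((\<lambda>n::nat. (\<kappa> * real n) ^ D / exp (\<kappa> * real n)) \<longlongrightarrow> 0) sequentially"
    by (rule filterlim_compose[OF tendsto_power_div_exp_0])
      (use assms in \<open>auto intro!: filterlim_tendsto_pos_mult_at_top[OF tendsto_const] filterlim_real_sequentially\<close>)
  have "((\<lambda>n::nat. c / \<kappa> ^ D * ((\<kappa> * real n) ^ D / exp (\<kappa> * real n))) \<longlongrightarrow> 0) sequentially"
    by (rule tendsto_mult_right_zero[OF lim])
  then have "\<forall>\<^sub>F n :: nat in sequentially. c / \<kappa> ^ D * ((\<kappa> * real n) ^ D / exp (\<kappa> * real n)) < \<delta>"
    using assms by (intro order_tendstoD(2)) auto
  moreover have "c / \<kappa> ^ D * ((\<kappa> * real n) ^ D / exp (\<kappa> * real n)) = c * real n ^ D * exp (- (\<kappa> * n))" for n :: nat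
    using assms by (simp add: power_mult_distrib exp_minus field_simps)
  ultimately show ?thesis by simp
qed

text \<open>The union bound over d-subsets of a Q-set costs only a polynomial factor, so some
  constant Q attains any prescribed failure probability.\<close>

lemma eventually_degenerate_probability_le:
  fixes \<kappa> \<delta> c :: real
  assumes "\<kappa> > 0" "\<delta> > 0" "c \<ge> 0"
  shows "\<forall>\<^sub>F Q :: nat in sequentially. c * (Q choose d) * exp (- (\<kappa> * real (Q - d))) \<le> \<delta>"
  using eventually_poly_times_exp_less[OF assms(1,2), of "c * exp (\<kappa> * d)" d] eventually_ge_at_top[of d]
proof eventually_elim
  case (elim Q)
  have "real (Q choose d) \<le> real Q ^ d"
    using binomial_le_power[of Q d] by (metis of_nat_le_iff of_nat_power)
  then have "c * (Q choose d) * exp (- (\<kappa> * real (Q - d))) \<le> c * real Q ^ d * exp (- (\<kappa> * real (Q - d)))"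
    using assms by (intro mult_right_mono mult_left_mono) auto
  also have "\<dots> = c * exp (\<kappa> * d) * real Q ^ d * exp (- (\<kappa> * Q))"
    using elim(2) by (simp add: of_nat_diff algebra_simps flip: exp_add)
  finally show ?case using elim(1) by linarith
qed

text \<open>Every step has its own system \<open>H s\<close>, which is what allows the colours to be
  distributed in advance. Q is fixed from the threshold and the failure probability before n grows;
  at least a fraction \<mu> of the vertices stays uncovered, which keeps the accumulated drift
  bounded.\<close>

lemma eventually_almost_factor:
  fixes F :: "'v::linorder dkgraph" and y \<eta> \<mu> \<delta> :: real
  assumes F: "dkgraph k F" and b: "1 \<le> card (verts F)" and d: "d < k"
    and rule: "degree_rule k d l N" and \<eta>: "0 < \<eta>" "\<eta> \<le> 1" and \<mu>: "\<mu> > 0" and \<delta>: "\<delta> > 0"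
    and cov: "\<forall>\<^sub>F n in sequentially. \<forall>V H. dense_system k d l N y n V (card (edges F)) H \<longrightarrow>
        (\<exists>w. perfect_fractional_matching V (copy_sets cv F V H) w)"
  shows "\<forall>\<^sub>F n in sequentially. \<forall>V H T. finite V \<and> card V = n \<and> card (verts F) * T \<le> (1 - \<mu>) * n \<and>
     (\<forall>s<T. \<forall>i\<in>{1..card (edges F)}. dkgraph k (H s i) \<and> verts (H s i) = V \<and>
         (y + \<eta>) * (n - d choose (k - d)) \<le> min_rule_deg d l N (H s i)) \<longrightarrow>
     (\<exists>E. (\<forall>s<T. E s \<in> nsets V (card (verts F))) \<and> disjoint_family_on E {..<T} \<and>
        card {s. s < T \<and> E s \<notin> copy_sets cv F V (H s)} \<le> \<delta> * T)"
proof -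
  define b where "b = card (verts F)"
  define f where "f = card (edges F)"
  define \<kappa> where "\<kappa> = \<eta>\<^sup>2 / (16 * (real (k - d))\<^sup>2)"
  have \<kappa>: "\<kappa> > 0" using \<eta> d by (simp add: \<kappa>_def)
  \<comment> \<open>The target is \<delta> / 2 because the drift will cost at most a factor
    2.\<close>
  have "\<forall>\<^sub>F Q in sequentially. real f * real l * (Q choose d) * exp (- (\<kappa> * real (Q - d))) \<le> \<delta> / 2"
    using \<kappa> \<delta> by (intro eventually_degenerate_probability_le) auto
  with cov eventually_ge_at_top[of "max 2 (max b k)"]
  have "\<forall>\<^sub>F Q in sequentially. (\<forall>V H. dense_system k d l N y Q V f H \<longrightarrow>
        (\<exists>w. perfect_fractional_matching V (copy_sets cv F V H) w)) \<and>
      real f * real l * (Q choose d) * exp (- (\<kappa> * real (Q - d))) \<le> \<delta> / 2 \<and> max 2 (max b k) \<le> Q"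
    unfolding f_def by eventually_elim simp
  then obtain Q where pfm: "\<And>V H. dense_system k d l N y Q V f H \<Longrightarrow>
        (\<exists>w. perfect_fractional_matching V (copy_sets cv F V H) w)"
    and Q\<delta>: "real f * real l * (Q choose d) * exp (- (\<kappa> * real (Q - d))) \<le> \<delta> / 2"
    and Q: "2 \<le> Q" "b \<le> Q" "k \<le> Q"
    unfolding eventually_sequentially by (metis max.bounded_iff order_refl)
  define K where "K = drift b Q"
  have K: "K \<ge> 0" by (simp add: K_def drift_def)
  \<comment> \<open>Besides n >= Q, the second bound makes \<mu> n, even after rounding down, large
    enough for \<open>greedy_packing\<close>; the third keeps the total drift at most 1/2.\<close>
  have "\<forall>\<^sub>F n :: nat in sequentially. real n \<ge> max Q (max (2 / \<mu> * (2 * b + 2 * b * Q + 1)) (8 * K / \<mu>\<^sup>2))"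
    by (rule eventually_compose_filterlim[OF eventually_ge_at_top filterlim_real_sequentially])
  then show ?thesis
  proof eventually_elim
    case (elim n)
    then have nQ: "n \<ge> Q" and n1: "real n \<ge> 2 / \<mu> * (2 * b + 2 * b * Q + 1)" and n2: "real n \<ge> 8 * K / \<mu>\<^sup>2"
      by auto
    define r0 where "r0 = nat \<lfloor>\<mu> * n\<rfloor>"
    have \<mu>n: "\<mu> * n \<ge> 2 * (2 * b + 2 * b * Q + 1)" using n1 \<mu> by (simp add: field_simps)
    have "real 2 \<le> real (2 * (2 * b + 2 * b * Q + 1))" unfolding of_nat_le_iff by simp
    then have "\<mu> * n \<ge> 2" using \<mu>n by linarith
    then have "real r0 = of_int \<lfloor>\<mu> * n\<rfloor>" unfolding r0_def by simp
    then have r0_half: "real r0 \<ge> \<mu> * n / 2" using \<open>\<mu> * n \<ge> 2\<close> by linarith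
    have r0_le: "real r0 \<le> \<mu> * n" using \<mu> unfolding r0_def by simp
    have "real r0 \<ge> real (2 * b + 2 * b * Q)" using r0_half \<mu>n by simp
    then have r0: "r0 \<ge> 2 * b + 2 * b * Q" by (simp only: of_nat_le_iff)
    have n0: "real n > 0" using n1 \<mu> Q nQ by simp
    \<comment> \<open>At most n steps, each with relative error K / r0^2 where r0 >= \<mu> n / 2,
      give a total exponent of at most 4 K / (\<mu>^2 n).\<close>
    have zeta: "(1 + K / r0\<^sup>2) ^ T \<le> 2" if "T \<le> n" for T
    proof -
      have "(1 + K / r0\<^sup>2) ^ T \<le> exp (K / r0\<^sup>2) ^ T"
        using K by (intro power_mono) auto
      also have "\<dots> = exp (T * (K / r0\<^sup>2))" by (simp only: exp_of_nat_mult)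
      also have "T * (K / r0\<^sup>2) \<le> 1 / 2"
      proof -
        have "T * (K / r0\<^sup>2) \<le> n * (K / (\<mu> * n / 2)\<^sup>2)"
        proof (rule mult_mono)
          have p: "\<mu> * n / 2 > 0" using \<mu> n0 by simp
          then have "(\<mu> * n / 2)\<^sup>2 \<le> (real r0)\<^sup>2" using r0_half by (intro power_mono) auto
          moreover have "real r0 > 0" using p r0_half by linarith
          ultimately have "K / (real r0)\<^sup>2 \<le> K / (\<mu> * n / 2)\<^sup>2"
            using p K by (meson divide_left_mono mult_pos_pos zero_less_power)
          then show "K / r0\<^sup>2 \<le> K / (\<mu> * n / 2)\<^sup>2" by simp
        qed (use that K in auto)
        also have "\<dots> = 4 * K / (\<mu>\<^sup>2 * n)" using n0 by (simp add: power2_eq_square field_simps)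
        also have "\<dots> \<le> 1 / 2" using n2 \<mu> n0 by (simp add: field_simps)
        finally show ?thesis .
      qed
      also have "exp (1 / 2 :: real) \<le> 2" using exp_bound_half[of "1 / 2 :: real"] by simp
      finally show ?thesis by simp
    qed
    show ?case
    proof (intro allI impI, elim conjE)
      fix V :: "'v set" and H :: "nat \<Rightarrow> nat \<Rightarrow> 'v dkgraph" and T :: nat
      assume V: "finite V" "card V = n" and T: "card (verts F) * T \<le> (1 - \<mu>) * n"
        and H: "\<forall>s<T. \<forall>i\<in>{1..card (edges F)}. dkgraph k (H s i) \<and> verts (H s i) = V \<and>
         (y + \<eta>) * (n - d choose (k - d)) \<le> min_rule_deg d l N (H s i)"
      \<comment> \<open>The form y + \<eta> - \<eta> fits \<open>card_degenerate_subsets_le\<close>: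
        a Q-set that loses at most \<eta> still meets the covering condition at y.\<close>
      define B where "B s = {U \<in> nsets V Q. \<exists>i\<in>{1..f}. min_rule_deg d l N (induced (H s i) U) < (y + \<eta> - \<eta>) * (Q - d choose (k - d))}" for s
      have "real (b * T) + r0 \<le> n" using T r0_le by (simp add: b_def algebra_simps)
      then have T': "b * T + r0 \<le> card V" unfolding V by (simp only: of_nat_add[symmetric] of_nat_le_iff)
      have "T \<le> b * T" using b by (simp add: b_def)
      then have Tn: "T \<le> n" using T' V by linarith
      have B: "card (B s) \<le> \<delta> / 2 * (card V choose Q)" if s: "s < T" for s
      proof -
        have "card (B s) \<le> f * l * (Q choose d) * exp (- (\<eta>\<^sup>2 * real (Q - d) / (16 * (real (k - d))\<^sup>2))) * (card V choose Q)"
          unfolding B_def by (rule card_degenerate_subsets_le[OF rule]) (use V H s d Q nQ \<eta> in \<open>auto simp: f_def\<close>)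
        also have "\<eta>\<^sup>2 * real (Q - d) / (16 * (real (k - d))\<^sup>2) = \<kappa> * real (Q - d)" by (simp add: \<kappa>_def)
        also have "f * l * (Q choose d) * exp (- (\<kappa> * real (Q - d))) * (card V choose Q) \<le> \<delta> / 2 * (card V choose Q)"
          using Q\<delta> by (intro mult_right_mono) auto
        finally show ?thesis .
      qed
      have "\<exists>w. uniform_weight U b w \<and> (U \<notin> B s \<longrightarrow> (\<forall>e. w e > 0 \<longrightarrow> e \<in> copy_sets cv F V (H s)))"
        if s: "s < T" and U: "U \<in> nsets V Q" for s U
      proof (cases "U \<in> B s")
        case True
        have "uniform_weight U b (\<lambda>e. 1 / (card U - 1 choose (b - 1)))"
          using U b Q by (intro uniform_weight_const) (auto simp: nsets_def b_def)
        then show ?thesis using True by blast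
      next
        case False
        have U': "finite U" "U \<subseteq> V" "card U = Q" using U by (auto simp: nsets_def)
        have "dense_system k d l N y Q U f (\<lambda>i. induced (H s i) U)"
          unfolding dense_system_def dk_system_def
        proof (intro conjI ballI)
          fix i assume i: "i \<in> {1..f}"
          then have "dkgraph k (H s i)" "verts (H s i) = V" using H s by (auto simp: f_def)
          then show "dkgraph k (induced (H s i) U)" "verts (induced (H s i) U) = U"
            using U' dkgraph_induced verts_induced[of U "H s i"] by auto
          show "y * (Q - d choose (k - d)) \<le> min_rule_deg d l N (induced (H s i) U)"
            using False U i by (auto simp: B_def not_less)
        qed (use U' in auto)
        then obtain w where w: "perfect_fractional_matching U (copy_sets cv F U (\<lambda>i. induced (H s i) U)) w"
          using pfm by blast
        show ?thesis
        proof (intro exI conjI impI allI)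
          show "uniform_weight U b (\<lambda>e. if e \<in> copy_sets cv F U (\<lambda>i. induced (H s i) U) then w e else 0)"
            unfolding b_def by (rule uniform_weight_copy_sets[OF F U'(1) w])
          show "e \<in> copy_sets cv F V (H s)"
            if "0 < (if e \<in> copy_sets cv F U (\<lambda>i. induced (H s i) U) then w e else 0)" for e
            using that copy_sets_induced_subset[OF U'(2)] by (auto split: if_splits)
        qed
      qed
      then obtain W where W: "\<And>s U. s < T \<Longrightarrow> U \<in> nsets V Q \<Longrightarrow> uniform_weight U b (W s U)"
        "\<And>s U e. s < T \<Longrightarrow> U \<in> nsets V Q \<Longrightarrow> U \<notin> B s \<Longrightarrow> W s U e > 0 \<Longrightarrow> e \<in> copy_sets cv F V (H s)"
        by metis
      have "\<exists>E. (\<forall>s<T. E s \<in> nsets V b) \<and> disjoint_family_on E {..<T} \<and>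
        card {s. s < T \<and> \<not> E s \<in> copy_sets cv F V (H s)} \<le> (1 + drift b Q / r0\<^sup>2) ^ T * (\<delta> / 2) * T"
        by (rule greedy_packing[where W = W and B = B]) (use V b Q r0 T' W B in \<open>auto simp: b_def B_def\<close>)
      then obtain E where E: "\<forall>s<T. E s \<in> nsets V b" "disjoint_family_on E {..<T}"
        and le: "card {s. s < T \<and> E s \<notin> copy_sets cv F V (H s)} \<le> (1 + K / r0\<^sup>2) ^ T * (\<delta> / 2) * T"
        by (auto simp: K_def)
      have "(1 + K / r0\<^sup>2) ^ T * (\<delta> / 2) * T \<le> 2 * (\<delta> / 2) * T"
        using zeta[OF Tn] \<delta> by (intro mult_right_mono) auto
      then have "card {s. s < T \<and> E s \<notin> copy_sets cv F V (H s)} \<le> \<delta> * T" using le by simp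
      then show "\<exists>E. (\<forall>s<T. E s \<in> nsets V (card (verts F))) \<and> disjoint_family_on E {..<T} \<and>
        card {s. s < T \<and> E s \<notin> copy_sets cv F V (H s)} \<le> \<delta> * T"
        using E unfolding b_def by blast
    qed
  qed
qed

section \<open>Absorption\<close>

definition absorbs ::
  "dir_conv \<Rightarrow> 'v::linorder dkgraph \<Rightarrow> (nat \<Rightarrow> 'v dkgraph) \<Rightarrow> 'v set \<times> nat set \<Rightarrow> 'v set \<times> nat set \<Rightarrow> bool" where
  "absorbs cv F H t y \<longleftrightarrow> fst y \<inter> fst t = {} \<and> snd y \<inter> snd t = {} \<and>
     rainbow_factor cv F H (fst t) (snd t) \<and> rainbow_factor cv F H (fst y \<union> fst t) (snd y \<union> snd t)"

text \<open>An absorber takes up b vertices and f colours by switching to its larger factor.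
  Spending it lowers each count of available absorbers by at most one, so availability and leftover
  decrease together; absorbers unspent at the end keep their inner factors.\<close>

lemma absorb_leftover:
  assumes F: "dkgraph k F" "k \<ge> 1"
    and I: "finite I" "disjoint_family_on L I" "disjoint_family_on D I"
    and LD: "\<And>i. i \<in> I \<Longrightarrow> rainbow_factor cv F H (L i) (D i)"
    and W: "finite W" "card W = b * t" "\<And>i. i \<in> I \<Longrightarrow> W \<inter> L i = {}"
    and C: "finite C" "card C = f * t" "\<And>i. i \<in> I \<Longrightarrow> C \<inter> D i = {}"
    and many: "\<And>B A. B \<in> nsets W b \<Longrightarrow> A \<in> nsets C f \<Longrightarrow> t \<le> card {i \<in> I. absorbs cv F H (L i, D i) (B, A)}"
  shows "rainbow_factor cv F H (W \<union> (\<Union>i\<in>I. L i)) (C \<union> (\<Union>i\<in>I. D i))"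
  using I LD W C many
proof (induction t arbitrary: I W C)
  case 0
  then have "W = {}" "C = {}" by auto
  then show ?case using rainbow_factor_UN[OF F 0(1) 0(4,2,3)] by simp
next
  case (Suc t)
  have "b \<le> card W" "f \<le> card C" using Suc.prems by auto
  then obtain B A where B: "B \<subseteq> W" "card B = b" "finite B" and A: "A \<subseteq> C" "card A = f" "finite A"
    using obtain_subset_with_card_n by metis
  have BA: "B \<in> nsets W b" "A \<in> nsets C f" using A B by (auto simp: nsets_def)
  then have "card {i \<in> I. absorbs cv F H (L i, D i) (B, A)} > 0" using Suc.prems(11)[OF BA] by linarith
  then obtain i where i: "i \<in> I" "absorbs cv F H (L i, D i) (B, A)"
    by (auto simp: card_gt_0_iff)
  have 1: "rainbow_factor cv F H (B \<union> L i) (A \<union> D i)" using i by (simp add: absorbs_def)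
  have 2: "rainbow_factor cv F H ((W - B) \<union> (\<Union>j\<in>I - {i}. L j)) ((C - A) \<union> (\<Union>j\<in>I - {i}. D j))"
  proof (rule Suc.IH)
    show "finite (I - {i})" "disjoint_family_on L (I - {i})" "disjoint_family_on D (I - {i})"
      using Suc.prems by (auto simp: disjoint_family_on_def)
    show "finite (W - B)" "card (W - B) = b * t" "finite (C - A)" "card (C - A) = f * t"
      using Suc.prems A B by (auto simp: card_Diff_subset)
    show "t \<le> card {j \<in> I - {i}. absorbs cv F H (L j, D j) (B', A')}"
      if "B' \<in> nsets (W - B) b" "A' \<in> nsets (C - A) f" for B' A'
    proof -
      have "B' \<in> nsets W b" "A' \<in> nsets C f" using that by (auto simp: nsets_def)
      then have "Suc t \<le> card {j \<in> I. absorbs cv F H (L j, D j) (B', A')}" by (rule Suc.prems(11))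
      also have "\<dots> \<le> card (insert i {j \<in> I - {i}. absorbs cv F H (L j, D j) (B', A')})"
        using Suc.prems(1) by (intro card_mono) auto
      also have "\<dots> = Suc (card {j \<in> I - {i}. absorbs cv F H (L j, D j) (B', A')})"
        using Suc.prems(1) by (subst card_insert_disjoint) auto
      finally show ?thesis by simp
    qed
    show "rainbow_factor cv F H (L j) (D j)" "(W - B) \<inter> L j = {}" "(C - A) \<inter> D j = {}" if "j \<in> I - {i}" for j
      using that Suc.prems(4)[of j] Suc.prems(7)[of j] Suc.prems(10)[of j] by blast+
  qed
  have dL: "L i \<inter> L j = {}" "D i \<inter> D j = {}" if "j \<in> I - {i}" for j
    using that i(1) Suc.prems(2,3) by (auto simp: disjoint_family_on_def) (metis IntI empty_iff)+
  have "rainbow_factor cv F H ((B \<union> L i) \<union> ((W - B) \<union> (\<Union>j\<in>I - {i}. L j))) ((A \<union> D i) \<union> ((C - A) \<union> (\<Union>j\<in>I - {i}. D j)))"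
  proof (rule rainbow_factor_Un[OF F 1 2])
    have "B \<inter> L j = {}" if "j \<in> I" for j using Suc.prems(7)[OF that] B by auto
    then show "(B \<union> L i) \<inter> ((W - B) \<union> (\<Union>j\<in>I - {i}. L j)) = {}"
      using Suc.prems(7)[OF i(1)] dL by blast
    have "A \<inter> D j = {}" if "j \<in> I" for j using Suc.prems(10)[OF that] A by auto
    then show "(A \<union> D i) \<inter> ((C - A) \<union> (\<Union>j\<in>I - {i}. D j)) = {}"
      using Suc.prems(10)[OF i(1)] dL by blast
  qed
  moreover have "(B \<union> L i) \<union> ((W - B) \<union> (\<Union>j\<in>I - {i}. L j)) = W \<union> (\<Union>i\<in>I. L i)" using B i by auto
  moreover have "(A \<union> D i) \<union> ((C - A) \<union> (\<Union>j\<in>I - {i}. D j)) = C \<union> (\<Union>i\<in>I. D i)" using A i by auto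
  ultimately show ?case by simp
qed

text \<open>A random q-set meets L with probability at most q^2 / |X|, by a union bound over the
  points of L; multiplied out to stay in the natural numbers.\<close>

lemma card_nsets_meeting_le:
  assumes X: "finite X" and L: "L \<in> nsets X q"
  shows "card {A \<in> nsets X q. L \<inter> A \<noteq> {}} * card X \<le> q\<^sup>2 * (card X choose q)"
proof (cases "q = 0")
  case True
  then show ?thesis by simp
next
  case False
  have L': "L \<subseteq> X" "card L = q" "finite L" using L by (auto simp: nsets_def)
  have fX: "finite (nsets X q)" using X by (rule finite_imp_finite_nsets)
  have "{A \<in> nsets X q. L \<inter> A \<noteq> {}} \<subseteq> (\<Union>v\<in>L. {A \<in> nsets X q. {v} \<subseteq> A})" by auto
  then have "card {A \<in> nsets X q. L \<inter> A \<noteq> {}} \<le> card (\<Union>v\<in>L. {A \<in> nsets X q. {v} \<subseteq> A})"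
    using fX L' by (intro card_mono) auto
  also have "\<dots> \<le> (\<Sum>v\<in>L. card {A \<in> nsets X q. {v} \<subseteq> A})"
    using L' by (intro card_UN_le) auto
  also have "\<dots> = (\<Sum>v\<in>L. card X - 1 choose (q - 1))"
    using L' False by (intro sum.cong refl) (subst card_nsets_superset[OF X], auto)
  also have "\<dots> = q * (card X - 1 choose (q - 1))" using L' by simp
  finally have "card {A \<in> nsets X q. L \<inter> A \<noteq> {}} * card X \<le> q * (card X - 1 choose (q - 1)) * card X"
    by (rule mult_le_mono1)
  also have "\<dots> = q * (q * (card X choose q))"
    using times_binomial_minus1_eq[of q "card X"] False by simp
  finally show ?thesis by (simp add: power2_eq_square mult_ac)
qed

text \<open>An instance of \<open>potential_selection\<close> with demands (B, C) and candidates (L,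
  D). A candidate conflicts with a proportion of at most (h b)^2 / |V| + (h f)^2 / m of all pairs,
  which permits M to be linear in |V| when m is.\<close>

lemma absorbing_family:
  fixes c \<alpha> :: real and H :: "nat \<Rightarrow> 'v::linorder dkgraph"
  assumes V: "finite V" "V \<noteq> {}" and f: "1 \<le> f" and m: "m \<ge> f + 2 * f * (h * f) + h * f + 1" and n: "b \<le> card V"
    and \<alpha>: "0 < \<alpha>" "\<alpha> \<le> 1" "\<alpha> \<le> c / 2"
    and many: "\<And>B C D. B \<in> nsets V b \<Longrightarrow> C \<in> nsets {1..m} f \<Longrightarrow> D \<in> nsets ({1..m} - C) (h * f) \<Longrightarrow>
       c * card V ^ (h * b) \<le> card {L \<in> nsets V (h * b). absorbs cv F H (L, D) (B, C)}"
    and M: "2 * M * ((h * b)\<^sup>2 / card V + (h * f)\<^sup>2 / m) \<le> \<alpha>"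
    and q: "card V ^ b * m ^ f * (1 - \<alpha> / 4) ^ M * 2 ^ q < 1"
  shows "\<exists>L D. (\<forall>i<M. L i \<in> nsets V (h * b) \<and> D i \<in> nsets {1..m} (h * f) \<and> rainbow_factor cv F H (L i) (D i)) \<and>
     disjoint_family_on L {..<M} \<and> disjoint_family_on D {..<M} \<and>
     (\<forall>B\<in>nsets V b. \<forall>C\<in>nsets {1..m} f. q \<le> card {i. i < M \<and> absorbs cv F H (L i, D i) (B, C)})"
proof -
  define n where "n = card V"
  define \<T> where "\<T> = nsets V (h * b) \<times> nsets {1..m} (h * f)"
  \<comment> \<open>Restricting to pairs with an inner factor makes every selected candidate usable
    when it is not spent; no absorbing pair is lost by this.\<close>
  define T where "T = {t \<in> \<T>. rainbow_factor cv F H (fst t) (snd t)}"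
  define Y where "Y = nsets V b \<times> nsets {1..m} f"
  define cf where "cf t t' \<longleftrightarrow> fst t \<inter> fst t' \<noteq> {} \<or> snd t \<inter> snd t' \<noteq> {}" for t t' :: "'v set \<times> nat set"
  define a where "a = (m - f choose (h * f)) * (c * n ^ (h * b))"
  \<comment> \<open>The inserted 0 keeps \<open>Max\<close> meaningful when there are no candidate
    sets.\<close>
  define s1 where "s1 = Max (insert 0 ((\<lambda>L. card {A \<in> nsets V (h * b). L \<inter> A \<noteq> {}}) ` nsets V (h * b)))"
  define s2 where "s2 = Max (insert 0 ((\<lambda>L. card {A \<in> nsets {1..m} (h * f). L \<inter> A \<noteq> {}}) ` nsets {1..m} (h * f)))"
  define s where "s = s1 * (m choose (h * f)) + (n choose (h * b)) * s2"
  have npos: "n > 0" using V by (auto simp: n_def card_gt_0_iff)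
  have mpos: "m > 0" using m by simp
  have fin: "finite (nsets V r)" "finite (nsets {1..m} r)" for r using V by (auto intro: finite_imp_finite_nsets)
  have f\<T>: "finite \<T>" using fin by (simp add: \<T>_def)
  have fT: "finite T" using f\<T> by (simp add: T_def)
  have c\<T>: "card \<T> = (n choose (h * b)) * (m choose (h * f))" by (simp add: \<T>_def card_cartesian_product n_def)
  have cpos: "c > 0" using \<alpha> by simp
  \<comment> \<open>The colour sets disjoint from C are at least half of all, by the lower bound on
    m; this is the source of the 2 in \<alpha> <= c / 2.\<close>
  have a\<T>: "\<alpha> * card \<T> \<le> a"
  proof -
    have "real (n choose (h * b)) \<le> n ^ (h * b)"
      using binomial_le_power[of n "h * b"] by (simp only: of_nat_le_iff)
    moreover have "real (m choose (h * f)) \<le> 2 * (m - f choose (h * f))"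
    proof -
      have bd: "(1 - f * (h * f) / (real m - f)) * (m choose (h * f)) \<le> (m - f choose (h * f))"
        using binomial_diff_ge[of f "h * f" m] m by (simp add: of_nat_diff)
      have "real m \<ge> real (f + 2 * f * (h * f) + h * f + 1)" using m by (simp only: of_nat_le_iff)
      moreover have "real (f + 2 * f * (h * f) + h * f + 1) = f + 2 * real (f * (h * f)) + real (h * f) + 1" by simp
      moreover have "0 \<le> real (h * f)" "0 \<le> real (f * (h * f))" by auto
      ultimately have "2 * real (f * (h * f)) \<le> real m - f" "real m - f > 0" by linarith+
      then have "1 / 2 \<le> 1 - f * (h * f) / (real m - f)" by (simp add: pos_divide_le_eq)
      then have "1 / 2 * (m choose (h * f)) \<le> (1 - f * (h * f) / (real m - f)) * (m choose (h * f))"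
        by (rule mult_right_mono) simp
      also have "\<dots> \<le> (m - f choose (h * f))" by (rule bd)
      finally show ?thesis by simp
    qed
    ultimately have "real (n choose (h * b)) * (m choose (h * f)) \<le> real (n ^ (h * b)) * real (2 * (m - f choose (h * f)))"
      by (rule mult_mono) auto
    then have "\<alpha> * (real (n choose (h * b)) * (m choose (h * f))) \<le> (c / 2) * (real (n ^ (h * b)) * real (2 * (m - f choose (h * f))))"
      using \<alpha> by (intro mult_mono[of \<alpha> "c / 2"]) auto
    then have "\<alpha> * card \<T> \<le> (c / 2) * (real (n ^ (h * b)) * real (2 * (m - f choose (h * f))))"
      unfolding c\<T> of_nat_mult .
    then show ?thesis by (simp add: a_def mult_ac)
  qed
  have s1: "s1 * real n \<le> (h * b)\<^sup>2 * (n choose (h * b))"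
  proof -
    have "s1 \<in> insert 0 ((\<lambda>L. card {A \<in> nsets V (h * b). L \<inter> A \<noteq> {}}) ` nsets V (h * b))"
      unfolding s1_def using fin by (intro Max_in) auto
    then have "s1 * n \<le> (h * b)\<^sup>2 * (n choose (h * b))"
      using card_nsets_meeting_le[OF V(1)] by (auto simp: n_def)
    then show ?thesis by (metis of_nat_le_iff of_nat_mult)
  qed
  have s2: "s2 * real m \<le> (h * f)\<^sup>2 * (m choose (h * f))"
  proof -
    have "s2 \<in> insert 0 ((\<lambda>L. card {A \<in> nsets {1..m} (h * f). L \<inter> A \<noteq> {}}) ` nsets {1..m} (h * f))"
      unfolding s2_def using fin by (intro Max_in) auto
    then have "s2 * m \<le> (h * f)\<^sup>2 * (m choose (h * f))"
      using card_nsets_meeting_le[of "{1..m}" _ "h * f"] by auto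
    then show ?thesis by (metis of_nat_le_iff of_nat_mult)
  qed
  have "s \<le> ((h * b)\<^sup>2 / n + (h * f)\<^sup>2 / m) * card \<T>"
  proof -
    have "real s1 \<le> (h * b)\<^sup>2 / n * (n choose (h * b))" using s1 npos by (simp add: field_simps)
    moreover have "real s2 \<le> (h * f)\<^sup>2 / m * (m choose (h * f))" using s2 mpos by (simp add: field_simps)
    ultimately have "real s \<le> (h * b)\<^sup>2 / n * (n choose (h * b)) * (m choose (h * f)) + (n choose (h * b)) * ((h * f)\<^sup>2 / m * (m choose (h * f)))"
      unfolding s_def of_nat_add of_nat_mult by (intro add_mono mult_right_mono mult_left_mono) auto
    then show ?thesis by (simp add: c\<T> distrib_left mult_ac)
  qed
  then have "2 * M * s \<le> 2 * M * (((h * b)\<^sup>2 / n + (h * f)\<^sup>2 / m) * card \<T>)"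
    by (simp add: mult_left_mono)
  also have "\<dots> = (2 * M * ((h * b)\<^sup>2 / n + (h * f)\<^sup>2 / m)) * card \<T>" by (simp add: mult_ac)
  also have "\<dots> \<le> \<alpha> * card \<T>" using M by (intro mult_right_mono) (auto simp: n_def)
  finally have Ms: "2 * M * s \<le> a" using a\<T> by simp
  have "\<exists>t. (\<forall>i<M. t i \<in> T) \<and> (\<forall>i<M. \<forall>j<i. \<not> cf (t j) (t i)) \<and> (\<forall>y\<in>Y. q \<le> card {i. i < M \<and> absorbs cv F H (t i) y})"
  proof (rule potential_selection[where a = a and \<alpha> = \<alpha> and s = s])
    show "finite T" by (rule fT)
    show "finite Y" "Y \<noteq> {}" using fin n m by (auto simp: Y_def nsets_eq_empty_iff V)
    show "2 * M * s \<le> a" by (rule Ms)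
    have "card T \<le> card \<T>" using f\<T> by (intro card_mono) (auto simp: T_def)
    then have "\<alpha> * card T \<le> \<alpha> * card \<T>" using \<alpha> by (intro mult_left_mono) auto
    then show "\<alpha> * card T \<le> a" using a\<T> by simp
    show "0 \<le> \<alpha>" "\<alpha> \<le> 1" using \<alpha> by auto
    show "a > 0" using cpos npos m by (simp add: a_def)
    show "a \<le> card {t \<in> T. absorbs cv F H t y}" if y: "y \<in> Y" for y
    proof -
      define B C where "B = fst y" and "C = snd y"
      have BC: "B \<in> nsets V b" "C \<in> nsets {1..m} f" "y = (B, C)" using y by (auto simp: Y_def B_def C_def)
      have "a = (\<Sum>D\<in>nsets ({1..m} - C) (h * f). c * n ^ (h * b))"
        using BC by (simp add: a_def card_Diff_subset mem_nsets_iff finite_subset[of C "{1..m}"])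
      also have "\<dots> \<le> (\<Sum>D\<in>nsets ({1..m} - C) (h * f). real (card {L \<in> nsets V (h * b). absorbs cv F H (L, D) (B, C)}))"
        using many[OF BC(1,2)] by (intro sum_mono) (simp add: n_def)
      also have "\<dots> = card (Sigma (nsets ({1..m} - C) (h * f)) (\<lambda>D. {L \<in> nsets V (h * b). absorbs cv F H (L, D) (B, C)}))"
        using fin by (subst card_SigmaI) (auto intro!: finite_imp_finite_nsets)
      also have "card (Sigma (nsets ({1..m} - C) (h * f)) (\<lambda>D. {L \<in> nsets V (h * b). absorbs cv F H (L, D) (B, C)}))
         \<le> card {t \<in> T. absorbs cv F H t y}"
      proof (rule card_inj_on_le[where f = "\<lambda>(D, L). (L, D)"])
        show "(\<lambda>(D, L). (L, D)) ` Sigma (nsets ({1..m} - C) (h * f)) (\<lambda>D. {L \<in> nsets V (h * b). absorbs cv F H (L, D) (B, C)})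
            \<subseteq> {t \<in> T. absorbs cv F H t y}"
          by (auto simp: T_def \<T>_def BC(3) absorbs_def nsets_def)
      qed (use fT in \<open>auto simp: inj_on_def\<close>)
      finally show ?thesis by simp
    qed
    show "card {t' \<in> T. cf t t'} \<le> s" if t: "t \<in> T" for t
    proof -
      have t': "fst t \<in> nsets V (h * b)" "snd t \<in> nsets {1..m} (h * f)" using t by (auto simp: T_def \<T>_def)
      have "{t' \<in> T. cf t t'} \<subseteq> {A \<in> nsets V (h * b). fst t \<inter> A \<noteq> {}} \<times> nsets {1..m} (h * f) \<union>
          nsets V (h * b) \<times> {A \<in> nsets {1..m} (h * f). snd t \<inter> A \<noteq> {}}"
        by (auto simp: T_def \<T>_def cf_def)
      then have "card {t' \<in> T. cf t t'} \<le> card ({A \<in> nsets V (h * b). fst t \<inter> A \<noteq> {}} \<times> nsets {1..m} (h * f) \<union>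
          nsets V (h * b) \<times> {A \<in> nsets {1..m} (h * f). snd t \<inter> A \<noteq> {}})"
        using fin by (intro card_mono) auto
      also have "\<dots> \<le> card {A \<in> nsets V (h * b). fst t \<inter> A \<noteq> {}} * (m choose (h * f)) +
          (n choose (h * b)) * card {A \<in> nsets {1..m} (h * f). snd t \<inter> A \<noteq> {}}"
        using card_Un_le[of "{A \<in> nsets V (h * b). fst t \<inter> A \<noteq> {}} \<times> nsets {1..m} (h * f)"
          "nsets V (h * b) \<times> {A \<in> nsets {1..m} (h * f). snd t \<inter> A \<noteq> {}}"]
        by (simp add: card_cartesian_product n_def)
      also have "\<dots> \<le> s"
        unfolding s_def
      proof (intro add_mono mult_le_mono le_refl)
        show "card {A \<in> nsets V (h * b). fst t \<inter> A \<noteq> {}} \<le> s1"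
          unfolding s1_def using fin t' by (intro Max_ge) auto
        show "card {A \<in> nsets {1..m} (h * f). snd t \<inter> A \<noteq> {}} \<le> s2"
          unfolding s2_def using fin t' by (intro Max_ge) auto
      qed
      finally show ?thesis .
    qed
    show "card Y * (1 - \<alpha> / 4) ^ M * 2 ^ q < 1"
    proof -
      have "card Y \<le> n ^ b * m ^ f"
        unfolding Y_def card_cartesian_product by (simp add: n_def binomial_le_power mult_le_mono)
      then have "real (card Y) \<le> card V ^ b * m ^ f" by (metis n_def of_nat_le_iff of_nat_mult of_nat_power)
      then have "card Y * ((1 - \<alpha> / 4) ^ M * 2 ^ q) \<le> (card V ^ b * m ^ f) * ((1 - \<alpha> / 4) ^ M * 2 ^ q)"
        using \<alpha> by (intro mult_right_mono) auto
      then show ?thesis using q by (simp add: mult.assoc)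
    qed
  qed
  then obtain t where t: "\<And>i. i < M \<Longrightarrow> t i \<in> T" "\<And>i j. i < M \<Longrightarrow> j < i \<Longrightarrow> \<not> cf (t j) (t i)"
    "\<And>y. y \<in> Y \<Longrightarrow> q \<le> card {i. i < M \<and> absorbs cv F H (t i) y}" by blast
  have "fst (t i) \<inter> fst (t j) = {} \<and> snd (t i) \<inter> snd (t j) = {}" if "i < M" "j < M" "i \<noteq> j" for i j
    using t(2)[of i j] t(2)[of j i] that by (cases "i < j") (auto simp: cf_def)
  then have "disjoint_family_on (fst \<circ> t) {..<M}" "disjoint_family_on (snd \<circ> t) {..<M}"
    by (auto simp: disjoint_family_on_def)
  moreover have "fst (t i) \<in> nsets V (h * b) \<and> snd (t i) \<in> nsets {1..m} (h * f) \<and> rainbow_factor cv F H (fst (t i)) (snd (t i))"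
    if "i < M" for i using t(1)[OF that] by (auto simp: T_def \<T>_def)
  moreover have "q \<le> card {i. i < M \<and> absorbs cv F H (fst (t i), snd (t i)) (B, C)}"
    if "B \<in> nsets V b" "C \<in> nsets {1..m} f" for B C
    using t(3)[of "(B, C)"] that by (simp add: Y_def)
  ultimately show ?thesis by (intro exI[of _ "fst \<circ> t"] exI[of _ "snd \<circ> t"]) simp
qed

section \<open>From absorber graphs to absorbing pairs\<close>

lemma factor_on_card:
  assumes F: "dkgraph k F" and P: "factor_on cv F W P"
  shows "card W = card (verts F) * card (verts ` P)"
proof -
  have iso: "isomorphic cv F G" if "G \<in> P" for G using P that by (auto simp: factor_on_def packing_def)
  have "card W = card (\<Union>(verts ` P))" using P by (simp add: factor_on_def)
  also have "\<dots> = (\<Sum>U\<in>verts ` P. card U)"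
  proof (rule card_Union_disjoint)
    show "pairwise disjnt (verts ` P)"
      using P by (auto simp: factor_on_def packing_def pairwise_def)
    show "finite U" if "U \<in> verts ` P" for U
      using that isomorphic_dkgraph[OF F iso] by (auto simp: dkgraph_def)
  qed
  also have "\<dots> = (\<Sum>U\<in>verts ` P. card (verts F))"
    using isomorphic_card[OF iso] by (intro sum.cong) auto
  finally show ?thesis by simp
qed

lemma card_dkgraphs_on_le:
  fixes X :: "'v set"
  assumes "finite X"
  shows "finite {G. verts G = X \<and> edges G \<subseteq> Pow X \<times> UNIV}"
    "card {G. verts G = X \<and> edges G \<subseteq> Pow X \<times> UNIV} \<le> 2 ^ (2 * 2 ^ card X)"
proof -
  have UD: "(UNIV :: dir set) = {Plus, Minus}" using dir.exhaust by auto
  define E where "E = Pow (Pow X \<times> (UNIV :: dir set))"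
  have fE: "finite E" unfolding E_def UD using assms by simp
  have cE: "card E = 2 ^ (2 * 2 ^ card X)"
    unfolding E_def UD using assms by (simp add: card_Pow card_cartesian_product mult.commute)
  have eq: "{G. verts G = X \<and> edges G \<subseteq> Pow X \<times> UNIV} \<subseteq> DK X ` E"
  proof
    fix G assume "G \<in> {G. verts G = X \<and> edges G \<subseteq> Pow X \<times> UNIV}"
    then show "G \<in> DK X ` E" by (cases G) (auto simp: E_def)
  qed
  then show "finite {G. verts G = X \<and> edges G \<subseteq> Pow X \<times> UNIV}" using fE finite_subset by blast
  show "card {G. verts G = X \<and> edges G \<subseteq> Pow X \<times> UNIV} \<le> 2 ^ (2 * 2 ^ card X)"
    unfolding cE[symmetric] using surj_card_le[OF fE eq] .
qed

text \<open>The threshold counts graphs G, while the selection needs vertex sets L for prescribed C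
  and D. A bijection renames the colours so that D takes the first h f indices and C the last f, as
  the inner factor of \<open>rainbow_absorber\<close> demands. Each L comes from boundedly many G,
  whence the constant divisor.\<close>

lemma card_absorbs_ge:
  fixes F A :: "'v::linorder dkgraph" and e y :: real
  assumes F: "dkgraph k F" and b: "card (verts F) = b" "1 \<le> b" and f: "card (edges F) = f"
    and A: "dkgraph k A" "card (verts A) = Suc h * b"
    and dense: "dense_system k d l N y n V m H"
    and many: "\<And>H B. dense_system k d l N y n V (Suc h * f) H \<Longrightarrow> B \<subseteq> V \<Longrightarrow> card B = b \<Longrightarrow>
      e * real n ^ (h * b) \<le> card {G. rainbow_absorber cv F V (Suc h * f) H B G \<and> isomorphic cv A G}"
    and B: "B \<in> nsets V b" and C: "C \<in> nsets {1..m} f" and D: "D \<in> nsets ({1..m} - C) (h * f)"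
  shows "e / 2 ^ (2 * 2 ^ (Suc h * b)) * real n ^ (h * b) \<le> card {L \<in> nsets V (h * b). absorbs cv F H (L, D) (B, C)}"
proof -
  have V: "finite V" "card V = n" using dense by (auto simp: dense_system_def dk_system_def)
  have BCD: "B \<subseteq> V" "finite B" "card B = b" "C \<subseteq> {1..m}" "finite C" "card C = f"
    "D \<subseteq> {1..m}" "D \<inter> C = {}" "finite D" "card D = h * f"
    using B C D by (auto simp: nsets_def)
  obtain \<sigma>1 where \<sigma>1: "bij_betw \<sigma>1 {1..h * f} D"
    using BCD finite_same_card_bij[of "{1..h * f}" D] by auto
  obtain \<sigma>2 where \<sigma>2: "bij_betw \<sigma>2 {h * f + 1..Suc h * f} C"
    using BCD finite_same_card_bij[of "{h * f + 1..Suc h * f}" C] by auto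
  define \<sigma> where "\<sigma> i = (if i \<in> {1..h * f} then \<sigma>1 i else \<sigma>2 i)" for i
  have b1: "bij_betw \<sigma> {1..h * f} D"
    using \<sigma>1 by (subst bij_betw_cong[of _ _ \<sigma>1]) (auto simp: \<sigma>_def)
  have b2: "bij_betw \<sigma> {h * f + 1..Suc h * f} C"
    using \<sigma>2 by (subst bij_betw_cong[of _ _ \<sigma>2]) (auto simp: \<sigma>_def)
  have "bij_betw \<sigma> ({1..h * f} \<union> {h * f + 1..Suc h * f}) (D \<union> C)"
    using b1 b2 BCD by (intro bij_betw_combine) auto
  moreover have "{1..h * f} \<union> {h * f + 1..Suc h * f} = {1..Suc h * f}" by auto
  ultimately have b3: "bij_betw \<sigma> {1..Suc h * f} (C \<union> D)" by (simp add: Un_commute)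
  have "dense_system k d l N y n V (Suc h * f) (\<lambda>i. H (\<sigma> i))"
  proof -
    have "\<sigma> i \<in> {1..m}" if "i \<in> {1..Suc h * f}" for i
      using bij_betwE[OF b3] that BCD by blast
    then show ?thesis using dense unfolding dense_system_def dk_system_def by blast
  qed
  define \<G> where "\<G> = {G. rainbow_absorber cv F V (Suc h * f) (\<lambda>i. H (\<sigma> i)) B G \<and> isomorphic cv A G}"
  define \<L> where "\<L> = {L \<in> nsets V (h * b). absorbs cv F H (L, D) (B, C)}"
  define K where "K X = {G :: 'v dkgraph. verts G = X \<and> edges G \<subseteq> Pow X \<times> UNIV}" for X
  have f\<L>: "finite \<L>" using V finite_imp_finite_nsets[of V "h * b"] by (simp add: \<L>_def)
  have eG: "e * real n ^ (h * b) \<le> card \<G>"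
    unfolding \<G>_def by (rule many) (use \<open>dense_system k d l N y n V (Suc h * f) (\<lambda>i. H (\<sigma> i))\<close> BCD in auto)
  have "\<G> \<subseteq> (\<Union>L\<in>\<L>. K (B \<union> L))"
  proof
    fix G assume "G \<in> \<G>"
    then have ra: "rainbow_absorber cv F V (Suc h * f) (\<lambda>i. H (\<sigma> i)) B G" and iso: "isomorphic cv A G"
      by (auto simp: \<G>_def)
    have G: "dkgraph k G" "card (verts G) = Suc h * b"
      using isomorphic_dkgraph[OF A(1) iso] isomorphic_card[OF iso] A by auto
    obtain L Pe Pi where L: "verts G \<subseteq> V" "verts G = B \<union> L" "B \<inter> L = {}"
      and Pe: "factor_on cv F (verts G) Pe" "rainbow (\<lambda>i. H (\<sigma> i)) {1..Suc h * f} (pack_edges Pe)"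
      and Pi: "factor_on cv F L Pi" "rainbow (\<lambda>i. H (\<sigma> i)) {1..h * f} (pack_edges Pi)"
      using ra f by (auto simp: rainbow_absorber_def)
    have fL: "finite L" using L V finite_subset[of L V] by auto
    have "card L = h * b" using G L BCD fL by (simp add: card_Un_disjoint)
    moreover have "rainbow_factor cv F H L D"
      unfolding rainbow_factor_def using Pi rainbow_reindex[OF _ b1] by blast
    moreover have "rainbow_factor cv F H (B \<union> L) (C \<union> D)"
      unfolding rainbow_factor_def using Pe L rainbow_reindex[OF _ b3] by metis
    ultimately have "L \<in> \<L>" using L BCD fL by (auto simp: \<L>_def nsets_def absorbs_def)
    moreover have "G \<in> K (B \<union> L)" using G L by (fastforce simp: K_def dkgraph_def)
    ultimately show "G \<in> (\<Union>L\<in>\<L>. K (B \<union> L))" by blast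
  qed
  moreover have fin: "finite (B \<union> L)" "card (B \<union> L) \<le> Suc h * b" if "L \<in> \<L>" for L
    using that BCD card_Un_le[of B L] by (auto simp: \<L>_def nsets_def)
  moreover have "finite (K (B \<union> L))" if "L \<in> \<L>" for L
    using card_dkgraphs_on_le(1)[OF fin(1)[OF that]] by (simp add: K_def)
  ultimately have "card \<G> \<le> card (\<Union>L\<in>\<L>. K (B \<union> L))"
    using f\<L> by (intro card_mono) auto
  also have "\<dots> \<le> (\<Sum>L\<in>\<L>. card (K (B \<union> L)))" using f\<L> by (rule card_UN_le)
  also have "\<dots> \<le> (\<Sum>L\<in>\<L>. 2 ^ (2 * 2 ^ (Suc h * b)))"
  proof (rule sum_mono)
    fix L assume L: "L \<in> \<L>"
    have "card (K (B \<union> L)) \<le> 2 ^ (2 * 2 ^ card (B \<union> L))"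
      unfolding K_def by (rule card_dkgraphs_on_le(2)[OF fin(1)[OF L]])
    also have "\<dots> \<le> 2 ^ (2 * 2 ^ (Suc h * b))"
      using fin(2)[OF L] by (intro power_increasing mult_le_mono2) auto
    finally show "card (K (B \<union> L)) \<le> 2 ^ (2 * 2 ^ (Suc h * b))" .
  qed
  finally have "card \<G> \<le> card \<L> * 2 ^ (2 * 2 ^ (Suc h * b))" by simp
  then have "real (card \<G>) \<le> real (card \<L> * 2 ^ (2 * 2 ^ (Suc h * b)))" by (simp only: of_nat_le_iff)
  then have "e * real n ^ (h * b) \<le> card \<L> * 2 ^ (2 * 2 ^ (Suc h * b))" using eG by simp
  then show ?thesis unfolding \<L>_def[symmetric] by (simp add: pos_divide_le_eq)
qed

section \<open>Thresholds and the main theorem\<close>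

text \<open>A d-set lies in at most 2 (n - d choose k - d) directed edges. Constants above 2
  therefore meet the threshold conditions vacuously, which makes the sets under \<open>Inf\<close>
  nonempty.\<close>

lemma not_dense_system:
  assumes rule: "degree_rule k d l N" and d: "d < k" "k \<le> n" and m: "m \<ge> 1" and x: "x > 2"
  shows "\<not> dense_system k d l N x n V m H"
proof
  assume dense: "dense_system k d l N x n V m H"
  then have G: "dkgraph k (H 1)" "verts (H 1) = V" "card V = n" "finite V"
    "x * (n - d choose (k - d)) \<le> min_rule_deg d l N (H 1)"
    using m by (auto simp: dense_system_def dk_system_def)
  have l: "l \<ge> 1" using rule by (simp add: degree_rule_def)
  have "d \<le> card V" using d G by simp
  then obtain S where "S \<subseteq> V" "card S = d" "finite S" using obtain_subset_with_card_n by metis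
  then have S: "S \<in> nsets V d" by (simp add: nsets_def)
  have "x * (n - d choose (k - d)) \<le> card (N (H 1) S 1)"
    using G(5) S l d G min_rule_deg_ge_iff[of "H 1" d l] by auto
  also have "card (N (H 1) S 1) \<le> card {x \<in> edges (H 1). S \<subseteq> fst x}"
    using degree_rule_subset[OF rule G(1)] S l G finite_edges[OF G(1)] by (intro card_mono) auto
  also have "\<dots> \<le> 2 * (n - d choose (k - d))"
    using card_edges_superset_le[OF G(1), of S] S G d by (simp add: nsets_def)
  finally have "x * (n - d choose (k - d)) \<le> 2 * (n - d choose (k - d))" by simp
  moreover have "real (n - d choose (k - d)) > 0" using d by simp
  ultimately show False using x by simp
qed

text \<open>Any y above the infimum exceeds some member c, whose condition is applied with
  \<epsilon> = y - c. Nonnegativity ensures later that the degree bound dominates the loss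
  \<eta>.\<close>

lemma
  fixes F :: "'v::linorder dkgraph"
  assumes rule: "degree_rule k d l N" and d: "d < k" and f: "1 \<le> card (edges F)"
  shows c_cov_nonneg: "0 \<le> c_cov k d l N cv F"
    and c_cov_property: "y > c_cov k d l N cv F \<Longrightarrow> \<forall>\<^sub>F n in sequentially. \<forall>V H.
        dense_system k d l N y n V (card (edges F)) H \<longrightarrow>
        (\<exists>w. perfect_fractional_matching V (copy_sets cv F V H) w)"
proof -
  define X where "X = {c. c > 0 \<and>
     (\<forall>\<epsilon>>0. \<forall>\<^sub>F n in sequentially. \<forall>V H.
        dense_system k d l N (c + \<epsilon>) n V (card (edges F)) H \<longrightarrow>
        (\<exists>w. perfect_fractional_matching V (copy_sets cv F V H) w))}"
  have cX: "c_cov k d l N cv F = Inf X" by (simp add: c_cov_def X_def)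
  have "3 \<in> X"
    unfolding X_def using not_dense_system[OF rule d _ f]
    by (auto intro!: eventually_mono[OF eventually_ge_at_top[of k]])
  then have ne: "X \<noteq> {}" by blast
  show "0 \<le> c_cov k d l N cv F"
    unfolding cX by (rule cInf_greatest[OF ne]) (auto simp: X_def)
  assume "y > c_cov k d l N cv F"
  then obtain c where c: "c \<in> X" "c < y" using cInf_lessD[OF ne] unfolding cX by blast
  then have "y - c > 0" by simp
  with c(1) have "\<forall>\<^sub>F n in sequentially. \<forall>V H.
        dense_system k d l N (c + (y - c)) n V (card (edges F)) H \<longrightarrow>
        (\<exists>w. perfect_fractional_matching V (copy_sets cv F V H) w)"
    unfolding X_def by blast
  then show "\<forall>\<^sub>F n in sequentially. \<forall>V H.
        dense_system k d l N y n V (card (edges F)) H \<longrightarrow>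
        (\<exists>w. perfect_fractional_matching V (copy_sets cv F V H) w)" by simp
qed

text \<open>The infimum is resolved twice, over absorbers and then over constants. As an F-factor
  covers A, and B already has b vertices, |A| is a positive multiple of b; the inner part makes up h
  blocks, possibly none.\<close>

lemma c_abs_property:
  fixes F :: "'v::linorder dkgraph"
  assumes F: "dkgraph k F" and b: "card (verts F) = b" "1 \<le> b" and f: "card (edges F) = f" "1 \<le> f"
    and rule: "degree_rule k d l N" and d: "d < k" and y: "y > c_abs k d l N cv F"
  shows "\<exists>A h e. dkgraph k A \<and> card (verts A) = Suc h * b \<and> e > 0 \<and>
     (\<forall>\<^sub>F n in sequentially. \<forall>V H. dense_system k d l N y n V (Suc h * f) H \<longrightarrow>
        (\<forall>B. B \<subseteq> V \<and> card B = b \<longrightarrow>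
           e * real n ^ (h * b) \<le> card {G. rainbow_absorber cv F V (Suc h * f) H B G \<and> isomorphic cv A G}))"
proof -
  define \<A> where "\<A> = {c_abs_of k d l N cv F A | A. \<exists>B. absorber_for k cv F B A}"
  \<comment> \<open>F absorbs its own vertex set with an empty inner part, so the infimum over
    absorbers has a nonempty range.\<close>
  have "absorber_for k cv F (verts F) F"
    unfolding absorber_for_def
    by (intro conjI F refl exI[of _ "{}"] exI[of _ "{F}"])
      (auto simp: pack_edges_def factor_on_def packing_def isomorphic_refl)
  then have "\<A> \<noteq> {}" by (auto simp: \<A>_def)
  moreover have "Inf \<A> < y" using y by (simp add: \<A>_def c_abs_def)
  ultimately obtain a where "a \<in> \<A>" "a < y" using cInf_lessD by blast
  then obtain A B where AB: "absorber_for k cv F B A" "c_abs_of k d l N cv F A < y"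
    unfolding \<A>_def by auto
  obtain Pext where A: "dkgraph k A" "B \<subseteq> verts A" "card B = b" "factor_on cv F (verts A) Pext"
    using AB(1) b by (auto simp: absorber_for_def)
  have fA: "finite (verts A)" using A by (simp add: dkgraph_def)
  define p where "p = card (verts ` Pext)"
  have cA: "card (verts A) = b * p" using factor_on_card[OF F A(4)] b by (simp add: p_def)
  have "b \<le> card (verts A)" using card_mono[OF fA A(2)] A(3) by simp
  then have "p \<noteq> 0" using b cA by (intro notI) simp
  then obtain h where h: "p = Suc h" using not0_implies_Suc by blast
  have cA': "card (verts A) = Suc h * b" using cA h by (simp add: mult.commute)
  have col: "absorber_colours F A = Suc h * f"
    unfolding absorber_colours_def cA' b f using b(2) by (metis div_mult_self_is_m less_le_trans mult.assoc mult.commute zero_less_one)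
  define X where "X = {c. c > 0 \<and>
     (\<forall>\<epsilon>>0. \<exists>\<epsilon>'>0. \<forall>\<^sub>F n in sequentially. \<forall>V H.
        dense_system k d l N (c + \<epsilon>) n V (Suc h * f) H \<longrightarrow>
        (\<forall>B. B \<subseteq> V \<and> card B = b \<longrightarrow>
           real (card {G. rainbow_absorber cv F V (Suc h * f) H B G \<and> isomorphic cv A G})
             \<ge> \<epsilon>' * real n ^ (h * b)))}"
  have cX: "c_abs_of k d l N cv F A = Inf X"
    unfolding c_abs_of_def X_def col b cA' by simp
  have "1 \<le> Suc h * f" using f by simp
  then have "3 \<in> X"
    unfolding X_def using not_dense_system[OF rule d]
    by (auto intro!: exI[of _ "1::real"] eventually_mono[OF eventually_ge_at_top[of k]])
  then obtain c where c: "c \<in> X" "c < y" using cInf_lessD[of X y] AB(2) unfolding cX by blast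
  then have "y - c > 0" by simp
  with c(1) have "\<exists>\<epsilon>'>0. \<forall>\<^sub>F n in sequentially. \<forall>V H.
        dense_system k d l N (c + (y - c)) n V (Suc h * f) H \<longrightarrow>
        (\<forall>B. B \<subseteq> V \<and> card B = b \<longrightarrow>
           real (card {G. rainbow_absorber cv F V (Suc h * f) H B G \<and> isomorphic cv A G})
             \<ge> \<epsilon>' * real n ^ (h * b))"
    unfolding X_def by blast
  then show ?thesis using A(1) cA' by auto
qed

text \<open>Absorbers, greedy steps and leftover all consume vertices and colours in the ratio b :
  f, so both are exhausted together. The packing hypothesis is stated for every colour assignment
  \<chi>, because the colours left by the absorbers are distributed only here.\<close>

lemma rainbow_factor_assemble:
  fixes F :: "'v::linorder dkgraph"
  assumes F: "dkgraph k F" "1 \<le> k" and b: "card (verts F) = b" and f: "card (edges F) = f"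
    and V: "finite V" "card V = b * N0" and m: "m = f * N0"
    and LD: "\<And>i. i < M \<Longrightarrow> L i \<in> nsets V (h * b) \<and> D i \<in> nsets {1..m} (h * f) \<and> rainbow_factor cv F H (L i) (D i)"
    and disj: "disjoint_family_on L {..<M}" "disjoint_family_on D {..<M}"
    and many: "\<And>B C. B \<in> nsets V b \<Longrightarrow> C \<in> nsets {1..m} f \<Longrightarrow> q \<le> card {i. i < M \<and> absorbs cv F H (L i, D i) (B, C)}"
    and V': "V' = V - (\<Union>i<M. L i)" and N1: "N1 = N0 - M * h" and T: "T \<le> N1" "N1 - T + z \<le> q"
    and almost: "\<And>\<chi>. (\<And>s i. s < T \<Longrightarrow> i \<in> {1..f} \<Longrightarrow> \<chi> s i \<in> {1..m}) \<Longrightarrow>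
       \<exists>E. (\<forall>s<T. E s \<in> nsets V' b) \<and> disjoint_family_on E {..<T} \<and>
         card {s. s < T \<and> E s \<notin> copy_sets cv F V' (\<lambda>i. induced (H (\<chi> s i)) V')} \<le> z"
  shows "rainbow_factor cv F H V {1..m}"
proof -
  define C0 where "C0 = {1..m} - (\<Union>i<M. D i)"
  have L: "L i \<subseteq> V" "finite (L i)" "card (L i) = h * b" "D i \<subseteq> {1..m}" "finite (D i)" "card (D i) = h * f"
    if "i < M" for i using LD[OF that] by (auto simp: nsets_def)
  have V'V: "V' \<subseteq> V" and fV': "finite V'" using V by (auto simp: V')
  have "card (\<Union>i<M. L i) = (\<Sum>i<M. card (L i))"
    using L disj(1) by (intro card_UN_disjoint) (auto simp: disjoint_family_on_def)
  then have "card (\<Union>i<M. L i) = M * h * b" using L by simp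
  then have cV': "card V' = b * N1"
    unfolding V' N1 using V L by (subst card_Diff_subset) (auto simp: diff_mult_distrib2 mult_ac)
  have "card (\<Union>i<M. D i) = (\<Sum>i<M. card (D i))"
    using L disj(2) by (intro card_UN_disjoint) (auto simp: disjoint_family_on_def)
  then have "card (\<Union>i<M. D i) = M * h * f" using L by simp
  then have cC0: "card C0 = f * N1"
  proof -
    have "(\<Union>i<M. D i) \<subseteq> {1..m}" using L(4) by blast
    moreover have "finite (\<Union>i<M. D i)" using L(5) by auto
    ultimately show ?thesis
      unfolding C0_def N1 using m \<open>card (\<Union>i<M. D i) = M * h * f\<close>
      by (simp add: card_Diff_subset diff_mult_distrib2 mult_ac)
  qed
  have fC0: "finite C0" by (simp add: C0_def)
  obtain e where e: "bij_betw e {0..<f * N1} C0" using ex_bij_betw_nat_finite[OF fC0] cC0 by auto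
  \<comment> \<open>Step s owns the s-th block of f remaining colours; i - 1 turns the indices 1,
    ..., f into offsets.\<close>
  define \<chi> where "\<chi> s i = e (s * f + (i - 1))" for s i
  have idx: "s * f + (i - 1) \<in> {0..<f * N1}" "(s * f + (i - 1)) div f = s" if "s < T" "i \<in> {1..f}" for s i
  proof -
    have "i - 1 < f" using that by auto
    then have "s * f + (i - 1) < Suc s * f" by simp
    also have "Suc s * f \<le> N1 * f" using that T by (intro mult_le_mono1) simp
    finally show "s * f + (i - 1) \<in> {0..<f * N1}" by (simp add: mult.commute)
    show "(s * f + (i - 1)) div f = s" using \<open>i - 1 < f\<close> by simp
  qed
  have \<chi>C0: "\<chi> s i \<in> C0" if "s < T" "i \<in> {1..f}" for s i
    using bij_betwE[OF e] idx[OF that] by (auto simp: \<chi>_def)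
  have \<chi>_inj: "s = s' \<and> i = i'" if "\<chi> s i = \<chi> s' i'" "s < T" "i \<in> {1..f}" "s' < T" "i' \<in> {1..f}" for s i s' i'
  proof -
    have eq: "s * f + (i - 1) = s' * f + (i' - 1)"
      using that idx inj_onD[OF bij_betw_imp_inj_on[OF e]] by (auto simp: \<chi>_def)
    then have "s = s'" using idx(2)[OF that(2,3)] idx(2)[OF that(4,5)] by simp
    then show ?thesis using eq that by auto
  qed
  define Ds where "Ds s = \<chi> s ` {1..f}" for s
  have bij: "bij_betw (\<chi> s) {1..f} (Ds s)" if "s < T" for s
  proof -
    have "inj_on (\<chi> s) {1..f}" by (rule inj_onI) (use \<chi>_inj[of s _ s] that in blast)
    then show ?thesis by (simp add: bij_betw_def Ds_def)
  qed
  have Ds: "Ds s \<subseteq> C0" "card (Ds s) = f" "finite (Ds s)" if "s < T" for s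
  proof -
    show "Ds s \<subseteq> C0" using \<chi>C0[OF that] by (auto simp: Ds_def)
    show "card (Ds s) = f" using bij_betw_same_card[OF bij[OF that]] by simp
    show "finite (Ds s)" by (simp add: Ds_def)
  qed
  have Ds_disj: "disjoint_family_on Ds {..<T}"
    unfolding disjoint_family_on_def Ds_def
  proof (intro ballI impI)
    fix s s' assume s: "s \<in> {..<T}" "s' \<in> {..<T}" "s \<noteq> s'"
    then have "\<chi> s i \<noteq> \<chi> s' i'" if "i \<in> {1..f}" "i' \<in> {1..f}" for i i'
      using \<chi>_inj[of s i s' i'] that by auto
    then show "\<chi> s ` {1..f} \<inter> \<chi> s' ` {1..f} = {}" by blast
  qed
  have "\<exists>E. (\<forall>s<T. E s \<in> nsets V' b) \<and> disjoint_family_on E {..<T} \<and>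
         card {s. s < T \<and> E s \<notin> copy_sets cv F V' (\<lambda>i. induced (H (\<chi> s i)) V')} \<le> z"
    by (rule almost) (use \<chi>C0 in \<open>auto simp: C0_def\<close>)
  then obtain E where E: "\<And>s. s < T \<Longrightarrow> E s \<in> nsets V' b" "disjoint_family_on E {..<T}"
    and z: "card {s. s < T \<and> E s \<notin> copy_sets cv F V' (\<lambda>i. induced (H (\<chi> s i)) V')} \<le> z" by blast
  \<comment> \<open>Failed steps are undone: their vertices and colours return to the
    leftover.\<close>
  define Gd where "Gd = {s. s < T \<and> E s \<in> copy_sets cv F V' (\<lambda>i. induced (H (\<chi> s i)) V')}"
  have GdT: "Gd \<subseteq> {..<T}" and fGd: "finite Gd" by (auto simp: Gd_def)
  have Gdz: "T \<le> card Gd + z"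
  proof -
    define Bd where "Bd = {s. s < T \<and> E s \<notin> copy_sets cv F V' (\<lambda>i. induced (H (\<chi> s i)) V')}"
    have "{..<T} = Gd \<union> Bd" unfolding Gd_def Bd_def by blast
    then have "T = card (Gd \<union> Bd)" by (metis card_lessThan)
    then show ?thesis using card_Un_le[of Gd Bd] z by (simp add: Bd_def)
  qed
  have GdN1: "card Gd \<le> N1" using card_mono[OF _ GdT] T by simp
  have EGd: "disjoint_family_on E Gd" "disjoint_family_on Ds Gd"
    using E(2) Ds_disj GdT by (auto intro: disjoint_family_on_mono)
  have rfE: "rainbow_factor cv F H (E s) (Ds s)" if s: "s \<in> Gd" for s
  proof -
    obtain G where G: "E s = verts G" "isomorphic cv F G" "rainbow (\<lambda>i. induced (H (\<chi> s i)) V') {1..f} (edges G)"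
      using s by (auto simp: Gd_def copy_sets_def f)
    have "rainbow (\<lambda>i. H (\<chi> s i)) {1..f} (edges G)"
      by (rule rainbow_mono[where H = "\<lambda>i. induced (H (\<chi> s i)) V'", OF G(3)]) (auto simp: induced_def)
    moreover have "bij_betw (\<chi> s) {1..f} (Ds s)" using bij[of s] s GdT by auto
    ultimately have "rainbow H (Ds s) (edges G)" by (rule rainbow_reindex)
    then show ?thesis using G rainbow_factor_copy by metis
  qed
  have rfG: "rainbow_factor cv F H (\<Union>s\<in>Gd. E s) (\<Union>s\<in>Gd. Ds s)"
    by (rule rainbow_factor_UN[OF F fGd rfE EGd])
  define W where "W = V' - (\<Union>s\<in>Gd. E s)"
  define Cr where "Cr = C0 - (\<Union>s\<in>Gd. Ds s)"
  have Es: "E s \<subseteq> V'" "card (E s) = b" "finite (E s)" if "s \<in> Gd" for s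
    using E(1)[of s] that GdT by (auto simp: nsets_def)
  have Dss: "Ds s \<subseteq> C0" "card (Ds s) = f" "finite (Ds s)" if "s \<in> Gd" for s
    using Ds[of s] that GdT by auto
  have "card (\<Union>s\<in>Gd. E s) = (\<Sum>s\<in>Gd. card (E s))"
    using Es EGd fGd by (intro card_UN_disjoint) (auto simp: disjoint_family_on_def)
  then have "card (\<Union>s\<in>Gd. E s) = card Gd * b" using Es by simp
  then have cW: "card W = b * (N1 - card Gd)"
    unfolding W_def using Es fGd cV' by (subst card_Diff_subset) (auto simp: diff_mult_distrib2 mult_ac)
  have "card (\<Union>s\<in>Gd. Ds s) = (\<Sum>s\<in>Gd. card (Ds s))"
    using Dss EGd fGd by (intro card_UN_disjoint) (auto simp: disjoint_family_on_def)
  then have "card (\<Union>s\<in>Gd. Ds s) = card Gd * f" using Dss by simp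
  then have cCr: "card Cr = f * (N1 - card Gd)"
    unfolding Cr_def using Dss fGd cC0 by (subst card_Diff_subset) (auto simp: diff_mult_distrib2 mult_ac)
  have "rainbow_factor cv F H (W \<union> (\<Union>i\<in>{..<M}. L i)) (Cr \<union> (\<Union>i\<in>{..<M}. D i))"
  proof (rule absorb_leftover[OF F _ disj])
    show "rainbow_factor cv F H (L i) (D i)" if "i \<in> {..<M}" for i using LD that by simp
    show "finite W" "finite Cr" using fV' fC0 by (auto simp: W_def Cr_def)
    show "card W = b * (N1 - card Gd)" "card Cr = f * (N1 - card Gd)" by fact+
    show "W \<inter> L i = {}" "Cr \<inter> D i = {}" if "i \<in> {..<M}" for i
      using that by (auto simp: W_def V' Cr_def C0_def)
    show "N1 - card Gd \<le> card {i \<in> {..<M}. absorbs cv F H (L i, D i) (B, A)}"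
      if "B \<in> nsets W b" "A \<in> nsets Cr f" for B A
    proof -
      have "B \<in> nsets V b" "A \<in> nsets {1..m} f"
        using that V'V by (auto simp: nsets_def W_def Cr_def C0_def)
      then have "q \<le> card {i. i < M \<and> absorbs cv F H (L i, D i) (B, A)}" by (rule many)
      \<comment> \<open>The N1 - T blocks never attempted and the at most z failed ones together
        stay within the capacity q.\<close>
      moreover have "N1 - card Gd \<le> q" using Gdz T by linarith
      ultimately show ?thesis by simp
    qed
  qed simp
  then have "rainbow_factor cv F H ((W \<union> (\<Union>i<M. L i)) \<union> (\<Union>s\<in>Gd. E s)) ((Cr \<union> (\<Union>i<M. D i)) \<union> (\<Union>s\<in>Gd. Ds s))"
  proof (rule rainbow_factor_Un[OF F _ rfG])
    show "(W \<union> (\<Union>i<M. L i)) \<inter> (\<Union>s\<in>Gd. E s) = {}"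
      using Es(1) unfolding W_def V' by blast
    show "(Cr \<union> (\<Union>i<M. D i)) \<inter> (\<Union>s\<in>Gd. Ds s) = {}"
      using Dss(1) unfolding Cr_def C0_def by blast
  qed
  moreover have "(W \<union> (\<Union>i<M. L i)) \<union> (\<Union>s\<in>Gd. E s) = V"
    using Es(1) L(1) unfolding W_def V' by blast
  moreover have "(Cr \<union> (\<Union>i<M. D i)) \<union> (\<Union>s\<in>Gd. Ds s) = {1..m}"
    using Dss(1) L(4) unfolding Cr_def C0_def by blast
  ultimately show ?thesis by simp
qed

text \<open>The case of no colours, where the degree hypotheses are void: any partition into sets of
  the size of F yields a factor.\<close>

lemma rainbow_factor_edgeless:
  assumes F: "dkgraph k F" "1 \<le> k" "edges F = {}" and V: "finite V" "card V = card (verts F) * t"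
  shows "rainbow_factor cv F H V {}"
  using V
proof (induction t arbitrary: V)
  case 0
  then show ?case by (simp add: rainbow_factor_empty)
next
  case (Suc t)
  then have "card (verts F) \<le> card V" by simp
  then obtain B where B: "B \<subseteq> V" "card B = card (verts F)" "finite B"
    using obtain_subset_with_card_n by metis
  obtain \<phi> where "bij_betw \<phi> (verts F) B"
    using finite_same_card_bij[of "verts F" B] B F by (auto simp: dkgraph_def)
  then have "isomorphic cv F (DK B {})" unfolding isomorphic_def using F by auto
  moreover have "rainbow H {} (edges (DK B {}))" by (simp add: rainbow_def bij_betw_def)
  ultimately have "rainbow_factor cv F H B {}" using rainbow_factor_copy by fastforce
  moreover have "rainbow_factor cv F H (V - B) {}"
    using Suc B by (intro Suc.IH) (auto simp: card_Diff_subset)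
  ultimately have "rainbow_factor cv F H (B \<union> (V - B)) ({} \<union> {})"
    by (intro rainbow_factor_Un[OF F(1,2)]) auto
  then show ?case using B by (simp add: Un_absorb1)
qed

text \<open>There are polynomially many demands, while (1 - \<alpha> / 4)^M <= exp(-\<alpha> M / 4)
  and 2^q <= exp(\<alpha> M / 8), so half of the decay survives. The factor exp(\<alpha> / 8) pays
  for rounding M down.\<close>

lemma absorption_failure_bound:
  fixes \<alpha> \<gamma> :: real and n m f b M q :: nat
  assumes \<alpha>: "0 < \<alpha>" "\<alpha> \<le> 1"
    and M: "\<gamma> * n - 1 \<le> M" and q: "q \<le> \<alpha> * M / 8" and m: "m \<le> n * f"
    and small: "real f ^ f * exp (\<alpha> / 8) * real n ^ (b + f) * exp (- (\<alpha> * \<gamma> / 8 * n)) < 1"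
  shows "real n ^ b * real m ^ f * (1 - \<alpha> / 4) ^ M * 2 ^ q < 1"
proof -
  have "real m \<le> real (n * f)" using m by (simp only: of_nat_le_iff)
  then have "real m \<le> real n * real f" by simp
  then have "real n ^ b * real m ^ f \<le> real n ^ b * (real n * f) ^ f"
    by (intro mult_left_mono power_mono) auto
  also have "\<dots> = real f ^ f * real n ^ (b + f)" by (simp add: power_add power_mult_distrib mult_ac)
  finally have 1: "real n ^ b * real m ^ f \<le> real f ^ f * real n ^ (b + f)" .
  have "(1 - \<alpha> / 4) ^ M \<le> exp (- (\<alpha> / 4)) ^ M"
    using \<alpha> exp_ge_add_one_self[of "- (\<alpha> / 4)"] by (intro power_mono) auto
  also have "\<dots> = exp (M * - (\<alpha> / 4))" by (simp only: exp_of_nat_mult)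
  finally have 2: "(1 - \<alpha> / 4) ^ M \<le> exp (M * - (\<alpha> / 4))" .
  have "(2 :: real) ^ q \<le> exp 1 ^ q" using exp_ge_add_one_self[of 1] by (intro power_mono) auto
  also have "\<dots> = exp (real q * 1)" by (simp only: exp_of_nat_mult)
  also have "\<dots> \<le> exp (\<alpha> * M / 8)" using q by simp
  finally have 3: "(2 :: real) ^ q \<le> exp (\<alpha> * M / 8)" .
  have "(1 - \<alpha> / 4) ^ M * 2 ^ q \<le> exp (M * - (\<alpha> / 4)) * exp (\<alpha> * M / 8)"
    using 2 3 by (rule mult_mono) auto
  also have "\<dots> = exp (- (\<alpha> / 8 * M))" by (simp flip: exp_add)
  also have "\<dots> \<le> exp (- (\<alpha> / 8 * (\<gamma> * n - 1)))" using M \<alpha> by simp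
  also have "\<dots> = exp (\<alpha> / 8) * exp (- (\<alpha> * \<gamma> / 8 * n))" by (simp add: right_diff_distrib flip: exp_add)
  finally have 4: "(1 - \<alpha> / 4) ^ M * 2 ^ q \<le> exp (\<alpha> / 8) * exp (- (\<alpha> * \<gamma> / 8 * n))" .
  have "real n ^ b * real m ^ f * (1 - \<alpha> / 4) ^ M * 2 ^ q = (real n ^ b * real m ^ f) * ((1 - \<alpha> / 4) ^ M * 2 ^ q)"
    by simp
  also have "\<dots> \<le> (real f ^ f * real n ^ (b + f)) * (exp (\<alpha> / 8) * exp (- (\<alpha> * \<gamma> / 8 * n)))"
    using 1 4 by (rule mult_mono) (use \<alpha> in auto)
  also have "\<dots> < 1" using small by (simp add: mult_ac)
  finally show ?thesis .
qed

text \<open>With \<mu> = \<alpha> \<gamma> / 64, the capacity q is about 8 \<mu> n, while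
  unattempted and failed blocks number at most 2 \<mu> n + 1. The slack covers the roundings once
  \<mu> n >= 1/2.\<close>

lemma leftover_bound:
  fixes \<alpha> \<gamma> :: real and n N1 T M q z :: nat
  assumes \<alpha>: "0 < \<alpha>" "\<alpha> \<le> 1" and \<gamma>: "0 < \<gamma>" "\<gamma> \<le> 1" and n: "32 / (\<alpha> * \<gamma>) \<le> n" and N1: "N1 \<le> n"
    and T: "T = nat \<lfloor>(1 - \<alpha> * \<gamma> / 64) * N1\<rfloor>" and M: "\<gamma> * n - 1 \<le> M" and q: "q = nat \<lfloor>\<alpha> * M / 8\<rfloor>"
    and z: "z \<le> \<alpha> * \<gamma> / 64 * T"
  shows "T \<le> N1" "N1 - T + z \<le> q"
proof -
  define \<mu> where "\<mu> = \<alpha> * \<gamma> / 64"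
  have ag: "0 < \<alpha> * \<gamma>" "\<alpha> * \<gamma> \<le> 1" using \<alpha> \<gamma> by (auto intro: mult_le_one)
  have \<mu>: "0 < \<mu>" "\<mu> \<le> 1" using ag by (auto simp: \<mu>_def)
  have "0 \<le> (1 - \<mu>) * N1" using \<mu> by simp
  then have T1: "real T \<le> (1 - \<mu>) * N1" "(1 - \<mu>) * N1 - 1 \<le> real T"
    unfolding T \<mu>_def[symmetric] by (simp, linarith)
  have "(1 - \<mu>) * N1 \<le> N1" using \<mu> by (simp add: mult_left_le_one_le)
  then have "real T \<le> real N1" using T1 by linarith
  then show TN: "T \<le> N1" by simp
  have "\<mu> * T \<le> \<mu> * n" "\<mu> * N1 \<le> \<mu> * n" using TN N1 \<mu> by (auto intro!: mult_left_mono)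
  then have 1: "real (N1 - T + z) \<le> 2 * (\<mu> * n) + 1"
    using z T1 TN unfolding \<mu>_def[symmetric] by (simp add: of_nat_diff left_diff_distrib)
  have "real q > \<alpha> * M / 8 - 1"
  proof -
    have "0 \<le> \<alpha> * M / 8" using \<alpha> by simp
    then have "real q = of_int \<lfloor>\<alpha> * M / 8\<rfloor>" unfolding q by simp
    then show ?thesis by linarith
  qed
  moreover have "\<alpha> * M / 8 \<ge> \<alpha> * (\<gamma> * n - 1) / 8" using M \<alpha> by (simp add: mult_left_mono)
  moreover have "\<alpha> * (\<gamma> * n - 1) / 8 = 8 * (\<mu> * n) - \<alpha> / 8" by (simp add: \<mu>_def field_simps)
  moreover have "\<mu> * n \<ge> 1 / 2" using n ag by (simp add: \<mu>_def field_simps)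
  ultimately have "real (N1 - T + z) \<le> real q" using 1 \<alpha> by linarith
  then show "N1 - T + z \<le> q" by simp
qed

lemma dense_rainbow_factor:
  fixes F :: "'v::linorder dkgraph" and \<epsilon> :: real
  assumes F: "dkgraph k F" and b: "card (verts F) = b" "1 \<le> b" and f: "card (edges F) = f" "1 \<le> f"
    and d: "1 \<le> d" "d < k" and rule: "degree_rule k d l N" and \<epsilon>: "\<epsilon> > 0"
  shows "\<forall>\<^sub>F n in sequentially. \<forall>N0 V H. n = b * N0 \<longrightarrow>
    dense_system k d l N (max (c_abs k d l N cv F) (c_cov k d l N cv F) + \<epsilon>) n V (f * N0) H \<longrightarrow>
    rainbow_factor cv F H V {1..f * N0}"
proof -
  define ca cc where "ca = c_abs k d l N cv F" and "cc = c_cov k d l N cv F"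
  \<comment> \<open>The excess \<epsilon> is split four ways: one \<eta> is lost to deleting the
    absorbers, one to passing to Q-sets, and two place the covering property above its threshold.
    The cap at 1 serves the concentration bound.\<close>
  define \<eta> where "\<eta> = min \<epsilon> 1 / 4"
  define x where "x = max ca cc + \<epsilon>"
  have \<eta>: "0 < \<eta>" "\<eta> \<le> 1 / 4" "4 * \<eta> \<le> \<epsilon>" using \<epsilon> by (auto simp: \<eta>_def)
  have f1: "1 \<le> card (edges F)" using f by simp
  have "cc \<ge> 0" unfolding cc_def by (rule c_cov_nonneg[OF rule d(2) f1])
  then have x: "x \<ge> ca + \<eta>" "x - \<eta> \<ge> cc + 2 * \<eta> + \<eta>" "\<eta> \<le> x" using \<eta> by (auto simp: x_def)
  have "ca + \<eta> > c_abs k d l N cv F" using \<eta> by (simp add: ca_def)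
  from c_abs_property[OF F b f rule d(2) this]
  obtain A h e where A: "dkgraph k A" "card (verts A) = Suc h * b" and e: "e > 0"
    and ev_abs: "\<forall>\<^sub>F n in sequentially. \<forall>V H. dense_system k d l N (ca + \<eta>) n V (Suc h * f) H \<longrightarrow>
        (\<forall>B. B \<subseteq> V \<and> card B = b \<longrightarrow>
           e * real n ^ (h * b) \<le> card {G. rainbow_absorber cv F V (Suc h * f) H B G \<and> isomorphic cv A G})"
    by blast
  define c where "c = e / 2 ^ (2 * 2 ^ (Suc h * b))"
  have c: "c > 0" using e by (simp add: c_def)
  define \<alpha> where "\<alpha> = min 1 (c / 2)"
  have \<alpha>: "0 < \<alpha>" "\<alpha> \<le> 1" "\<alpha> \<le> c / 2" using c by (auto simp: \<alpha>_def)
  define S where "S = (h * b)\<^sup>2 + b * (h * f)\<^sup>2"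
  define P where "P = real (h * b * k)"
  have P: "P \<ge> 0" unfolding P_def by (rule of_nat_0_le_iff)
  \<comment> \<open>The first bound limits conflicts among the absorbers, \<open>S\<close>
    collecting the vertex and colour contributions; the second keeps the degree loss from deleting
    their roughly h b \<gamma> n vertices within \<eta>.\<close>
  define \<gamma> where "\<gamma> = min (\<alpha> / (2 * (real S + 1))) (\<eta> / (4 * (P + 1)))"
  have \<gamma>: "0 < \<gamma>" "\<gamma> \<le> \<alpha> / (2 * (real S + 1))" "\<gamma> \<le> \<eta> / (4 * (P + 1))"
    using \<alpha> \<eta> P by (auto simp: \<gamma>_def intro!: divide_pos_pos)
  have \<gamma>S: "2 * \<gamma> * S \<le> \<alpha>"
  proof -
    have "\<gamma> * (2 * (real S + 1)) \<le> \<alpha>" using \<gamma>(2) by (subst (asm) pos_le_divide_eq) auto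
    then show ?thesis using \<gamma>(1) by (simp add: algebra_simps)
  qed
  have \<gamma>k: "4 * \<gamma> * P + 4 * \<gamma> \<le> \<eta>"
  proof -
    have "\<gamma> * (4 * (P + 1)) \<le> \<eta>" using \<gamma>(3) P by (subst (asm) pos_le_divide_eq) auto
    then show ?thesis by (simp add: algebra_simps)
  qed
  have "\<gamma> * P \<ge> 0" using \<gamma> P by simp
  then have \<gamma>1: "\<gamma> \<le> 1" using \<gamma>k \<eta> \<gamma>(1) by linarith
  define \<mu> where "\<mu> = \<alpha> * \<gamma> / 64"
  have \<mu>: "\<mu> > 0" using \<alpha> \<gamma> by (simp add: \<mu>_def)
  have "cc + 2 * \<eta> > c_cov k d l N cv F" using \<eta> by (simp add: cc_def)
  then have "\<forall>\<^sub>F n in sequentially. \<forall>V H. dense_system k d l N (cc + 2 * \<eta>) n V (card (edges F)) H \<longrightarrow>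
        (\<exists>w. perfect_fractional_matching V (copy_sets cv F V H) w)"
    by (rule c_cov_property[OF rule d(2) f1])
  \<comment> \<open>The same \<mu> serves as the uncovered proportion and as the proportion of
    failed steps.\<close>
  note ev = eventually_almost_factor[OF F _ d(2) rule \<eta>(1) _ \<mu> \<mu> this, unfolded b(1) f(1)]
  have "\<eta> \<le> 1" using \<eta> by simp
  from ev[OF b(2) this] obtain n1 where n1: "\<forall>n\<ge>n1. \<forall>V H T. finite V \<and> card V = n \<and> b * T \<le> (1 - \<mu>) * n \<and>
     (\<forall>s<T. \<forall>i\<in>{1..f}. dkgraph k (H s i) \<and> verts (H s i) = V \<and>
         (cc + 2 * \<eta> + \<eta>) * (n - d choose (k - d)) \<le> min_rule_deg d l N (H s i)) \<longrightarrow>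
     (\<exists>E. (\<forall>s<T. E s \<in> nsets V b) \<and> disjoint_family_on E {..<T} \<and>
        card {s. s < T \<and> E s \<notin> copy_sets cv F V (H s)} \<le> \<mu> * T)"
    unfolding eventually_sequentially by (rule exE)
  have almost: "\<exists>E. (\<forall>s<T. E s \<in> nsets V b) \<and> disjoint_family_on E {..<T} \<and>
        card {s. s < T \<and> E s \<notin> copy_sets cv F V (H s)} \<le> \<mu> * T"
    if "n1 \<le> card V" "finite V" "b * T \<le> (1 - \<mu>) * card V"
      "\<And>s i. s < T \<Longrightarrow> i \<in> {1..f} \<Longrightarrow> dkgraph k (H s i) \<and> verts (H s i) = V \<and>
         (cc + 2 * \<eta> + \<eta>) * (card V - d choose (k - d)) \<le> min_rule_deg d l N (H s i)"
    for V H T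
    using n1[rule_format, of "card V" V T H] that by blast
  have "\<forall>\<^sub>F n :: nat in sequentially. real f ^ f * exp (\<alpha> / 8) * real n ^ (b + f) * exp (- (\<alpha> * \<gamma> / 8 * n)) < 1"
    using \<alpha> \<gamma> by (intro eventually_poly_times_exp_less) auto
  moreover have "\<forall>\<^sub>F n :: nat in sequentially. real n \<ge> 32 / (\<alpha> * \<gamma>)"
    by (rule eventually_compose_filterlim[OF eventually_ge_at_top filterlim_real_sequentially])
  \<comment> \<open>The first summand makes the number of colours large enough for
    \<open>absorbing_family\<close>; the others serve \<open>V'\<close>, which keeps at least half
    of the vertices, and the comparison of n / 2 with n - d.\<close>
  moreover have "\<forall>\<^sub>F n in sequentially. n \<ge> b * (f + 2 * f * (h * f) + h * f + 1) + 2 * n1 + 2 * k"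
    by (rule eventually_ge_at_top)
  ultimately show ?thesis
    using ev_abs
  proof eventually_elim
    case (elim n)
    show ?case
      unfolding ca_def[symmetric] cc_def[symmetric] x_def[symmetric]
    proof (intro allI impI)
      fix N0 V and H :: "nat \<Rightarrow> 'v dkgraph"
      assume n: "n = b * N0" and dense: "dense_system k d l N x n V (f * N0) H"
      define m where "m = f * N0"
      define M where "M = nat \<lfloor>\<gamma> * n\<rfloor>"
      define q where "q = nat \<lfloor>\<alpha> * M / 8\<rfloor>"
      have V: "finite V" "card V = n" and H: "\<And>i. i \<in> {1..m} \<Longrightarrow> dkgraph k (H i) \<and> verts (H i) = V"
        and deg: "\<And>i. i \<in> {1..m} \<Longrightarrow> x * (n - d choose (k - d)) \<le> min_rule_deg d l N (H i)"
        using dense by (auto simp: dense_system_def dk_system_def m_def)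
      have nk: "2 * k \<le> n" "b \<le> n" "2 * n1 \<le> n" using elim(3) by auto
      have npos: "n > 0" using nk b by simp
      then have Vne: "V \<noteq> {}" using V by auto
      have "b * (f + 2 * f * (h * f) + h * f + 1) \<le> b * N0" using elim(3) n by simp
      then have N0: "f + 2 * f * (h * f) + h * f + 1 \<le> N0" using b(2) unfolding mult_le_cancel1 by simp
      moreover have "N0 \<le> m" using f by (simp add: m_def)
      ultimately have m_large: "m \<ge> f + 2 * f * (h * f) + h * f + 1" by simp
      have "N0 \<le> n" using n b by simp
      have Mle: "real M \<le> \<gamma> * n" and Mge: "\<gamma> * n - 1 \<le> real M"
        using \<gamma>(1) unfolding M_def by (simp, linarith)
      have dense_abs: "dense_system k d l N (ca + \<eta>) n V m H"
      proof -
        have "(ca + \<eta>) * real (n - d choose (k - d)) \<le> x * (n - d choose (k - d))"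
          using x by (intro mult_right_mono) auto
        then show ?thesis using dense unfolding m_def dense_system_def by force
      qed
      have "\<exists>L D. (\<forall>i<M. L i \<in> nsets V (h * b) \<and> D i \<in> nsets {1..m} (h * f) \<and> rainbow_factor cv F H (L i) (D i)) \<and>
         disjoint_family_on L {..<M} \<and> disjoint_family_on D {..<M} \<and>
         (\<forall>B\<in>nsets V b. \<forall>C\<in>nsets {1..m} f. q \<le> card {i. i < M \<and> absorbs cv F H (L i, D i) (B, C)})"
      proof (rule absorbing_family[OF V(1) Vne f(2) m_large _ \<alpha>])
        show "b \<le> card V" using nk V by simp
        show "c * real (card V ^ (h * b)) \<le> card {L \<in> nsets V (h * b). absorbs cv F H (L, D) (B, C)}"
          if "B \<in> nsets V b" "C \<in> nsets {1..m} f" "D \<in> nsets ({1..m} - C) (h * f)" for B C D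
        proof -
          have "e / 2 ^ (2 * 2 ^ (Suc h * b)) * real n ^ (h * b) \<le> card {L \<in> nsets V (h * b). absorbs cv F H (L, D) (B, C)}"
            by (rule card_absorbs_ge[OF F b f(1) A dense_abs _ that]) (use elim(4) in blast)
          then show ?thesis by (simp add: c_def V(2))
        qed
        show "2 * real M * ((real h * real b)\<^sup>2 / card V + (real h * real f)\<^sup>2 / m) \<le> \<alpha>"
        proof -
          have "real ((h * f)\<^sup>2) / m \<le> real (b * (h * f)\<^sup>2) / n"
          proof -
            have "n \<le> b * m" using f n by (simp add: m_def)
            then have "real n \<le> real b * real m" by (metis of_nat_le_iff of_nat_mult)
            then have "real ((h * f)\<^sup>2) * real n \<le> real ((h * f)\<^sup>2) * (real b * real m)"
              by (intro mult_left_mono) auto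
            moreover have "real m > 0" "real n > 0" using m_large npos by auto
            ultimately show ?thesis by (simp add: divide_simps mult_ac)
          qed
          then have "real ((h * b)\<^sup>2) / card V + real ((h * f)\<^sup>2) / m \<le> real S / n"
            unfolding V S_def by (simp add: add_divide_distrib)
          then have "2 * real M * (real ((h * b)\<^sup>2) / card V + real ((h * f)\<^sup>2) / m) \<le> 2 * (\<gamma> * n) * (real S / n)"
            using Mle by (intro mult_mono) auto
          also have "\<dots> = 2 * \<gamma> * S" using npos by simp
          finally have "2 * real M * (real ((h * b)\<^sup>2) / card V + real ((h * f)\<^sup>2) / m) \<le> \<alpha>" using \<gamma>S by linarith
          then show ?thesis by simp
        qed
        have "0 \<le> \<alpha> * M / 8" using \<alpha> by simp
        then have "real q \<le> \<alpha> * M / 8" unfolding q_def by linarith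
        moreover have "m \<le> n * f" using \<open>N0 \<le> n\<close> by (simp add: m_def mult.commute)
        ultimately have "real n ^ b * real m ^ f * (1 - \<alpha> / 4) ^ M * 2 ^ q < 1"
          by (intro absorption_failure_bound[OF \<alpha>(1,2) Mge _ _ elim(1)])
        then show "real (card V ^ b * m ^ f) * (1 - \<alpha> / 4) ^ M * 2 ^ q < 1" using V by simp
      qed
      then obtain L D where LD: "\<And>i. i < M \<Longrightarrow> L i \<in> nsets V (h * b) \<and> D i \<in> nsets {1..m} (h * f) \<and> rainbow_factor cv F H (L i) (D i)"
        and disj: "disjoint_family_on L {..<M}" "disjoint_family_on D {..<M}"
        and many: "\<And>B C. B \<in> nsets V b \<Longrightarrow> C \<in> nsets {1..m} f \<Longrightarrow> q \<le> card {i. i < M \<and> absorbs cv F H (L i, D i) (B, C)}"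
        by blast
      define V' where "V' = V - (\<Union>i<M. L i)"
      define N1 where "N1 = N0 - M * h"
      define T where "T = nat \<lfloor>(1 - \<alpha> * \<gamma> / 64) * N1\<rfloor>"
      define z where "z = nat \<lfloor>\<mu> * T\<rfloor>"
      have Li: "L i \<subseteq> V" "finite (L i)" "card (L i) = h * b" if "i < M" for i using LD[OF that] by (auto simp: nsets_def)
      have V'V: "V' \<subseteq> V" "finite V'" using V by (auto simp: V'_def)
      have UV: "(\<Union>i<M. L i) \<subseteq> V" "finite (\<Union>i<M. L i)" using Li by auto
      have "card (\<Union>i<M. L i) = (\<Sum>i<M. card (L i))"
        using Li disj(1) by (intro card_UN_disjoint) (auto simp: disjoint_family_on_def)
      then have cU: "card (\<Union>i<M. L i) = M * h * b" using Li by simp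
      have cV': "card V' = n - M * h * b" unfolding V'_def using card_Diff_subset[OF UV(2,1)] cU V by simp
      then have cV'': "card V' = b * N1" by (simp add: n N1_def diff_mult_distrib2 mult_ac)
      have cVV': "card (V - V') = M * h * b" using UV cU by (simp add: V'_def double_diff)
      have Mhb: "real (M * h * b) \<le> \<gamma> * real (h * b) * n"
        using mult_right_mono[OF Mle, of "real (h * b)"] by (simp add: mult_ac)
      have Mhb4: "4 * (M * h * b) \<le> n"
      proof -
        have "h * b \<le> h * b * k" using d by simp
        then have "\<gamma> * real (h * b) \<le> \<gamma> * P"
          unfolding P_def using \<gamma>(1) by (intro mult_left_mono) (simp_all only: of_nat_le_iff less_imp_le)
        then have "4 * (\<gamma> * real (h * b)) \<le> 1" using \<gamma>k \<eta> \<gamma>(1) by linarith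
        then have "4 * (\<gamma> * real (h * b)) * n \<le> 1 * real n" by (rule mult_right_mono) simp
        then have "real (4 * (M * h * b)) \<le> real n" using Mhb by simp
        then show ?thesis by (simp only: of_nat_le_iff)
      qed
      then have n'_half: "n \<le> 2 * card V'" using cV' by linarith
      have N1n: "N1 \<le> n" using \<open>N0 \<le> n\<close> by (simp add: N1_def)
      have zT: "real z \<le> \<alpha> * \<gamma> / 64 * T" using \<mu> by (simp add: z_def flip: \<mu>_def)
      have TN: "T \<le> N1" "N1 - T + z \<le> q"
        using leftover_bound[OF \<alpha>(1,2) \<gamma>(1) \<gamma>1 elim(2) N1n T_def Mge q_def zT] by auto
      have degV': "(cc + 2 * \<eta> + \<eta>) * (card V' - d choose (k - d)) \<le> min_rule_deg d l N (induced (H i) V')"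
        if i: "i \<in> {1..m}" for i
      proof -
        have "(x - \<eta>) * (card V' - d choose (k - d)) \<le> min_rule_deg d l N (induced (H i) V')"
        proof (rule min_rule_deg_induced_ge[OF rule])
          show "dkgraph k (H i)" "d < k" "k \<le> card (verts (H i))" "V' \<subseteq> verts (H i)" "d \<le> card V'" "\<eta> \<le> x"
            using H[OF i] d V V'V nk n'_half x by auto
          show "x * (card (verts (H i)) - d choose (k - d)) \<le> min_rule_deg d l N (H i)"
            using H[OF i] deg[OF i] V by simp
          have "2 * real (M * h * b) * real (k - d) \<le> 2 * (\<gamma> * real (h * b) * n) * real k"
            using Mhb \<gamma>(1) by (intro mult_mono) auto
          also have "\<dots> = (4 * \<gamma> * P) * n / 2" by (simp add: P_def)
          also have "\<dots> \<le> \<eta> * n / 2"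
            using \<gamma>k \<gamma>(1) by (intro divide_right_mono mult_right_mono) auto
          also have "\<dots> \<le> \<eta> * (real n - d)"
          proof -
            have "real n / 2 \<le> real n - d" using nk d by linarith
            then show ?thesis using mult_left_mono[of "real n / 2" "real n - d" \<eta>] \<eta> by simp
          qed
          finally show "real (2 * card (verts (H i) - V')) * real (k - d) \<le> \<eta> * real (card (verts (H i)) - d)"
            using H[OF i] V cVV' nk d by (simp add: of_nat_diff)
        qed
        moreover have "(cc + 2 * \<eta> + \<eta>) * real (card V' - d choose (k - d)) \<le> (x - \<eta>) * (card V' - d choose (k - d))"
          using x by (intro mult_right_mono) auto
        ultimately show ?thesis by linarith
      qed
      have "rainbow_factor cv F H V {1..m}"
      proof (rule rainbow_factor_assemble[OF F _ b(1) f(1) V(1) _ m_def LD disj many V'_def N1_def TN])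
        show "1 \<le> k" using d by simp
        show "card V = b * N0" using V n by simp
        fix \<chi> :: "nat \<Rightarrow> nat \<Rightarrow> nat"
        assume \<chi>: "\<And>s i. s < T \<Longrightarrow> i \<in> {1..f} \<Longrightarrow> \<chi> s i \<in> {1..m}"
        have "\<exists>E. (\<forall>s<T. E s \<in> nsets V' b) \<and> disjoint_family_on E {..<T} \<and>
          card {s. s < T \<and> E s \<notin> copy_sets cv F V' (\<lambda>i. induced (H (\<chi> s i)) V')} \<le> \<mu> * T"
        proof (rule almost[OF _ V'V(2)])
          show "n1 \<le> card V'" using nk n'_half by linarith
          show "b * T \<le> (1 - \<mu>) * card V'"
          proof -
            have "0 \<le> (1 - \<mu>) * N1"
              unfolding \<mu>_def using \<alpha> \<gamma> \<gamma>1 mult_le_one[of \<alpha> \<gamma>] by simp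
            then have "real T \<le> (1 - \<mu>) * N1" by (simp add: T_def \<mu>_def)
            then have "b * real T \<le> b * ((1 - \<mu>) * N1)" by (rule mult_left_mono) simp
            then show ?thesis by (simp add: cV'' mult_ac)
          qed
          fix s i assume "s < T" "i \<in> {1..f}"
          then have i: "\<chi> s i \<in> {1..m}" by (rule \<chi>)
          show "dkgraph k (induced (H (\<chi> s i)) V') \<and> verts (induced (H (\<chi> s i)) V') = V' \<and>
             (cc + 2 * \<eta> + \<eta>) * (card V' - d choose (k - d)) \<le> min_rule_deg d l N (induced (H (\<chi> s i)) V')"
            using H[OF i] dkgraph_induced[of k "H (\<chi> s i)"] verts_induced[of V' "H (\<chi> s i)"] V'V degV'[OF i] by auto
        qed
        then obtain E where E: "\<forall>s<T. E s \<in> nsets V' b" "disjoint_family_on E {..<T}"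
          "card {s. s < T \<and> E s \<notin> copy_sets cv F V' (\<lambda>i. induced (H (\<chi> s i)) V')} \<le> \<mu> * T" by blast
        have "card {s. s < T \<and> E s \<notin> copy_sets cv F V' (\<lambda>i. induced (H (\<chi> s i)) V')} \<le> z"
          unfolding z_def using E(3) by (simp add: le_nat_iff le_floor_iff)
        then show "\<exists>E. (\<forall>s<T. E s \<in> nsets V' b) \<and> disjoint_family_on E {..<T} \<and>
          card {s. s < T \<and> E s \<notin> copy_sets cv F V' (\<lambda>i. induced (H (\<chi> s i)) V')} \<le> z"
          using E by blast
      qed
      then show "rainbow_factor cv F H V {1..f * N0}" by (simp add: m_def)
    qed
  qed
qed

theorem theorem2p1:
  fixes F :: "'v::linorder dkgraph"
    and k d l b f :: nat
    and N :: "'v dkgraph \<Rightarrow> 'v set \<Rightarrow> nat \<Rightarrow> 'v dedge set"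
    and cv :: dir_conv
    and \<epsilon> :: real
  assumes "dkgraph k F" and "card (verts F) = b" and "card (edges F) = f"
    and "d \<in> {1..k - 1}"
    and "degree_rule k d l N"
    and "\<epsilon> > 0"
  shows "\<forall>\<^sub>F n in sequentially. b dvd n \<longrightarrow>
    (\<forall>V H. dk_system k V (n * f div b) H \<and> card V = n \<and>
       (\<forall>i\<in>{1..n * f div b}. real (min_rule_deg d l N (H i)) \<ge>
          (max (c_abs k d l N cv F) (c_cov k d l N cv F) + \<epsilon>) * real ((n - d) choose (k - d)))
     \<longrightarrow> has_rainbow_factor cv F V (n * f div b) H)"
proof -
  have d: "1 \<le> d" "d < k" using assms(4) by auto
  consider (b0) "b = 0" | (f0) "b \<ge> 1" "f = 0" | (main) "b \<ge> 1" "f \<ge> 1" by linarith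
  then show ?thesis
  proof cases
    case b0
    \<comment> \<open>Divisibility by 0 forces n = 0, so every positive n qualifies.\<close>
    then show ?thesis by (intro eventually_mono[OF eventually_gt_at_top[of 0]]) auto
  next
    case f0
    have "edges F = {}" using f0 assms(3) finite_edges[OF assms(1)] by simp
    have "has_rainbow_factor cv F V 0 H" if V: "b dvd card V" "finite V" for V H
    proof -
      obtain t where "card V = card (verts F) * t" using V assms(2) by (auto elim: dvdE)
      then have "rainbow_factor cv F H V {}"
        using d by (intro rainbow_factor_edgeless[OF assms(1) _ \<open>edges F = {}\<close> V(2)]) auto
      then show ?thesis by (simp add: has_rainbow_factor_def rainbow_factor_def)
    qed
    then show ?thesis using f0 by (auto simp: dk_system_def)
  next
    case main
    from dense_rainbow_factor[OF assms(1,2) main(1) assms(3) main(2) d assms(5,6), of cv]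
    show ?thesis
    proof eventually_elim
      case (elim n)
      show ?case
      proof (intro impI allI, elim conjE)
        fix V H
        assume "b dvd n" and sys: "dk_system k V (n * f div b) H" "card V = n"
          and deg: "\<forall>i\<in>{1..n * f div b}. real (min_rule_deg d l N (H i)) \<ge>
          (max (c_abs k d l N cv F) (c_cov k d l N cv F) + \<epsilon>) * real ((n - d) choose (k - d))"
        then obtain N0 where n: "n = b * N0" by blast
        then have m: "n * f div b = f * N0" using main by simp
        have "dense_system k d l N (max (c_abs k d l N cv F) (c_cov k d l N cv F) + \<epsilon>) n V (f * N0) H"
          using sys deg unfolding dense_system_def m by blast
        then have "rainbow_factor cv F H V {1..f * N0}" using elim n by blast
        then show "has_rainbow_factor cv F V (n * f div b) H"
          unfolding m by (simp add: has_rainbow_factor_def rainbow_factor_def)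
      qed
    qed
  qed
qed

end
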